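(* Suppose $f:O\to\mathbb{R}^n$ is $C^k$ with $k\in\mathbb{N}$, and let $\varphi:\mathcal{D}^\varphi\to O$ be the maximal semiflow generated by the delay equation $\dot x(t)=f(x_t)$. Given $u\in O$, there exist $t>0$ small enough and a neighbourhood $U\subset\mathcal{D}^\varphi_t$ of $u$ such that $\varphi_t|_U$ is $C^k$. Moreover, $(s,w)\mapsto D^j\varphi_s(w)[v_1,\dots,v_j]$ is jointly continuous on $[0,t]\times U$ for each integer $j\le k$ and fixed $v_i\in X$, $1\le i\le j$.
   Context: Fix $h>0$, $n\in\mathbb{N}$. $X=C([-h,0];\mathbb{R}^n)$ with the supremum norm; $O\subset X$ is open. For a function $x$ on $[-h,t^* )$, $x_t\in X$ is $x_t(\theta)=x(t+\theta)$. For locally Lipschitz $f$ and each $u\in O$, the delay equation $\dot x(t)=f(x_t)$, $x_0=u$, has a unique maximal solution (continuous on $[-h,t^* )$, continuously differentiable on $(0,t^* )$ and satisfying the equation there, with right derivative $f(u)$ at $0$); $\varphi_t(u):=x_t$ defines a maximal local semiflow $\varphi:\mathcal{D}^\varphi\to O$ on an open set $\mathcal{D}^\varphi\subset[0,\infty)\times O$, and $\mathcal{D}^\varphi_t=\{u\in O\mid(t,u)\in\mathcal{D}^\varphi\}$. $\varphi$ is jointly continuous. $C^k$ is meant in the Fréchet sense. *)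

theory Defs
  imports "HOL-Analysis.Analysis"
begin

section \<open>Frechet derivatives of arbitrary order\<close>

text \<open>
  Everything is relative to a linear subspace \<open>X\<close> of a normed type, so that the calculus of the
  normed space \<open>X\<close> itself is available although \<open>X\<close> is not a type.  The order of
  differentiation varies, hence the space of bounded \<open>j\<close>-linear maps is not a type either: such
  a map is represented by its values on lists of length \<open>j\<close> with entries in \<open>X\<close>, and only
  these values matter.
\<close>

text \<open>The operator norm of the \<open>j\<close>-linear map \<open>L\<close> on \<open>X\<close> is at most \<open>c\<close>.\<close>

definition multilinear_norm_le ::
  "'a::real_normed_vector set \<Rightarrow> nat \<Rightarrow> ('a list \<Rightarrow> 'b::real_normed_vector) \<Rightarrow> real \<Rightarrow> bool" where
  "multilinear_norm_le X j L c \<longleftrightarrow>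
     (\<forall>vs. length vs = j \<and> set vs \<subseteq> X \<longrightarrow> norm (L vs) \<le> c * prod_list (map norm vs))"

definition bounded_multilinear_on ::
  "'a::real_normed_vector set \<Rightarrow> nat \<Rightarrow> ('a list \<Rightarrow> 'b::real_normed_vector) \<Rightarrow> bool" where
  "bounded_multilinear_on X j L \<longleftrightarrow>
     (\<forall>vs i. length vs = j \<and> set vs \<subseteq> X \<and> i < j \<longrightarrow>
        (\<forall>a\<in>X. \<forall>b\<in>X. L (vs[i := a + b]) = L (vs[i := a]) + L (vs[i := b])) \<and>
        (\<forall>a\<in>X. \<forall>c::real. L (vs[i := c *\<^sub>R a]) = c *\<^sub>R L (vs[i := a]))) \<and>
     (\<exists>K. multilinear_norm_le X j L K)"

text \<open>
  \<open>D j x [v\<^sub>1, \<dots>, v\<^sub>j]\<close> is the \<open>j\<close>-th Frechet derivative of \<open>g\<close> at \<open>x\<close>, for \<open>j \<le> k\<close>: with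
  respect to the operator norm, \<open>D j\<close> has Frechet derivative \<open>D (Suc j)\<close>, where \<open>j + 1\<close>-linear
  maps are identified with linear maps into the \<open>j\<close>-linear maps by \<open>v \<mapsto> (vs \<mapsto> L (v # vs))\<close>.
  If \<open>U\<close> is open in \<open>X\<close>, these conditions determine \<open>D j x vs\<close> for \<open>x \<in> U\<close>, \<open>j \<le> k\<close> and
  \<open>set vs \<subseteq> X\<close>.
\<close>

definition has_frechet_derivatives_on ::
  "'a::real_normed_vector set \<Rightarrow> nat \<Rightarrow> 'a set \<Rightarrow> ('a \<Rightarrow> 'b::real_normed_vector) \<Rightarrow>
    (nat \<Rightarrow> 'a \<Rightarrow> 'a list \<Rightarrow> 'b) \<Rightarrow> bool" where
  "has_frechet_derivatives_on X k U g D \<longleftrightarrow>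
     (\<forall>x\<in>U. D 0 x [] = g x) \<and>
     (\<forall>j\<le>k. \<forall>x\<in>U. bounded_multilinear_on X j (D j x)) \<and>
     (\<forall>j<k. \<forall>x\<in>U. \<forall>\<epsilon>>0. \<forall>\<^sub>F y in at x within U.
        multilinear_norm_le X j (\<lambda>vs. D j y vs - D j x vs - D (Suc j) x ((y - x) # vs))
          (\<epsilon> * norm (y - x)))"

definition C_k_on ::
  "'a::real_normed_vector set \<Rightarrow> nat \<Rightarrow> 'a set \<Rightarrow> ('a \<Rightarrow> 'b::real_normed_vector) \<Rightarrow> bool" where
  "C_k_on X k U g \<longleftrightarrow>
     (\<exists>D. has_frechet_derivatives_on X k U g D \<and>
        (\<forall>x\<in>U. \<forall>\<epsilon>>0. \<forall>\<^sub>F y in at x within U.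
           multilinear_norm_le X k (\<lambda>vs. D k y vs - D k x vs) \<epsilon>))"


section \<open>The space of histories\<close>

text \<open>
  \<open>C([-h, 0]; \<real>\<^sup>n)\<close> with the supremum norm.  A continuous function on \<open>[-h, 0]\<close> is identified
  with its extension to \<open>\<real>\<close> that is constant on both sides of the interval; the two lemmas below
  show that this identification is a bijection and that the norm is the supremum norm.
\<close>

definition history_space :: "real \<Rightarrow> (real \<Rightarrow>\<^sub>C (real^'n)) set" where
  "history_space h = {u. apply_bcontfun u = ext_cont (apply_bcontfun u) (-h) 0}"

lemma history_space_ex1:
  fixes g :: "real \<Rightarrow> real^'n"
  assumes "h > 0" and "continuous_on {-h..0} g"
  shows "\<exists>!u. u \<in> history_space h \<and> (\<forall>\<theta>\<in>{-h..0}. apply_bcontfun u \<theta> = g \<theta>)"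
proof -
  have cl: "clamp (-h) 0 \<theta> \<in> {-h..0}" for \<theta>
    using clamp_in_interval[of "-h" 0 \<theta>] assms(1) by (simp add: cbox_interval)
  have "ext_cont g (-h) 0 \<in> bcontfun"
    using assms by (auto simp: bcontfun_def ext_cont_def cbox_interval
        intro!: clamp_continuous_on clamp_bounded compact_imp_bounded[OF compact_continuous_image])
  then have u: "apply_bcontfun (Bcontfun (ext_cont g (-h) 0)) x = g (clamp (-h) 0 x)" for x
    by (simp add: Bcontfun_inverse ext_cont_def)
  define u where "u = Bcontfun (ext_cont g (-h) 0)"
  note u = u[folded u_def]
  show ?thesis
  proof (rule ex1I[of _ u])
    show "u \<in> history_space h \<and> (\<forall>\<theta>\<in>{-h..0}. apply_bcontfun u \<theta> = g \<theta>)"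
      using cl by (auto simp: history_space_def ext_cont_def u fun_eq_iff cbox_interval)
  next
    fix w assume w: "w \<in> history_space h \<and> (\<forall>\<theta>\<in>{-h..0}. apply_bcontfun w \<theta> = g \<theta>)"
    then have "apply_bcontfun w x = apply_bcontfun w (clamp (-h) 0 x)" for x
      unfolding history_space_def ext_cont_def by (metis (mono_tags) mem_Collect_eq)
    then show "w = u" using w cl by (intro bcontfun_eqI) (metis u)
  qed
qed

lemma norm_history_space:
  fixes u :: "real \<Rightarrow>\<^sub>C (real^'n)"
  assumes "h > 0" and "u \<in> history_space h"
  shows "norm u = (SUP \<theta>\<in>{-h..0}. norm (apply_bcontfun u \<theta>))"
proof -
  have cl: "clamp (-h) 0 \<theta> \<in> {-h..0}" for \<theta>
    using clamp_in_interval[of "-h" 0 \<theta>] assms(1) by (simp add: cbox_interval)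
  have "apply_bcontfun u x = apply_bcontfun u (clamp (-h) 0 x)" for x
    using assms(2) unfolding history_space_def ext_cont_def by (metis (mono_tags) mem_Collect_eq)
  then have "range (\<lambda>x. norm (apply_bcontfun u x)) = (\<lambda>x. norm (apply_bcontfun u x)) ` {-h..0}"
    using cl by (metis (mono_tags, lifting) image_eqI image_subset_iff subset_UNIV image_mono subset_antisym)
  moreover have "norm u = (SUP x. norm (apply_bcontfun u x))"
    by (simp add: norm_bcontfun_def dist_bcontfun.rep_eq)
  ultimately show ?thesis by simp
qed

text \<open>The segment \<open>x\<^sub>t\<close>; meaningful if \<open>x\<close> is continuous on \<open>[t - h, t]\<close>.\<close>

definition segment :: "real \<Rightarrow> (real \<Rightarrow> real^'n) \<Rightarrow> real \<Rightarrow> (real \<Rightarrow>\<^sub>C (real^'n))" where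
  "segment h x t = Bcontfun (ext_cont (\<lambda>\<theta>. x (t + \<theta>)) (-h) 0)"


section \<open>The delay equation and its semiflow\<close>

text \<open>
  In all of the following, \<open>f\<close> is the right-hand side, with domain \<open>\<Omega> \<subseteq> history_space h\<close>.
  The function \<open>x\<close> is a solution on \<open>[-h, T)\<close>, where \<open>0 < T \<le> \<infinity>\<close>; its values outside this
  interval are irrelevant.
\<close>

definition dde_solution ::
  "real \<Rightarrow> (real \<Rightarrow>\<^sub>C (real^'n)) set \<Rightarrow> ((real \<Rightarrow>\<^sub>C (real^'n)) \<Rightarrow> real^'n) \<Rightarrow> (real \<Rightarrow>\<^sub>C (real^'n)) \<Rightarrow>
    ereal \<Rightarrow> (real \<Rightarrow> real^'n) \<Rightarrow> bool" where
  "dde_solution h \<Omega> f u T x \<longleftrightarrow>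
     0 < T \<and>
     continuous_on {t. -h \<le> t \<and> ereal t < T} x \<and>
     (\<forall>\<theta>\<in>{-h..0}. x \<theta> = apply_bcontfun u \<theta>) \<and>
     (\<forall>t. 0 \<le> t \<and> ereal t < T \<longrightarrow> segment h x t \<in> \<Omega>) \<and>
     (\<forall>t. 0 < t \<and> ereal t < T \<longrightarrow> (x has_vector_derivative f (segment h x t)) (at t)) \<and>
     continuous_on {t. 0 < t \<and> ereal t < T} (\<lambda>t. vector_derivative x (at t)) \<and>
     (x has_vector_derivative f u) (at_right 0)"

definition maximal_dde_solution ::
  "real \<Rightarrow> (real \<Rightarrow>\<^sub>C (real^'n)) set \<Rightarrow> ((real \<Rightarrow>\<^sub>C (real^'n)) \<Rightarrow> real^'n) \<Rightarrow> (real \<Rightarrow>\<^sub>C (real^'n)) \<Rightarrow>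
    ereal \<Rightarrow> (real \<Rightarrow> real^'n) \<Rightarrow> bool" where
  "maximal_dde_solution h \<Omega> f u T x \<longleftrightarrow>
     dde_solution h \<Omega> f u T x \<and>
     (\<forall>S y. dde_solution h \<Omega> f u S y \<and> T \<le> S \<and> (\<forall>t. -h \<le> t \<and> ereal t < T \<longrightarrow> y t = x t) \<longrightarrow>
        S = T)"

text \<open>
  For locally Lipschitz \<open>f\<close> the maximal solution exists and is unique on \<open>[-h, T)\<close>; the choice
  made below only concerns its irrelevant values outside this interval.
\<close>

definition lifetime ::
  "real \<Rightarrow> (real \<Rightarrow>\<^sub>C (real^'n)) set \<Rightarrow> ((real \<Rightarrow>\<^sub>C (real^'n)) \<Rightarrow> real^'n) \<Rightarrow> (real \<Rightarrow>\<^sub>C (real^'n)) \<Rightarrow>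
    ereal" where
  "lifetime h \<Omega> f u = (THE T. \<exists>x. maximal_dde_solution h \<Omega> f u T x)"

definition the_dde_solution ::
  "real \<Rightarrow> (real \<Rightarrow>\<^sub>C (real^'n)) set \<Rightarrow> ((real \<Rightarrow>\<^sub>C (real^'n)) \<Rightarrow> real^'n) \<Rightarrow> (real \<Rightarrow>\<^sub>C (real^'n)) \<Rightarrow>
    real \<Rightarrow> real^'n" where
  "the_dde_solution h \<Omega> f u = (SOME x. maximal_dde_solution h \<Omega> f u (lifetime h \<Omega> f u) x)"

definition semiflow_domain ::
  "real \<Rightarrow> (real \<Rightarrow>\<^sub>C (real^'n)) set \<Rightarrow> ((real \<Rightarrow>\<^sub>C (real^'n)) \<Rightarrow> real^'n) \<Rightarrow>
    (real \<times> (real \<Rightarrow>\<^sub>C (real^'n))) set" where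
  "semiflow_domain h \<Omega> f = {(t, u). 0 \<le> t \<and> u \<in> \<Omega> \<and> ereal t < lifetime h \<Omega> f u}"

definition semiflow ::
  "real \<Rightarrow> (real \<Rightarrow>\<^sub>C (real^'n)) set \<Rightarrow> ((real \<Rightarrow>\<^sub>C (real^'n)) \<Rightarrow> real^'n) \<Rightarrow>
    real \<Rightarrow> (real \<Rightarrow>\<^sub>C (real^'n)) \<Rightarrow> (real \<Rightarrow>\<^sub>C (real^'n))" where
  "semiflow h \<Omega> f t u = segment h (the_dde_solution h \<Omega> f u) t"

end

theory Submission
  imports Defs
begin

text \<open>
  A function in \<open>history_space h\<close> is already extended to the real line as a constant, so the whole
  Banach space \<open>W\<close> of bounded continuous functions can serve as the space of candidate solutions.
  On a short interval \<open>[0, T]\<close> the delay equation with initial value \<open>w\<close> is the fixed point equation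
  \<open>x = w + K x\<close> in \<open>W\<close>, where \<open>K x (s)\<close> is the integral of \<open>f (x\<^sub>r)\<close> over \<open>0 \<le> r \<le> s\<close>, with \<open>s\<close>
  clamped to \<open>[0, T]\<close>.  \<open>K\<close> is \<open>C\<^sup>k\<close>, because differentiability is uniform along the compact curve
  \<open>r \<mapsto> x\<^sub>r\<close>, and it is a contraction near \<open>u\<close>.  Hence the solution \<open>\<psi> w\<close> has derivative
  \<open>(1 - K'(\<psi> w))\<^sup>-\<^sup>1\<close>, and by induction on the order \<open>\<psi>\<close> is \<open>C\<^sup>k\<close>.  The semiflow at time \<open>s\<close> is the
  linear map \<open>x \<mapsto> x\<^sub>s\<close> composed with \<open>\<psi>\<close>; since only this linear map depends on \<open>s\<close>, and
  \<open>(s, x) \<mapsto> x\<^sub>s\<close> is continuous, all derivatives are jointly continuous.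
\<close>

section \<open>Families of multilinear maps\<close>

text \<open>The history space is not a type, so the calculus is done on the whole Banach space and
  transferred at both ends: taking the segment at time \<open>0\<close> is a linear projection onto
  \<open>history_space h\<close> of norm at most one. Hence \<open>f\<close> composed with it is as
  smooth as \<open>f\<close>, on a set that is open in the whole space, and points and directions
  can be restricted again at the end. Spaces of multilinear maps are not types either. The induction
  on the order therefore needs one operation that is closed under differentiation and covers both
  the chain rule and the derivative \<open>A T' A\<close> of \<open>A = (1 - T)^-1\<close>:
  inserting one multilinear family into a slot of another. The analytic obstacle is superposition,
  since the supremum norm demands a single radius for all times, whereas differentiability of
  \<open>f\<close> gives one for each point. Finally, the semiflow is defined through a description
  and a choice, so the fixed point has to be identified with it by uniqueness; the Lipschitz
  property that this requires comes from the first derivative.\<close>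

abbreviation mlin_norm_le :: "nat \<Rightarrow> ('a::real_normed_vector list \<Rightarrow> 'b::real_normed_vector) \<Rightarrow> real \<Rightarrow> bool" where
  "mlin_norm_le \<equiv> multilinear_norm_le UNIV"

abbreviation bdd_mlin :: "nat \<Rightarrow> ('a::real_normed_vector list \<Rightarrow> 'b::real_normed_vector) \<Rightarrow> bool" where
  "bdd_mlin \<equiv> bounded_multilinear_on UNIV"

lemma prod_norm_nonneg [simp]: "0 \<le> prod_list (map norm vs)"
  by (induction vs) auto

lemma mlin_norm_le_iff:
  "mlin_norm_le j L c \<longleftrightarrow> (\<forall>vs. length vs = j \<longrightarrow> norm (L vs) \<le> c * prod_list (map norm vs))"
  by (auto simp: multilinear_norm_le_def)

lemma mlin_norm_le_D: "mlin_norm_le j L c \<Longrightarrow> length vs = j \<Longrightarrow> norm (L vs) \<le> c * prod_list (map norm vs)"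
  by (auto simp: mlin_norm_le_iff)

lemma mlin_norm_le_mono: "mlin_norm_le j L c \<Longrightarrow> c \<le> d \<Longrightarrow> mlin_norm_le j L d"
  unfolding mlin_norm_le_iff by (auto intro: order_trans[OF _ mult_right_mono])

lemma mlin_norm_le_add: "mlin_norm_le j L c \<Longrightarrow> mlin_norm_le j L' d \<Longrightarrow> mlin_norm_le j (\<lambda>vs. L vs + L' vs) (c + d)"
  unfolding mlin_norm_le_iff by (metis (no_types, lifting) add_mono distrib_right norm_triangle_mono)

lemma mlin_norm_le_diff: "mlin_norm_le j L c \<Longrightarrow> mlin_norm_le j L' d \<Longrightarrow> mlin_norm_le j (\<lambda>vs. L vs - L' vs) (c + d)"
  unfolding mlin_norm_le_iff by (metis (no_types, lifting) add_mono distrib_right norm_triangle_le_diff)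

text \<open>With the list written as \<open>xs @ a # ys\<close> the varied slot is visible to
  rewriting, which list update hides. The bound is chosen nonnegative because bounds get multiplied
  later.\<close>

lemma bdd_mlin_iff:
  "bdd_mlin j L \<longleftrightarrow>
    (\<forall>xs ys a b. length xs + Suc (length ys) = j \<longrightarrow>
        L (xs @ (a + b) # ys) = L (xs @ a # ys) + L (xs @ b # ys)) \<and>
    (\<forall>xs ys a c. length xs + Suc (length ys) = j \<longrightarrow>
        L (xs @ (c *\<^sub>R a) # ys) = c *\<^sub>R L (xs @ a # ys)) \<and>
    (\<exists>K\<ge>0. mlin_norm_le j L K)"
  (is "_ \<longleftrightarrow> ?A \<and> ?S \<and> ?B")
proof
  assume *: "bdd_mlin j L"
  have "L (xs @ (a + b) # ys) = L (xs @ a # ys) + L (xs @ b # ys) \<and>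
        L (xs @ (c *\<^sub>R a) # ys) = c *\<^sub>R L (xs @ a # ys)"
    if "length xs + Suc (length ys) = j" for xs ys a b c
  proof -
    have "(xs @ 0 # ys)[length xs := z] = xs @ z # ys" for z
      by simp
    then show ?thesis
      using *[unfolded bounded_multilinear_on_def, THEN conjunct1, rule_format,
          of "xs @ 0 # ys" "length xs"] that by auto
  qed
  moreover from * obtain K where "mlin_norm_le j L K"
    unfolding bounded_multilinear_on_def by blast
  then have "mlin_norm_le j L (max K 0)" by (rule mlin_norm_le_mono) simp
  then have ?B by (meson max.cobounded2)
  ultimately show "?A \<and> ?S \<and> ?B" by blast
next
  assume *: "?A \<and> ?S \<and> ?B"
  show "bdd_mlin j L"
    unfolding bounded_multilinear_on_def
  proof (intro conjI allI impI ballI)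
    fix vs :: "'a list" and i :: nat
    assume vs: "length vs = j \<and> set vs \<subseteq> UNIV \<and> i < j"
    then have upd: "vs[i := z] = take i vs @ z # drop (Suc i) vs" for z
      by (simp add: upd_conv_take_nth_drop)
    have len: "length (take i vs) + Suc (length (drop (Suc i) vs)) = j"
      using vs by auto
    show "L (vs[i := a + b]) = L (vs[i := a]) + L (vs[i := b])" for a b
      using * len upd by presburger
    show "L (vs[i := c *\<^sub>R a]) = c *\<^sub>R L (vs[i := a])" for a c
      using * len upd by presburger
  qed (use * in blast)
qed

lemma bdd_mlin_add:
  assumes "bdd_mlin j L" "length xs + Suc (length ys) = j"
  shows "L (xs @ (a + b) # ys) = L (xs @ a # ys) + L (xs @ b # ys)"
  using assms unfolding bdd_mlin_iff by blast

lemma bdd_mlin_scaleR: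
  assumes "bdd_mlin j L" "length xs + Suc (length ys) = j"
  shows "L (xs @ (c *\<^sub>R a) # ys) = c *\<^sub>R L (xs @ a # ys)"
  using assms unfolding bdd_mlin_iff by blast

lemma bdd_mlin_diff:
  assumes "bdd_mlin j L" "length xs + Suc (length ys) = j"
  shows "L (xs @ (a - b) # ys) = L (xs @ a # ys) - L (xs @ b # ys)"
  using bdd_mlin_add[OF assms, of a "- b"] bdd_mlin_scaleR[OF assms, of "-1" b] by simp

lemma bdd_mlin_bound:
  assumes "bdd_mlin j L"
  obtains K where "K \<ge> 0" "mlin_norm_le j L K"
  using assms unfolding bdd_mlin_iff by blast

lemma bdd_mlin_cong:
  assumes "\<And>vs. length vs = j \<Longrightarrow> L vs = L' vs"
  shows "bdd_mlin j L \<longleftrightarrow> bdd_mlin j L'"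
  using assms by (simp add: bdd_mlin_iff mlin_norm_le_iff)

lemma bdd_mlin_plus:
  assumes "bdd_mlin j L" "bdd_mlin j L'"
  shows "bdd_mlin j (\<lambda>vs. L vs + L' vs)"
proof -
  obtain K K' where "K \<ge> 0" "K' \<ge> 0" "mlin_norm_le j L K" "mlin_norm_le j L' K'"
    using assms by (meson bdd_mlin_bound)
  then have "\<exists>K\<ge>0. mlin_norm_le j (\<lambda>vs. L vs + L' vs) K"
    by (intro exI[of _ "K + K'"]) (simp add: mlin_norm_le_add)
  then show ?thesis
    using assms unfolding bdd_mlin_iff by (simp add: algebra_simps)
qed

lemma bdd_mlin_Cons_bounded_linear:
  assumes "bdd_mlin (Suc j) L" "length vs = j"
  shows "bounded_linear (\<lambda>v. L (v # vs))"
proof -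
  obtain K where K: "K \<ge> 0" "mlin_norm_le (Suc j) L K" using assms bdd_mlin_bound by blast
  show ?thesis
  proof (rule bounded_linear_intro[where K = "K * prod_list (map norm vs)"])
    show "L ((a + b) # vs) = L (a # vs) + L (b # vs)" for a b
      using bdd_mlin_add[OF assms(1), of "[]" vs] assms(2) by simp
    show "L ((c *\<^sub>R a) # vs) = c *\<^sub>R L (a # vs)" for a c
      using bdd_mlin_scaleR[OF assms(1), of "[]" vs] assms(2) by simp
    show "norm (L (a # vs)) \<le> norm a * (K * prod_list (map norm vs))" for a
      using mlin_norm_le_D[OF K(2), of "a # vs"] assms(2) by (simp add: mult_ac)
  qed
qed

section \<open>Continuity and differentiability in operator norm\<close>

definition multi_cont ::
  "nat \<Rightarrow> 'a::real_normed_vector set \<Rightarrow> ('a \<Rightarrow> 'a list \<Rightarrow> 'b::real_normed_vector) \<Rightarrow> bool" where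
  "multi_cont j U M \<longleftrightarrow>
     (\<forall>x\<in>U. \<forall>\<epsilon>>0. \<forall>\<^sub>F y in at x within U. mlin_norm_le j (\<lambda>vs. M y vs - M x vs) \<epsilon>)"

text \<open>Together with \<open>multi_cont\<close> this isolates what \<open>C_k_on\<close> imposes
  at a single order, over the whole space. Treating one order at a time permits recursion without
  carrying a whole sequence of derivatives.\<close>

definition multi_deriv ::
  "nat \<Rightarrow> 'a::real_normed_vector set \<Rightarrow> ('a \<Rightarrow> 'a list \<Rightarrow> 'b::real_normed_vector) \<Rightarrow>
    ('a \<Rightarrow> 'a list \<Rightarrow> 'b) \<Rightarrow> bool" where
  "multi_deriv j U M M' \<longleftrightarrow>
     (\<forall>x\<in>U. \<forall>\<epsilon>>0. \<forall>\<^sub>F y in at x within U.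
        mlin_norm_le j (\<lambda>vs. M y vs - M x vs - M' x ((y - x) # vs)) (\<epsilon> * norm (y - x)))"

text \<open>
  A recursive form of \<open>C_k_on\<close> for families of \<open>j\<close>-linear maps; induction on \<open>m\<close> replaces explicit
  formulas for the higher derivatives of composite and inverse maps.
\<close>

primrec C_multi ::
  "nat \<Rightarrow> nat \<Rightarrow> 'a::real_normed_vector set \<Rightarrow> ('a \<Rightarrow> 'a list \<Rightarrow> 'b::real_normed_vector) \<Rightarrow> bool" where
  "C_multi 0 j U M \<longleftrightarrow> (\<forall>x\<in>U. bdd_mlin j (M x)) \<and> multi_cont j U M"
| "C_multi (Suc m) j U M \<longleftrightarrow> (\<forall>x\<in>U. bdd_mlin j (M x)) \<and>
     (\<exists>M'. C_multi m (Suc j) U M' \<and> multi_deriv j U M M')"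

text \<open>The filter skips \<open>y = x\<close>, where the difference is zero; so the estimate
  holds on the full ball.\<close>

lemma multi_contD:
  assumes "multi_cont j U M" "x \<in> U" "\<epsilon> > 0"
  obtains \<delta> where "\<delta> > 0"
    "\<And>y. y \<in> U \<Longrightarrow> dist y x < \<delta> \<Longrightarrow> mlin_norm_le j (\<lambda>vs. M y vs - M x vs) \<epsilon>"
proof -
  obtain d where d: "d > 0"
    "\<And>y. y \<in> U \<Longrightarrow> y \<noteq> x \<Longrightarrow> dist y x < d \<Longrightarrow> mlin_norm_le j (\<lambda>vs. M y vs - M x vs) \<epsilon>"
    using assms(1)[unfolded multi_cont_def eventually_at, rule_format, OF assms(2,3)] by auto
  have "mlin_norm_le j (\<lambda>vs. M y vs - M x vs) \<epsilon>" if "y \<in> U" "dist y x < d" for y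
    using d(2)[of y] that assms(3) by (cases "y = x") (auto simp: mlin_norm_le_iff)
  with d(1) that show ?thesis by blast
qed

lemma multi_contI:
  assumes "\<And>x \<epsilon>. x \<in> U \<Longrightarrow> \<epsilon> > 0 \<Longrightarrow>
    \<exists>\<delta>>0. \<forall>y\<in>U. dist y x < \<delta> \<longrightarrow> mlin_norm_le j (\<lambda>vs. M y vs - M x vs) \<epsilon>"
  shows "multi_cont j U M"
  unfolding multi_cont_def eventually_at using assms by blast

text \<open>At \<open>y = x\<close>, which the filter skips, the remainder reduces to the value of
  \<open>M' x\<close> at \<open>0 # vs\<close>, and this vanishes by linearity.\<close>

lemma multi_derivD:
  assumes "multi_deriv j U M M'" "x \<in> U" "bdd_mlin (Suc j) (M' x)" "\<epsilon> > 0"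
  obtains \<delta> where "\<delta> > 0"
    "\<And>y. y \<in> U \<Longrightarrow> dist y x < \<delta> \<Longrightarrow>
       mlin_norm_le j (\<lambda>vs. M y vs - M x vs - M' x ((y - x) # vs)) (\<epsilon> * norm (y - x))"
proof -
  obtain d where d: "d > 0"
    "\<And>y. y \<in> U \<Longrightarrow> y \<noteq> x \<Longrightarrow> dist y x < d \<Longrightarrow>
       mlin_norm_le j (\<lambda>vs. M y vs - M x vs - M' x ((y - x) # vs)) (\<epsilon> * norm (y - x))"
    using assms(1)[unfolded multi_deriv_def eventually_at, rule_format, OF assms(2,4)] by auto
  have "mlin_norm_le j (\<lambda>vs. M y vs - M x vs - M' x ((y - x) # vs)) (\<epsilon> * norm (y - x))"
    if "y \<in> U" "dist y x < d" for y
  proof (cases "y = x")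
    case True
    have "M' x (0 # vs) = 0" if "length vs = j" for vs
      using linear_simps(3)[OF bdd_mlin_Cons_bounded_linear[OF assms(3) that]] .
    with True show ?thesis by (simp add: mlin_norm_le_iff)
  qed (use d that in auto)
  with d(1) that show ?thesis by blast
qed

lemma multi_derivI:
  assumes "\<And>x \<epsilon>. x \<in> U \<Longrightarrow> \<epsilon> > 0 \<Longrightarrow>
    \<exists>\<delta>>0. \<forall>y\<in>U. dist y x < \<delta> \<longrightarrow>
      mlin_norm_le j (\<lambda>vs. M y vs - M x vs - M' x ((y - x) # vs)) (\<epsilon> * norm (y - x))"
  shows "multi_deriv j U M M'"
  unfolding multi_deriv_def eventually_at using assms by blast

text \<open>The remainder with \<epsilon> = 1 plus a bound of the derivative gives a Lipschitz
  estimate at the single point \<open>x\<close>, which continuity and the chain rule both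
  use.\<close>

lemma multi_deriv_bound:
  assumes "multi_deriv j U M M'" "x \<in> U" "bdd_mlin (Suc j) (M' x)"
  obtains \<delta> K where "\<delta> > 0" "K \<ge> 0"
    "\<And>y. y \<in> U \<Longrightarrow> dist y x < \<delta> \<Longrightarrow> mlin_norm_le j (\<lambda>vs. M y vs - M x vs) (K * norm (y - x))"
proof -
  obtain K where K: "K \<ge> 0" "mlin_norm_le (Suc j) (M' x) K" using assms(3) bdd_mlin_bound by blast
  obtain \<delta> where \<delta>: "\<delta> > 0"
    "\<And>y. y \<in> U \<Longrightarrow> dist y x < \<delta> \<Longrightarrow>
       mlin_norm_le j (\<lambda>vs. M y vs - M x vs - M' x ((y - x) # vs)) (1 * norm (y - x))"
    using multi_derivD[OF assms, of 1] by (metis zero_less_one)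
  have "mlin_norm_le j (\<lambda>vs. M y vs - M x vs) ((1 + K) * norm (y - x))"
    if "y \<in> U" "dist y x < \<delta>" for y
  proof -
    have "mlin_norm_le j (\<lambda>vs. M' x ((y - x) # vs)) (K * norm (y - x))"
      unfolding mlin_norm_le_iff using mlin_norm_le_D[OF K(2), of "(y - x) # _"] by (simp add: mult_ac)
    from mlin_norm_le_add[OF \<delta>(2)[OF that] this] show ?thesis by (simp add: algebra_simps)
  qed
  then show ?thesis using that[of \<delta> "1 + K"] \<delta>(1) K(1) by auto
qed

lemma multi_deriv_imp_cont:
  assumes "multi_deriv j U M M'" "\<And>x. x \<in> U \<Longrightarrow> bdd_mlin (Suc j) (M' x)"
  shows "multi_cont j U M"
proof (rule multi_contI)
  fix x and \<epsilon> :: real assume x: "x \<in> U" and e: "\<epsilon> > 0"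
  obtain \<delta> K where \<delta>: "\<delta> > 0" "K \<ge> 0"
    "\<And>y. y \<in> U \<Longrightarrow> dist y x < \<delta> \<Longrightarrow> mlin_norm_le j (\<lambda>vs. M y vs - M x vs) (K * norm (y - x))"
    using multi_deriv_bound[OF assms(1) x assms(2)[OF x]] by blast
  show "\<exists>\<delta>>0. \<forall>y\<in>U. dist y x < \<delta> \<longrightarrow> mlin_norm_le j (\<lambda>vs. M y vs - M x vs) \<epsilon>"
  \<comment> \<open>\<open>K + 1\<close> instead of \<open>K\<close> keeps the quotient meaningful
    when \<open>K = 0\<close>.\<close>
  proof (intro exI[of _ "min \<delta> (\<epsilon> / (K + 1))"] conjI ballI impI)
    show "min \<delta> (\<epsilon> / (K + 1)) > 0" using \<delta> e by simp
    fix y assume y: "y \<in> U" "dist y x < min \<delta> (\<epsilon> / (K + 1))"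
    then have "norm (y - x) * (K + 1) < \<epsilon>" using \<delta>(2) by (simp add: dist_norm field_simps)
    then have "norm (y - x) + K * norm (y - x) < \<epsilon>" by (simp add: algebra_simps)
    then have "K * norm (y - x) \<le> \<epsilon>" using norm_ge_zero[of "y - x"] by linarith
    then show "mlin_norm_le j (\<lambda>vs. M y vs - M x vs) \<epsilon>" using mlin_norm_le_mono[OF \<delta>(3)] y by auto
  qed
qed

lemma C_multi_bml: "C_multi m j U M \<Longrightarrow> x \<in> U \<Longrightarrow> bdd_mlin j (M x)"
  by (cases m) auto

lemma C_multi_cont: "C_multi m j U M \<Longrightarrow> multi_cont j U M"
  by (cases m) (auto intro: multi_deriv_imp_cont C_multi_bml)

text \<open>Only the lowest level has content: there differentiability gives continuity.\<close>

lemma C_multi_Suc_lower: "C_multi (Suc m) j U M \<Longrightarrow> C_multi m j U M"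
proof (induction m arbitrary: j M)
  case 0
  then show ?case using C_multi_cont[OF 0] by auto
next
  case (Suc m)
  then show ?case by (metis C_multi.simps(2))
qed

lemma C_multi_lower:
  assumes "C_multi m j U M" "l \<le> m"
  shows "C_multi l j U M"
  using assms(2,1) by (induction rule: inc_induct) (blast intro: C_multi_Suc_lower)+

lemma multi_cont_cong:
  assumes "\<And>x vs. x \<in> U \<Longrightarrow> length vs = j \<Longrightarrow> M x vs = N x vs"
  shows "multi_cont j U M \<Longrightarrow> multi_cont j U N"
  using assms by (simp add: multi_cont_def eventually_at mlin_norm_le_iff cong: conj_cong)

lemma C_multi_cong:
  assumes "\<And>x vs. x \<in> U \<Longrightarrow> length vs = j \<Longrightarrow> M x vs = N x vs" "C_multi m j U M"
  shows "C_multi m j U N"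
proof -
  have "bdd_mlin j (N x)" if "x \<in> U" for x
    using C_multi_bml[OF assms(2) that] bdd_mlin_cong[of j "M x" "N x"] assms(1) that by blast
  moreover have "multi_cont j U N" using multi_cont_cong[OF assms(1) C_multi_cont[OF assms(2)]] .
  moreover have "multi_deriv j U N M'" if "multi_deriv j U M M'" for M'
  proof -
    have "mlin_norm_le j (\<lambda>vs. N y vs - N x vs - M' x ((y - x) # vs)) c \<longleftrightarrow>
        mlin_norm_le j (\<lambda>vs. M y vs - M x vs - M' x ((y - x) # vs)) c" if "x \<in> U" "y \<in> U" for x y c
      using assms(1) that by (simp add: mlin_norm_le_iff)
    then show ?thesis using that unfolding multi_deriv_def eventually_at by meson
  qed
  ultimately show ?thesis using assms(2) by (cases m) auto
qed

text \<open>Serves the two summands of the product rule.\<close>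

lemma C_multi_add:
  assumes "C_multi m j U M" "C_multi m j U N"
  shows "C_multi m j U (\<lambda>x vs. M x vs + N x vs)"
  using assms
proof (induction m arbitrary: j M N)
  case 0
  have "multi_cont j U (\<lambda>x vs. M x vs + N x vs)"
  proof (rule multi_contI)
    fix x and \<epsilon> :: real assume x: "x \<in> U" and e: "\<epsilon> > 0"
    obtain \<delta>1 where 1: "\<delta>1 > 0"
      "\<And>y. y \<in> U \<Longrightarrow> dist y x < \<delta>1 \<Longrightarrow> mlin_norm_le j (\<lambda>vs. M y vs - M x vs) (\<epsilon>/2)"
      using multi_contD[of j U M x "\<epsilon>/2"] 0 x e by auto
    obtain \<delta>2 where 2: "\<delta>2 > 0"
      "\<And>y. y \<in> U \<Longrightarrow> dist y x < \<delta>2 \<Longrightarrow> mlin_norm_le j (\<lambda>vs. N y vs - N x vs) (\<epsilon>/2)"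
      using multi_contD[of j U N x "\<epsilon>/2"] 0 x e by auto
    have "mlin_norm_le j (\<lambda>vs. M y vs + N y vs - (M x vs + N x vs)) \<epsilon>"
      if "y \<in> U" "dist y x < min \<delta>1 \<delta>2" for y
      using mlin_norm_le_add[OF 1(2)[of y] 2(2)[of y]] that by (simp add: algebra_simps)
    then show "\<exists>\<delta>>0. \<forall>y\<in>U. dist y x < \<delta> \<longrightarrow>
        mlin_norm_le j (\<lambda>vs. M y vs + N y vs - (M x vs + N x vs)) \<epsilon>"
      using 1(1) 2(1) by (intro exI[of _ "min \<delta>1 \<delta>2"]) auto
  qed
  then show ?case using 0 by (simp add: bdd_mlin_plus)
next
  case (Suc m)
  obtain M' where M': "C_multi m (Suc j) U M'" "multi_deriv j U M M'" using Suc.prems by auto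
  obtain N' where N': "C_multi m (Suc j) U N'" "multi_deriv j U N N'" using Suc.prems by auto
  have "multi_deriv j U (\<lambda>x vs. M x vs + N x vs) (\<lambda>x vs. M' x vs + N' x vs)"
  proof (rule multi_derivI)
    fix x and \<epsilon> :: real assume x: "x \<in> U" and e: "\<epsilon> > 0"
    obtain \<delta>1 where 1: "\<delta>1 > 0"
      "\<And>y. y \<in> U \<Longrightarrow> dist y x < \<delta>1 \<Longrightarrow>
        mlin_norm_le j (\<lambda>vs. M y vs - M x vs - M' x ((y - x) # vs)) (\<epsilon>/2 * norm (y - x))"
      using multi_derivD[OF M'(2) x C_multi_bml[OF M'(1) x], of "\<epsilon>/2"] e by auto
    obtain \<delta>2 where 2: "\<delta>2 > 0"
      "\<And>y. y \<in> U \<Longrightarrow> dist y x < \<delta>2 \<Longrightarrow>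
        mlin_norm_le j (\<lambda>vs. N y vs - N x vs - N' x ((y - x) # vs)) (\<epsilon>/2 * norm (y - x))"
      using multi_derivD[OF N'(2) x C_multi_bml[OF N'(1) x], of "\<epsilon>/2"] e by auto
    have "mlin_norm_le j (\<lambda>vs. M y vs + N y vs - (M x vs + N x vs)
        - (M' x ((y - x) # vs) + N' x ((y - x) # vs))) (\<epsilon> * norm (y - x))"
      if "y \<in> U" "dist y x < min \<delta>1 \<delta>2" for y
      using mlin_norm_le_add[OF 1(2)[of y] 2(2)[of y]] that by (simp add: algebra_simps)
    then show "\<exists>\<delta>>0. \<forall>y\<in>U. dist y x < \<delta> \<longrightarrow>
        mlin_norm_le j (\<lambda>vs. M y vs + N y vs - (M x vs + N x vs)
        - (M' x ((y - x) # vs) + N' x ((y - x) # vs))) (\<epsilon> * norm (y - x))"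
      using 1(1) 2(1) by (intro exI[of _ "min \<delta>1 \<delta>2"]) auto
  qed
  with Suc.IH[OF M'(1) N'(1)] Suc.prems show ?case by (auto simp: bdd_mlin_plus)
qed

text \<open>
  The lists \<open>I\<close>, \<open>J\<close>, \<open>K\<close> partition the argument positions.  Arbitrary partitions are needed because
  the product rule moves the new argument into \<open>I\<close> or \<open>J\<close>.
\<close>

definition slot_comp ::
  "nat list \<Rightarrow> nat list \<Rightarrow> nat list \<Rightarrow> ('a \<Rightarrow> 'a list \<Rightarrow> 'b) \<Rightarrow> ('a \<Rightarrow> 'a list \<Rightarrow> 'a) \<Rightarrow> 'a \<Rightarrow> 'a list \<Rightarrow> 'b" where
  "slot_comp I J K M N x vs = M x (map ((!) vs) I @ N x (map ((!) vs) J) # map ((!) vs) K)"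

section \<open>Product rule for slot compositions\<close>

lemma prod_norm_partition:
  assumes "distinct (I @ J @ K)" "set (I @ J @ K) = {..<length vs}"
  shows "prod_list (map norm (map ((!) vs) I)) * prod_list (map norm (map ((!) vs) J))
    * prod_list (map norm (map ((!) vs) K)) = prod_list (map norm vs)"
proof -
  have "prod_list (map (\<lambda>i. norm (vs ! i)) (I @ J @ K)) = (\<Prod>i<length vs. norm (vs ! i))"
    using assms prod.distinct_set_conv_list[of "I @ J @ K" "\<lambda>i. norm (vs ! i)"] by simp
  also have "\<dots> = prod_list (map norm vs)"
    by (simp add: prod.list_conv_set_nth lessThan_atLeast0)
  finally show ?thesis by (simp add: o_def mult_ac)
qed

text \<open>The estimate of \<open>L\<close> leaves the norms of the \<open>I\<close> and
  \<open>K\<close> arguments, that of \<open>R\<close> those of the \<open>J\<close> arguments. The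
  three lists exhaust the positions without repetition, so all factors together form
  \<open>prod_list (map norm vs)\<close>, and operator norms multiply.\<close>

lemma mlin_norm_le_slot:
  assumes "mlin_norm_le (length I + Suc (length K)) L c" "mlin_norm_le (length J) R d" "0 \<le> c"
    and "distinct (I @ J @ K)" "set (I @ J @ K) = {..<n}"
  shows "mlin_norm_le n (\<lambda>vs. L (map ((!) vs) I @ R (map ((!) vs) J) # map ((!) vs) K)) (c * d)"
  unfolding mlin_norm_le_iff
proof (intro allI impI)
  fix vs :: "'a list" assume n: "length vs = n"
  let ?p = "\<lambda>I. prod_list (map norm (map ((!) vs) I))"
  have "norm (L (map ((!) vs) I @ R (map ((!) vs) J) # map ((!) vs) K))
      \<le> c * prod_list (map norm (map ((!) vs) I @ R (map ((!) vs) J) # map ((!) vs) K))"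
    by (rule mlin_norm_le_D[OF assms(1)]) simp
  also have "\<dots> = (c * ?p I * ?p K) * norm (R (map ((!) vs) J))"
    by (simp add: mult_ac)
  also have "\<dots> \<le> (c * ?p I * ?p K) * (d * ?p J)"
    using assms(3) by (intro mult_left_mono mlin_norm_le_D[OF assms(2)]) (simp_all del: map_map)
  also have "\<dots> = c * d * prod_list (map norm vs)"
    unfolding prod_norm_partition[of I J K vs, symmetric, unfolded n, OF assms(4,5)]
    by (simp add: mult_ac)
  finally show "norm (L (map ((!) vs) I @ R (map ((!) vs) J) # map ((!) vs) K))
    \<le> c * d * prod_list (map norm vs)" .
qed

lemma nth_append_other:
  assumes "i \<noteq> length xs"
  shows "(xs @ a # ys) ! i = (xs @ b # ys) ! i"
  using assms
  by (auto simp: nth_append nth_Cons split: nat.split)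

text \<open>A list of distinct positions meets the varied position \<open>length xs\<close> at most
  once, so the selected arguments contain \<open>a\<close> either nowhere or in one slot. The
  \<open>0\<close> is a mere placeholder.\<close>

lemma map_nth_slot:
  assumes "distinct I"
  shows "(length xs \<notin> set I \<and> (\<forall>a. map ((!) (xs @ a # ys)) I = map ((!) (xs @ 0 # ys)) I)) \<or>
    (length xs \<in> set I \<and> (\<exists>ps qs. length ps + Suc (length qs) = length I \<and>
      (\<forall>a. map ((!) (xs @ a # ys)) I = ps @ a # qs)))"
proof (cases "length xs \<in> set I")
  case True
  then obtain P Q where I: "I = P @ length xs # Q" by (meson split_list)
  have P: "length xs \<notin> set P" and Q: "length xs \<notin> set Q" using assms unfolding I by auto
  let ?f = "\<lambda>a. (!) (xs @ a # ys)"
  have PQ: "map (?f a) P = map (?f 0) P" "map (?f a) Q = map (?f 0) Q" for a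
    by (rule map_cong[OF refl nth_append_other], use P Q in blast)+
  have *: "map (?f a) I = map (?f a) P @ a # map (?f a) Q" for a
    unfolding I by simp
  have "map (?f a) I = map (?f 0) P @ a # map (?f 0) Q" for a
    using *[of a] unfolding PQ[of a] .
  moreover have "length (map (?f 0) P) + Suc (length (map (?f 0) Q)) = length I"
    unfolding I by simp
  ultimately show ?thesis using True by blast
next
  case False
  then have "map ((!) (xs @ a # ys)) I = map ((!) (xs @ 0 # ys)) I" for a
    by (intro map_cong[OF refl] nth_append_other) blast
  with False show ?thesis by blast
qed

text \<open>The varied position lies in exactly one of \<open>I\<close>, \<open>J\<close>,
  \<open>K\<close>. For \<open>I\<close> and \<open>K\<close> linearity is that of \<open>L\<close>;
  for \<open>J\<close> it passes through \<open>R\<close> and then through the inserted slot of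
  \<open>L\<close>.\<close>

lemma bdd_mlin_slot:
  assumes L: "bdd_mlin (length I + Suc (length K)) L" and R: "bdd_mlin (length J) R"
    and "distinct (I @ J @ K)" "set (I @ J @ K) = {..<n}"
  shows "bdd_mlin n (\<lambda>vs. L (map ((!) vs) I @ R (map ((!) vs) J) # map ((!) vs) K))" (is "bdd_mlin n ?C")
proof -
  have slot: "?C (xs @ (a + b) # ys) = ?C (xs @ a # ys) + ?C (xs @ b # ys) \<and>
      ?C (xs @ (c *\<^sub>R a) # ys) = c *\<^sub>R ?C (xs @ a # ys)"
    if len: "length xs + Suc (length ys) = n" for xs ys a b c
  proof -
    have i: "length xs \<in> set (I @ J @ K)" using assms(4) len by auto
    have dI: "distinct I" and dJ: "distinct J" and dK: "distinct K" using assms(3) by auto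
    have ex: "length xs \<in> set I \<and> length xs \<notin> set J \<and> length xs \<notin> set K \<or>
        length xs \<notin> set I \<and> length xs \<in> set J \<and> length xs \<notin> set K \<or>
        length xs \<notin> set I \<and> length xs \<notin> set J \<and> length xs \<in> set K"
      using i assms(3) by auto
    then consider "length xs \<in> set I" "length xs \<notin> set J" "length xs \<notin> set K"
      | "length xs \<notin> set I" "length xs \<in> set J" "length xs \<notin> set K"
      | "length xs \<notin> set I" "length xs \<notin> set J" "length xs \<in> set K" by blast
    then show ?thesis
    proof cases
      case 1
      obtain ps qs where I: "length ps + Suc (length qs) = length I"
        "\<And>a. map ((!) (xs @ a # ys)) I = ps @ a # qs"
        using map_nth_slot[OF dI, of xs ys] 1 by blast
      have J: "map ((!) (xs @ a # ys)) J = map ((!) (xs @ 0 # ys)) J" for a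
        using map_nth_slot[OF dJ, of xs ys] 1 by blast
      have K: "map ((!) (xs @ a # ys)) K = map ((!) (xs @ 0 # ys)) K" for a
        using map_nth_slot[OF dK, of xs ys] 1 by blast
      let ?q = "qs @ R (map ((!) (xs @ 0 # ys)) J) # map ((!) (xs @ 0 # ys)) K"
      have "?C (xs @ a # ys) = L (ps @ a # ?q)" for a
        unfolding I(2) J[of a] K[of a] by simp
      moreover have "length ps + Suc (length ?q) = length I + Suc (length K)" using I(1) by simp
      ultimately show ?thesis using bdd_mlin_add[OF L] bdd_mlin_scaleR[OF L] by presburger
    next
      case 2
      obtain ps qs where J: "length ps + Suc (length qs) = length J"
        "\<And>a. map ((!) (xs @ a # ys)) J = ps @ a # qs"
        using map_nth_slot[OF dJ, of xs ys] 2 by blast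
      have I: "map ((!) (xs @ a # ys)) I = map ((!) (xs @ 0 # ys)) I" for a
        using map_nth_slot[OF dI, of xs ys] 2 by blast
      have K: "map ((!) (xs @ a # ys)) K = map ((!) (xs @ 0 # ys)) K" for a
        using map_nth_slot[OF dK, of xs ys] 2 by blast
      let ?I = "map ((!) (xs @ 0 # ys)) I" let ?K = "map ((!) (xs @ 0 # ys)) K"
      have "?C (xs @ a # ys) = L (?I @ R (ps @ a # qs) # ?K)" for a
        unfolding J(2) I[of a] K[of a] by simp
      moreover have "length ?I + Suc (length ?K) = length I + Suc (length K)" by simp
      ultimately show ?thesis
        using bdd_mlin_add[OF L] bdd_mlin_scaleR[OF L] bdd_mlin_add[OF R J(1)] bdd_mlin_scaleR[OF R J(1)] by presburger
    next
      case 3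
      obtain ps qs where K: "length ps + Suc (length qs) = length K"
        "\<And>a. map ((!) (xs @ a # ys)) K = ps @ a # qs"
        using map_nth_slot[OF dK, of xs ys] 3 by blast
      have J: "map ((!) (xs @ a # ys)) J = map ((!) (xs @ 0 # ys)) J" for a
        using map_nth_slot[OF dJ, of xs ys] 3 by blast
      have I: "map ((!) (xs @ a # ys)) I = map ((!) (xs @ 0 # ys)) I" for a
        using map_nth_slot[OF dI, of xs ys] 3 by blast
      let ?p = "map ((!) (xs @ 0 # ys)) I @ R (map ((!) (xs @ 0 # ys)) J) # ps"
      have "?C (xs @ a # ys) = L (?p @ a # qs)" for a
        unfolding K(2) J[of a] I[of a] by simp
      moreover have "length ?p + Suc (length qs) = length I + Suc (length K)" using K(1) by simp
      ultimately show ?thesis using bdd_mlin_add[OF L] bdd_mlin_scaleR[OF L] by presburger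
    qed
  qed
  obtain c d where "0 \<le> c" "0 \<le> d" "mlin_norm_le (length I + Suc (length K)) L c" "mlin_norm_le (length J) R d"
    using L R by (meson bdd_mlin_bound)
  then have "mlin_norm_le n ?C (c * d)" "0 \<le> c * d"
    using mlin_norm_le_slot assms(3,4) by (blast, simp)
  then show ?thesis unfolding bdd_mlin_iff using slot by blast
qed

text \<open>Change \<open>M\<close> first and \<open>N\<close> second: the mixed value with
  \<open>M x\<close> and \<open>N y\<close> is subtracted and added.\<close>

lemma multi_cont_slot:
  assumes "multi_cont (length I + Suc (length K)) U M" "multi_cont (length J) U N"
    and "\<And>x. x \<in> U \<Longrightarrow> bdd_mlin (length I + Suc (length K)) (M x)"
    and "\<And>x. x \<in> U \<Longrightarrow> bdd_mlin (length J) (N x)"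
    and IJK: "distinct (I @ J @ K)" "set (I @ J @ K) = {..<n}"
  shows "multi_cont n U (slot_comp I J K M N)"
proof (rule multi_contI)
  fix x and \<epsilon> :: real assume x: "x \<in> U" and e: "\<epsilon> > 0"
  let ?p = "length I + Suc (length K)"
  obtain c where c: "c \<ge> 0" "mlin_norm_le ?p (M x) c" using assms(3)[OF x] bdd_mlin_bound by blast
  obtain d where d: "d \<ge> 0" "mlin_norm_le (length J) (N x) d" using assms(4)[OF x] bdd_mlin_bound by blast
  \<comment> \<open>The cap \<open>1\<close> bounds \<open>N y\<close> by \<open>d + 1\<close>, so
    the two errors sum to at most \<open>\<epsilon>' * (c + d + 1)\<close>.\<close>
  define \<epsilon>' where "\<epsilon>' = min 1 (\<epsilon> / (c + d + 1))"
  have e': "\<epsilon>' > 0" "\<epsilon>' \<le> 1" using e c d by (auto simp: \<epsilon>'_def)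
  obtain \<delta>1 where 1: "\<delta>1 > 0"
    "\<And>y. y \<in> U \<Longrightarrow> dist y x < \<delta>1 \<Longrightarrow> mlin_norm_le ?p (\<lambda>vs. M y vs - M x vs) \<epsilon>'"
    using multi_contD[OF assms(1) x e'(1)] by blast
  obtain \<delta>2 where 2: "\<delta>2 > 0"
    "\<And>y. y \<in> U \<Longrightarrow> dist y x < \<delta>2 \<Longrightarrow> mlin_norm_le (length J) (\<lambda>vs. N y vs - N x vs) \<epsilon>'"
    using multi_contD[OF assms(2) x e'(1)] by blast
  have "mlin_norm_le n (\<lambda>vs. slot_comp I J K M N y vs - slot_comp I J K M N x vs) \<epsilon>"
    if y: "y \<in> U" "dist y x < \<delta>1" "dist y x < \<delta>2" for y
  proof -
    have Ny: "mlin_norm_le (length J) (N y) (\<epsilon>' + d)"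
      using mlin_norm_le_add[OF 2(2)[OF y(1,3)] d(2)] by simp
    have "slot_comp I J K M N y vs - slot_comp I J K M N x vs =
      (M y (map ((!) vs) I @ N y (map ((!) vs) J) # map ((!) vs) K)
       - M x (map ((!) vs) I @ N y (map ((!) vs) J) # map ((!) vs) K)) +
      M x (map ((!) vs) I @ (N y (map ((!) vs) J) - N x (map ((!) vs) J)) # map ((!) vs) K)" for vs
      using bdd_mlin_diff[OF assms(3)[OF x], of "map ((!) vs) I" "map ((!) vs) K"]
      by (simp add: slot_comp_def)
    moreover have "mlin_norm_le n (\<lambda>vs. (M y (map ((!) vs) I @ N y (map ((!) vs) J) # map ((!) vs) K)
       - M x (map ((!) vs) I @ N y (map ((!) vs) J) # map ((!) vs) K)) +
      M x (map ((!) vs) I @ (N y (map ((!) vs) J) - N x (map ((!) vs) J)) # map ((!) vs) K))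
      (\<epsilon>' * (\<epsilon>' + d) + c * \<epsilon>')"
      by (intro mlin_norm_le_add mlin_norm_le_slot[OF 1(2)[OF y(1,2)] Ny _ IJK] mlin_norm_le_slot[OF c(2) 2(2)[OF y(1,3)] _ IJK])
        (use e' c in auto)
    moreover have "\<epsilon>' * (\<epsilon>' + d) + c * \<epsilon>' \<le> \<epsilon>"
    proof -
      have "\<epsilon>' * (\<epsilon>' + d) \<le> \<epsilon>' * (1 + d)" using e' by (intro mult_left_mono) auto
      then have "\<epsilon>' * (\<epsilon>' + d) + c * \<epsilon>' \<le> \<epsilon>' * (c + d + 1)" by (simp add: algebra_simps)
      also have "\<dots> \<le> \<epsilon> / (c + d + 1) * (c + d + 1)"
        using c d by (intro mult_right_mono) (auto simp: \<epsilon>'_def)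
      also have "\<dots> = \<epsilon>" using c d by simp
      finally show ?thesis .
    qed
    ultimately show ?thesis using mlin_norm_le_mono by simp
  qed
  then show "\<exists>\<delta>>0. \<forall>y\<in>U. dist y x < \<delta> \<longrightarrow>
      mlin_norm_le n (\<lambda>vs. slot_comp I J K M N y vs - slot_comp I J K M N x vs) \<epsilon>"
    using 1(1) 2(1) by (intro exI[of _ "min \<delta>1 \<delta>2"]) auto
qed

text \<open>The new direction stands at position \<open>0\<close> and shifts all others by
  \<open>Suc\<close>. \<open>M'\<close> expects it first, so it joins the front of \<open>I\<close>;
  in the summand where \<open>N\<close> is differentiated it joins the front of
  \<open>J\<close>.\<close>

lemma multi_deriv_slot:
  assumes M: "multi_deriv (length I + Suc (length K)) U M M'" and N: "multi_deriv (length J) U N N'"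
    and bM: "\<And>x. x \<in> U \<Longrightarrow> bdd_mlin (length I + Suc (length K)) (M x)"
    and bM': "\<And>x. x \<in> U \<Longrightarrow> bdd_mlin (Suc (length I + Suc (length K))) (M' x)"
    and bN: "\<And>x. x \<in> U \<Longrightarrow> bdd_mlin (length J) (N x)"
    and bN': "\<And>x. x \<in> U \<Longrightarrow> bdd_mlin (Suc (length J)) (N' x)"
    and IJK: "distinct (I @ J @ K)" "set (I @ J @ K) = {..<n}"
  shows "multi_deriv n U (slot_comp I J K M N)
    (\<lambda>x vs. slot_comp (0 # map Suc I) (map Suc J) (map Suc K) M' N x vs +
            slot_comp (map Suc I) (0 # map Suc J) (map Suc K) M N' x vs)"
proof (rule multi_derivI)
  fix x and \<epsilon> :: real assume x: "x \<in> U" and e: "\<epsilon> > 0"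
  let ?p = "length I + Suc (length K)"
  obtain c where c: "c \<ge> 0" "mlin_norm_le ?p (M x) c" using bM[OF x] bdd_mlin_bound by blast
  obtain c' where c': "c' \<ge> 0" "mlin_norm_le (Suc ?p) (M' x) c'" using bM'[OF x] bdd_mlin_bound by blast
  obtain d where d: "d \<ge> 0" "mlin_norm_le (length J) (N x) d" using bN[OF x] bdd_mlin_bound by blast
  define \<epsilon>' where "\<epsilon>' = min 1 (\<epsilon> / (c + c' + d + 1))"
  have e': "\<epsilon>' > 0" "\<epsilon>' \<le> 1" using e c d c' by (auto simp: \<epsilon>'_def)
  obtain \<delta>1 where 1: "\<delta>1 > 0"
    "\<And>y. y \<in> U \<Longrightarrow> dist y x < \<delta>1 \<Longrightarrow>
      mlin_norm_le ?p (\<lambda>vs. M y vs - M x vs - M' x ((y - x) # vs)) (\<epsilon>' * norm (y - x))"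
    using multi_derivD[OF M x bM'[OF x] e'(1)] by blast
  obtain \<delta>2 where 2: "\<delta>2 > 0"
    "\<And>y. y \<in> U \<Longrightarrow> dist y x < \<delta>2 \<Longrightarrow>
      mlin_norm_le (length J) (\<lambda>vs. N y vs - N x vs - N' x ((y - x) # vs)) (\<epsilon>' * norm (y - x))"
    using multi_derivD[OF N x bN'[OF x] e'(1)] by blast
  \<comment> \<open>Continuity of \<open>N\<close> is enough for the mixed error, because
    \<open>M' x\<close> in direction \<open>y - x\<close> already has the factor
    \<open>norm (y - x)\<close>.\<close>
  have "multi_cont (length J) U N" using multi_deriv_imp_cont[OF N bN'] .
  then obtain \<delta>3 where 3: "\<delta>3 > 0"
    "\<And>y. y \<in> U \<Longrightarrow> dist y x < \<delta>3 \<Longrightarrow> mlin_norm_le (length J) (\<lambda>vs. N y vs - N x vs) \<epsilon>'"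
    using multi_contD[OF _ x e'(1)] by blast
  have "mlin_norm_le n (\<lambda>vs. slot_comp I J K M N y vs - slot_comp I J K M N x vs -
      (slot_comp (0 # map Suc I) (map Suc J) (map Suc K) M' N x ((y - x) # vs) +
       slot_comp (map Suc I) (0 # map Suc J) (map Suc K) M N' x ((y - x) # vs)))
      (\<epsilon> * norm (y - x))"
    if y: "y \<in> U" "dist y x < \<delta>1" "dist y x < \<delta>2" "dist y x < \<delta>3" for y
  proof -
    let ?v = "y - x"
    define s where "s = norm ?v"
    have s: "s \<ge> 0" by (simp add: s_def)
    have Ny: "mlin_norm_le (length J) (N y) (\<epsilon>' + d)"
      using mlin_norm_le_add[OF 3(2)[OF y(1,4)] d(2)] by simp
    have M'v: "mlin_norm_le ?p (\<lambda>vs. M' x (?v # vs)) (c' * s)"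
      unfolding mlin_norm_le_iff s_def using mlin_norm_le_D[OF c'(2), of "?v # _"] by (simp add: mult_ac)
    \<comment> \<open>The three errors are the remainder of \<open>M\<close> evaluated at
      \<open>N y\<close>, the increment of \<open>N\<close> inside \<open>M' x\<close> in direction
      \<open>y - x\<close>, and the remainder of \<open>N\<close> inside \<open>M x\<close>. They
      account for \<open>d + 1\<close>, \<open>c'\<close> and \<open>c\<close> in the denominator of
      \<open>\<epsilon>'\<close>.\<close>
    have *: "slot_comp I J K M N y vs - slot_comp I J K M N x vs -
      (slot_comp (0 # map Suc I) (map Suc J) (map Suc K) M' N x (?v # vs) +
       slot_comp (map Suc I) (0 # map Suc J) (map Suc K) M N' x (?v # vs)) =
      (M y (map ((!) vs) I @ N y (map ((!) vs) J) # map ((!) vs) K)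
       - M x (map ((!) vs) I @ N y (map ((!) vs) J) # map ((!) vs) K)
       - M' x (?v # map ((!) vs) I @ N y (map ((!) vs) J) # map ((!) vs) K)) +
      M' x (?v # map ((!) vs) I @ (N y (map ((!) vs) J) - N x (map ((!) vs) J)) # map ((!) vs) K) +
      M x (map ((!) vs) I @ (N y (map ((!) vs) J) - N x (map ((!) vs) J)
         - N' x (?v # map ((!) vs) J)) # map ((!) vs) K)" for vs
      using bdd_mlin_diff[OF bM[OF x], of "map ((!) vs) I" "map ((!) vs) K"]
        bdd_mlin_diff[OF bM'[OF x], of "?v # map ((!) vs) I" "map ((!) vs) K"]
      by (simp add: slot_comp_def o_def)
    have **: "mlin_norm_le n (\<lambda>vs. (M y (map ((!) vs) I @ N y (map ((!) vs) J) # map ((!) vs) K)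
       - M x (map ((!) vs) I @ N y (map ((!) vs) J) # map ((!) vs) K)
       - M' x (?v # map ((!) vs) I @ N y (map ((!) vs) J) # map ((!) vs) K)) +
      M' x (?v # map ((!) vs) I @ (N y (map ((!) vs) J) - N x (map ((!) vs) J)) # map ((!) vs) K) +
      M x (map ((!) vs) I @ (N y (map ((!) vs) J) - N x (map ((!) vs) J)
         - N' x (?v # map ((!) vs) J)) # map ((!) vs) K))
      ((\<epsilon>' * s) * (\<epsilon>' + d) + (c' * s) * \<epsilon>' + c * (\<epsilon>' * s))"
      by (intro mlin_norm_le_add mlin_norm_le_slot[OF 1(2)[OF y(1,2), folded s_def] Ny _ IJK]
           mlin_norm_le_slot[OF M'v 3(2)[OF y(1,4)] _ IJK]
           mlin_norm_le_slot[OF c(2) 2(2)[OF y(1,3), folded s_def] _ IJK])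
        (use e' c c' s in auto)
    have "(\<epsilon>' * s) * (\<epsilon>' + d) + (c' * s) * \<epsilon>' + c * (\<epsilon>' * s) \<le> \<epsilon> * s"
    proof -
      have "(\<epsilon>' * s) * (\<epsilon>' + d) \<le> (\<epsilon>' * s) * (1 + d)" using e' s by (intro mult_left_mono) auto
      then have "(\<epsilon>' * s) * (\<epsilon>' + d) + (c' * s) * \<epsilon>' + c * (\<epsilon>' * s) \<le> \<epsilon>' * (c + c' + d + 1) * s"
        by (simp add: algebra_simps)
      also have "\<dots> \<le> \<epsilon> / (c + c' + d + 1) * (c + c' + d + 1) * s"
        using c d c' s by (intro mult_right_mono) (auto simp: \<epsilon>'_def)
      also have "\<dots> = \<epsilon> * s" using c d c' by simp
      finally show ?thesis .
    qed
    from mlin_norm_le_mono[OF ** this] show ?thesis unfolding * s_def .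
  qed
  then show "\<exists>\<delta>>0. \<forall>y\<in>U. dist y x < \<delta> \<longrightarrow>
      mlin_norm_le n (\<lambda>vs. slot_comp I J K M N y vs - slot_comp I J K M N x vs -
      (slot_comp (0 # map Suc I) (map Suc J) (map Suc K) M' N x ((y - x) # vs) +
       slot_comp (map Suc I) (0 # map Suc J) (map Suc K) M N' x ((y - x) # vs)))
      (\<epsilon> * norm (y - x))"
    using 1(1) 2(1) 3(1) by (intro exI[of _ "min (min \<delta>1 \<delta>2) \<delta>3"]) auto
qed

text \<open>Each summand of the product rule differentiates one factor and keeps the other, which is
  then used with one order less. So both summands fall under the induction hypothesis.\<close>

lemma C_multi_slot:
  assumes "C_multi m (length I + Suc (length K)) U M" "C_multi m (length J) U N"
    and "distinct (I @ J @ K)" "set (I @ J @ K) = {..<n}"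
  shows "C_multi m n U (slot_comp I J K M N)"
  using assms
proof (induction m arbitrary: I J K M N n)
  case 0
  have "bdd_mlin n (slot_comp I J K M N x)" if "x \<in> U" for x
    unfolding slot_comp_def using 0 that by (intro bdd_mlin_slot) auto
  moreover have "multi_cont n U (slot_comp I J K M N)"
    using 0 by (intro multi_cont_slot) auto
  ultimately show ?case by simp
next
  case (Suc m)
  obtain M' where M': "C_multi m (Suc (length I + Suc (length K))) U M'"
    "multi_deriv (length I + Suc (length K)) U M M'" using Suc.prems(1) by auto
  obtain N' where N': "C_multi m (Suc (length J)) U N'"
    "multi_deriv (length J) U N N'" using Suc.prems(2) by auto
  note low = Suc.prems(1,2)[THEN C_multi_Suc_lower]
  have ran: "Suc ` set I \<union> (Suc ` set J \<union> Suc ` set K) = Suc ` {..<n}"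
    unfolding Suc.prems(4)[symmetric] by auto
  have range: "insert 0 (Suc ` {..<n}) = {..<Suc n}"
    using lessThan_Suc_eq_insert_0 by blast
  have 1: "C_multi m (Suc n) U (slot_comp (0 # map Suc I) (map Suc J) (map Suc K) M' N)"
    by (rule Suc.IH) (use M' low Suc.prems(3) ran range in \<open>auto simp: distinct_map\<close>)
  have 2: "C_multi m (Suc n) U (slot_comp (map Suc I) (0 # map Suc J) (map Suc K) M N')"
    by (rule Suc.IH) (use N' low Suc.prems(3) ran range in \<open>auto simp: distinct_map\<close>)
  have 3: "multi_deriv n U (slot_comp I J K M N)
    (\<lambda>x vs. slot_comp (0 # map Suc I) (map Suc J) (map Suc K) M' N x vs +
            slot_comp (map Suc I) (0 # map Suc J) (map Suc K) M N' x vs)"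
    by (rule multi_deriv_slot[OF M'(2) N'(2) C_multi_bml[OF low(1)] C_multi_bml[OF M'(1)]
          C_multi_bml[OF low(2)] C_multi_bml[OF N'(1)] Suc.prems(3,4)])
  have "bdd_mlin n (slot_comp I J K M N x)" if "x \<in> U" for x
    using bdd_mlin_slot[OF C_multi_bml[OF low(1) that] C_multi_bml[OF low(2) that] Suc.prems(3,4)]
    by (simp add: slot_comp_def[abs_def])
  with C_multi_add[OF 1 2] 3 show ?case unfolding C_multi.simps by blast
qed

section \<open>Composition and inversion\<close>

text \<open>Connects with \<open>has_derivative\<close> at fixed arguments \<open>vs\<close>, so
  that the mean value theorem and the derivative of an inverse function become available.\<close>

lemma multi_deriv_has_derivative:
  assumes "multi_deriv j U M M'" "open U" "x \<in> U" "bdd_mlin (Suc j) (M' x)" "length vs = j"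
  shows "((\<lambda>x. M x vs) has_derivative (\<lambda>v. M' x (v # vs))) (at x)"
  unfolding has_derivative_at_alt
proof (intro conjI allI impI)
  show "bounded_linear (\<lambda>v. M' x (v # vs))"
    using assms by (intro bdd_mlin_Cons_bounded_linear)
  fix e :: real assume e: "e > 0"
  define p where "p = prod_list (map norm vs)"
  have p: "p \<ge> 0" by (simp add: p_def)
  \<comment> \<open>\<open>p\<close> may be \<open>0\<close>, hence \<open>p + 1\<close>.\<close>
  have e': "e / (p + 1) > 0" using p e by simp
  obtain \<delta> where \<delta>: "\<delta> > 0"
    "\<And>y. y \<in> U \<Longrightarrow> dist y x < \<delta> \<Longrightarrow>
      mlin_norm_le j (\<lambda>vs. M y vs - M x vs - M' x ((y - x) # vs)) (e / (p + 1) * norm (y - x))"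
    using multi_derivD[OF assms(1,3,4) e'] by blast
  obtain r where r: "r > 0" "ball x r \<subseteq> U" using assms(2,3) openE by blast
  have "norm (M y vs - M x vs - M' x ((y - x) # vs)) \<le> e * norm (y - x)"
    if "norm (y - x) < min \<delta> r" for y
  proof -
    have "norm (M y vs - M x vs - M' x ((y - x) # vs)) \<le> e / (p + 1) * norm (y - x) * p"
      using mlin_norm_le_D[OF \<delta>(2), of y vs] that r assms(5)
      by (auto simp: p_def dist_norm norm_minus_commute subset_eq)
    also have "\<dots> = e * norm (y - x) * (p / (p + 1))" by simp
    also have "\<dots> \<le> e * norm (y - x) * 1" using p e by (intro mult_left_mono) auto
    finally show ?thesis by simp
  qed
  then show "\<exists>d>0. \<forall>y. norm (y - x) < d \<longrightarrow>
      norm (M y vs - M x vs - M' x ((y - x) # vs)) \<le> e * norm (y - x)"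
    using \<delta>(1) r(1) by (intro exI[of _ "min \<delta> r"]) auto
qed

lemma multi_derivI_has_derivative:
  assumes "\<And>x. x \<in> U \<Longrightarrow> (f has_derivative (\<lambda>v. M' x [v])) (at x)"
  shows "multi_deriv 0 U (\<lambda>x vs. f x) M'"
proof (rule multi_derivI)
  fix x and \<epsilon> :: real assume "x \<in> U" and e: "\<epsilon> > 0"
  from assms[OF this(1)] e obtain d where "d > 0"
    "\<And>y. norm (y - x) < d \<Longrightarrow> norm (f y - f x - M' x [y - x]) \<le> \<epsilon> * norm (y - x)"
    unfolding has_derivative_at_alt by blast
  then show "\<exists>\<delta>>0. \<forall>y\<in>U. dist y x < \<delta> \<longrightarrow>
      mlin_norm_le 0 (\<lambda>vs. f y - f x - M' x ((y - x) # vs)) (\<epsilon> * norm (y - x))"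
    by (intro exI[of _ d]) (simp add: mlin_norm_le_iff dist_norm)
qed

section \<open>Chain rule\<close>

lemma map_nth_upt_Cons: "length vs = j \<Longrightarrow> map ((!) (v # vs)) [Suc 0..<Suc j] = vs"
  by (intro nth_equalityI) (auto simp del: upt_Suc)

lemma multi_cont_compose:
  assumes M: "multi_cont j V M" and "continuous_on U g" "g ` U \<subseteq> V"
  shows "multi_cont j U (\<lambda>x. M (g x))"
proof (rule multi_contI)
  fix x and \<epsilon> :: real assume x: "x \<in> U" and e: "\<epsilon> > 0"
  then have "g x \<in> V" using assms(3) by blast
  from multi_contD[OF M this e] obtain \<delta> where \<delta>: "\<delta> > 0"
    "\<And>y. y \<in> V \<Longrightarrow> dist y (g x) < \<delta> \<Longrightarrow> mlin_norm_le j (\<lambda>vs. M y vs - M (g x) vs) \<epsilon>" by blast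
  obtain d where d: "d > 0" "\<And>y. y \<in> U \<Longrightarrow> dist y x < d \<Longrightarrow> dist (g y) (g x) < \<delta>"
    using assms(2)[unfolded continuous_on_iff, rule_format, OF x \<delta>(1)] by blast
  show "\<exists>\<delta>>0. \<forall>y\<in>U. dist y x < \<delta> \<longrightarrow> mlin_norm_le j (\<lambda>vs. M (g y) vs - M (g x) vs) \<epsilon>"
    using d \<delta> assms(3) by (intro exI[of _ d]) blast
qed

lemma multi_cont_0_continuous_on:
  fixes g :: "'a::real_normed_vector \<Rightarrow> 'b::real_normed_vector"
  shows "multi_cont 0 U (\<lambda>x vs. g x) \<longleftrightarrow> continuous_on U g"
proof
  assume *: "multi_cont 0 U (\<lambda>x vs. g x)"
  show "continuous_on U g"
    unfolding continuous_on_iff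
  proof (intro ballI allI impI)
    fix x and e :: real assume x: "x \<in> U" and e: "e > 0"
    then have e2: "e / 2 > 0" by simp
    obtain \<delta> where \<delta>: "\<delta> > 0"
      "\<And>y. y \<in> U \<Longrightarrow> dist y x < \<delta> \<Longrightarrow> mlin_norm_le 0 (\<lambda>vs::'a list. g y - g x) (e / 2)"
      by (rule multi_contD[OF * x e2]) (rule that)
    have "dist (g y) (g x) < e" if "y \<in> U" "dist y x < \<delta>" for y
      using \<delta>(2)[OF that] e by (simp add: mlin_norm_le_iff dist_norm)
    then show "\<exists>d>0. \<forall>y\<in>U. dist y x < d \<longrightarrow> dist (g y) (g x) < e" using \<delta>(1) by blast
  qed
next
  assume *: "continuous_on U g"
  show "multi_cont 0 U (\<lambda>x vs. g x)"
  proof (rule multi_contI)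
    fix x and e :: real assume x: "x \<in> U" and e: "e > 0"
    obtain d where "d > 0" "\<And>y. y \<in> U \<Longrightarrow> dist y x < d \<Longrightarrow> dist (g y) (g x) < e"
      using *[unfolded continuous_on_iff, rule_format, OF x e] by blast
    then show "\<exists>\<delta>>0. \<forall>y\<in>U. dist y x < \<delta> \<longrightarrow> mlin_norm_le 0 (\<lambda>vs::'a list. g y - g x) e"
      by (intro exI[of _ d]) (auto simp: mlin_norm_le_iff dist_norm less_imp_le)
  qed
qed

text \<open>The derivative sends \<open>v # vs\<close> to \<open>M' (g x) (G x [v] # vs)\<close>. It
  is written as a slot composition with \<open>I\<close> empty, \<open>J = [0]\<close> and the old
  arguments in \<open>K\<close>, so that \<open>C_multi_slot\<close> governs its further
  derivatives.\<close>

lemma multi_deriv_compose: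
  fixes g :: "'a::real_normed_vector \<Rightarrow> 'a"
  assumes M: "multi_deriv j V M M'" and g: "multi_deriv 0 U (\<lambda>x vs. g x) G" and sub: "g ` U \<subseteq> V"
    and bM': "\<And>x. x \<in> V \<Longrightarrow> bdd_mlin (Suc j) (M' x)" and bG: "\<And>x. x \<in> U \<Longrightarrow> bdd_mlin (Suc 0) (G x)"
  shows "multi_deriv j U (\<lambda>x. M (g x)) (slot_comp [] [0] [Suc 0..<Suc j] (\<lambda>x. M' (g x)) G)"
proof (rule multi_derivI)
  fix x and \<epsilon> :: real assume x: "x \<in> U" and e: "\<epsilon> > 0"
  have gx: "g x \<in> V" using x sub by blast
  note bGx = bG[OF x]
  obtain c where c: "c \<ge> 0" "mlin_norm_le (Suc j) (M' (g x)) c" using bM'[OF gx] bdd_mlin_bound by blast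
  obtain \<delta>1 k where 1: "\<delta>1 > 0" "k \<ge> 0"
    "\<And>y. y \<in> U \<Longrightarrow> dist y x < \<delta>1 \<Longrightarrow> mlin_norm_le 0 (\<lambda>vs::'a list. g y - g x) (k * norm (y - x))"
    by (rule multi_deriv_bound[OF g x bGx]) (rule that)
  \<comment> \<open>\<open>k\<close> is a Lipschitz constant of \<open>g\<close> at \<open>x\<close>
    and \<open>c\<close> bounds \<open>M' (g x)\<close>: the remainder of \<open>M\<close>
    contributes \<open>k\<close>, that of \<open>g\<close> contributes \<open>c\<close>.\<close>
  define \<epsilon>' where "\<epsilon>' = \<epsilon> / (k + c + 1)"
  have e': "\<epsilon>' > 0" using e 1 c by (auto simp: \<epsilon>'_def)
  obtain \<delta>2 where 2: "\<delta>2 > 0"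
    "\<And>y. y \<in> U \<Longrightarrow> dist y x < \<delta>2 \<Longrightarrow>
      mlin_norm_le 0 (\<lambda>vs::'a list. g y - g x - G x ((y - x) # vs)) (\<epsilon>' * norm (y - x))"
    by (rule multi_derivD[OF g x bGx e']) (rule that)
  obtain \<delta>3 where 3: "\<delta>3 > 0"
    "\<And>z. z \<in> V \<Longrightarrow> dist z (g x) < \<delta>3 \<Longrightarrow>
      mlin_norm_le j (\<lambda>vs. M z vs - M (g x) vs - M' (g x) ((z - g x) # vs)) (\<epsilon>' * norm (z - g x))"
    using multi_derivD[OF M gx bM'[OF gx] e'] by blast
  \<comment> \<open>The last radius keeps \<open>g y\<close> within \<open>\<delta>3\<close> of
    \<open>g x\<close>.\<close>
  define \<delta> where "\<delta> = min (min \<delta>1 \<delta>2) (\<delta>3 / (k + 1))"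
  have "mlin_norm_le j (\<lambda>vs. M (g y) vs - M (g x) vs -
      slot_comp [] [0] [Suc 0..<Suc j] (\<lambda>x. M' (g x)) G x ((y - x) # vs)) (\<epsilon> * norm (y - x))"
    if y: "y \<in> U" "dist y x < \<delta>" for y
  proof -
    define s where "s = norm (y - x)"
    have s: "s \<ge> 0" by (simp add: s_def)
    have gy: "g y \<in> V" using y sub by blast
    have n1: "norm (g y - g x) \<le> k * s"
      using 1(3)[of y] y by (simp add: mlin_norm_le_iff \<delta>_def s_def)
    have "(k + 1) * s < \<delta>3" using y 1(2) by (simp add: \<delta>_def s_def dist_norm field_simps)
    then have "k * s < \<delta>3" using s by (simp add: algebra_simps)
    then have "dist (g y) (g x) < \<delta>3" using n1 by (simp add: dist_norm)
    note A = 3(2)[OF gy this]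
    have n2: "norm (g y - g x - G x [y - x]) \<le> \<epsilon>' * s"
      using 2(2)[of y] y by (simp add: mlin_norm_le_iff \<delta>_def s_def)
    show ?thesis
      unfolding mlin_norm_le_iff
    proof (intro allI impI)
      fix vs :: "'a list" assume len: "length vs = j"
      define p where "p = prod_list (map norm vs)"
      have p: "p \<ge> 0" by (simp add: p_def)
      have "slot_comp [] [0] [Suc 0..<Suc j] (\<lambda>x. M' (g x)) G x ((y - x) # vs) =
          M' (g x) (G x [y - x] # vs)"
        unfolding slot_comp_def map_nth_upt_Cons[OF len] by simp
      then have eq: "M (g y) vs - M (g x) vs -
          slot_comp [] [0] [Suc 0..<Suc j] (\<lambda>x. M' (g x)) G x ((y - x) # vs) =
        (M (g y) vs - M (g x) vs - M' (g x) ((g y - g x) # vs)) +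
        M' (g x) ((g y - g x - G x [y - x]) # vs)"
        using bdd_mlin_diff[OF bM'[OF gx], of "[]" vs] len by simp
      have b1: "norm (M (g y) vs - M (g x) vs - M' (g x) ((g y - g x) # vs))
          \<le> \<epsilon>' * (k * s) * p"
      proof -
        have "norm (M (g y) vs - M (g x) vs - M' (g x) ((g y - g x) # vs))
          \<le> \<epsilon>' * norm (g y - g x) * p"
          using mlin_norm_le_D[OF A len] by (simp add: p_def)
        also have "\<dots> \<le> \<epsilon>' * (k * s) * p"
          using e' p n1 by (intro mult_right_mono mult_left_mono) auto
        finally show ?thesis .
      qed
      have b2: "norm (M' (g x) ((g y - g x - G x [y - x]) # vs)) \<le> c * (\<epsilon>' * s) * p"
      proof -
        have "norm (M' (g x) ((g y - g x - G x [y - x]) # vs))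
          \<le> c * norm (g y - g x - G x [y - x]) * p"
          using mlin_norm_le_D[OF c(2), of "(g y - g x - G x [y - x]) # vs"] len by (simp add: p_def mult_ac)
        also have "\<dots> \<le> c * (\<epsilon>' * s) * p"
          using c p n2 by (intro mult_right_mono mult_left_mono) auto
        finally show ?thesis .
      qed
      have "norm (M (g y) vs - M (g x) vs -
          slot_comp [] [0] [Suc 0..<Suc j] (\<lambda>x. M' (g x)) G x ((y - x) # vs))
        \<le> \<epsilon>' * (k * s) * p + c * (\<epsilon>' * s) * p"
        unfolding eq by (rule norm_triangle_mono[OF b1 b2])
      also have "\<dots> = \<epsilon>' * (k + c) * (s * p)" by (simp add: algebra_simps)
      also have "\<dots> \<le> \<epsilon> * (s * p)"
      proof (rule mult_right_mono)
        have "\<epsilon>' * (k + c) \<le> \<epsilon>' * (k + c + 1)" using e' by simp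
        also have "\<dots> = \<epsilon>" using c 1(2) by (simp add: \<epsilon>'_def)
        finally show "\<epsilon>' * (k + c) \<le> \<epsilon>" .
      qed (use s p in simp)
      finally show "norm (M (g y) vs - M (g x) vs -
          slot_comp [] [0] [Suc 0..<Suc j] (\<lambda>x. M' (g x)) G x ((y - x) # vs))
        \<le> \<epsilon> * norm (y - x) * prod_list (map norm vs)"
        by (simp add: p_def s_def mult_ac)
    qed
  qed
  moreover have "\<delta> > 0" using 1 2 3 by (simp add: \<delta>_def)
  ultimately show "\<exists>\<delta>>0. \<forall>y\<in>U. dist y x < \<delta> \<longrightarrow> mlin_norm_le j (\<lambda>vs. M (g y) vs - M (g x) vs -
      slot_comp [] [0] [Suc 0..<Suc j] (\<lambda>x. M' (g x)) G x ((y - x) # vs)) (\<epsilon> * norm (y - x))"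
    by blast
qed

text \<open>The derivative combines \<open>G\<close> with \<open>M'\<close> composed with
  \<open>g\<close>; the latter is covered by the induction hypothesis for \<open>Suc j\<close>
  arguments, which is why \<open>j\<close> and \<open>M\<close> vary in the induction.\<close>

lemma C_multi_compose:
  assumes "C_multi m j V M" "C_multi m 0 U (\<lambda>x vs. g x)" "g ` U \<subseteq> V"
  shows "C_multi m j U (\<lambda>x. M (g x))"
  using assms(1,2)
proof (induction m arbitrary: j M)
  case 0
  then show ?case using multi_cont_compose[of j V M U g] assms(3)
    by (auto simp: multi_cont_0_continuous_on)
next
  case (Suc m)
  obtain M' where M': "C_multi m (Suc j) V M'" "multi_deriv j V M M'" using Suc.prems(1) by auto
  obtain G where G: "C_multi m (Suc 0) U G" "multi_deriv 0 U (\<lambda>x vs. g x) G"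
    using Suc.prems(2) by auto
  have "C_multi m (Suc j) U (slot_comp [] [0] [Suc 0..<Suc j] (\<lambda>x. M' (g x)) G)"
  proof (rule C_multi_slot)
    show "C_multi m (length [] + Suc (length [Suc 0..<Suc j])) U (\<lambda>x. M' (g x))"
      using Suc.IH[OF M'(1) C_multi_Suc_lower[OF Suc.prems(2)]] by (simp del: upt_Suc)
  qed (use G in \<open>auto simp del: upt_Suc\<close>)
  moreover have "multi_deriv j U (\<lambda>x. M (g x)) (slot_comp [] [0] [Suc 0..<Suc j] (\<lambda>x. M' (g x)) G)"
    by (rule multi_deriv_compose[OF M'(2) G(2) assms(3) C_multi_bml[OF M'(1)] C_multi_bml[OF G(1)]])
  moreover have "bdd_mlin j (M (g x))" if "x \<in> U" for x
    using C_multi_bml[OF Suc.prems(1)] assms(3) that by blast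
  ultimately show ?case by auto
qed

section \<open>Smoothness of the inverse of 1 - T\<close>

lemma bdd_mlin_1_linear:
  assumes "bdd_mlin (Suc 0) L"
  shows "L [a + b] = L [a] + L [b]" "L [a - b] = L [a] - L [b]" "L [c *\<^sub>R a] = c *\<^sub>R L [a]"
  using bdd_mlin_add[OF assms, of "[]" "[]"] bdd_mlin_diff[OF assms, of "[]" "[]"]
    bdd_mlin_scaleR[OF assms, of "[]" "[]"] by auto

text \<open>In operator form \<open>A y - A x = A y (T y - T x) A x\<close>, where \<open>A\<close>
  inverts \<open>1 - T\<close>: write \<open>v\<close> as \<open>(1 - T x) A x v\<close> in the
  first term and \<open>A x v\<close> as \<open>A y (1 - T y) A x v\<close> in the second.\<close>

lemma resolvent_identity:
  assumes "bdd_mlin (Suc 0) (A x)" "bdd_mlin (Suc 0) (A y)" "bdd_mlin (Suc 0) (T x)" "bdd_mlin (Suc 0) (T y)"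
    and "\<And>v. A y [v - T y [v]] = v" "\<And>v. A x [v] - T x [A x [v]] = v"
  shows "A y [v] - A x [v] = A y [T y [A x [v]] - T x [A x [v]]]"
proof -
  have "A y [v] - A x [v] = A y [A x [v] - T x [A x [v]]] - A y [A x [v] - T y [A x [v]]]"
    by (simp add: assms)
  also have "\<dots> = A y [T y [A x [v]] - T x [A x [v]]]"
    by (simp add: bdd_mlin_1_linear[OF assms(2)])
  finally show ?thesis .
qed

text \<open>The resolvent identity and the uniform bound \<open>c\<close> give continuity, and then
  the derivative \<open>A T' A\<close>. As this contains \<open>A\<close> itself, each order follows
  from the previous order of \<open>A\<close> and from \<open>T'\<close>.\<close>

lemma C_multi_resolvent:
  fixes T A :: "'a::real_normed_vector \<Rightarrow> 'a list \<Rightarrow> 'a"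
  assumes T: "C_multi m (Suc 0) U T"
    and A: "\<And>x. x \<in> U \<Longrightarrow> bdd_mlin (Suc 0) (A x)" "\<And>x. x \<in> U \<Longrightarrow> mlin_norm_le (Suc 0) (A x) c" "c > 0"
    and inv: "\<And>x v. x \<in> U \<Longrightarrow> A x [v - T x [v]] = v" "\<And>x v. x \<in> U \<Longrightarrow> A x [v] - T x [A x [v]] = v"
  shows "C_multi m (Suc 0) U A"
proof -
  have nA: "norm (A x [v]) \<le> c * norm v" if "x \<in> U" for x v
    using mlin_norm_le_D[OF A(2)[OF that], of "[v]"] by simp
  have id: "A y [v] - A x [v] = A y [T y [A x [v]] - T x [A x [v]]]" if "x \<in> U" "y \<in> U" for x y v
    by (rule resolvent_identity) (use that A C_multi_bml[OF T] inv in auto)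
  have len1: "(length vs = Suc 0) = (\<exists>v. vs = [v])" for vs :: "'a list"
    by (auto simp: length_Suc_conv)
  have cont: "multi_cont (Suc 0) U A"
  proof (rule multi_contI)
    fix x and \<epsilon> :: real assume x: "x \<in> U" and e: "\<epsilon> > 0"
    \<comment> \<open>One factor \<open>c\<close> for each \<open>A\<close> on the right of the
      resolvent identity.\<close>
    define \<epsilon>' where "\<epsilon>' = \<epsilon> / (c * c)"
    have e': "\<epsilon>' > 0" using e A(3) by (simp add: \<epsilon>'_def)
    obtain \<delta> where \<delta>: "\<delta> > 0"
      "\<And>y. y \<in> U \<Longrightarrow> dist y x < \<delta> \<Longrightarrow> mlin_norm_le (Suc 0) (\<lambda>vs. T y vs - T x vs) \<epsilon>'"
      using multi_contD[OF C_multi_cont[OF T] x e'] by blast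
    have "norm (A y [v] - A x [v]) \<le> \<epsilon> * norm v" if y: "y \<in> U" "dist y x < \<delta>" for y v
    proof -
      have "norm (A y [v] - A x [v]) \<le> c * norm (T y [A x [v]] - T x [A x [v]])"
        unfolding id[OF x y(1)] using nA y by blast
      also have "\<dots> \<le> c * (\<epsilon>' * norm (A x [v]))"
        using mlin_norm_le_D[OF \<delta>(2)[OF y], of "[A x [v]]"] A(3) by (intro mult_left_mono) auto
      also have "\<dots> \<le> c * (\<epsilon>' * (c * norm v))"
        using A(3) e' nA[OF x] by (intro mult_left_mono) auto
      also have "\<dots> = \<epsilon> * norm v" using A(3) by (simp add: \<epsilon>'_def)
      finally show ?thesis .
    qed
    then show "\<exists>\<delta>>0. \<forall>y\<in>U. dist y x < \<delta> \<longrightarrow> mlin_norm_le (Suc 0) (\<lambda>vs. A y vs - A x vs) \<epsilon>"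
      using \<delta>(1) by (intro exI[of _ \<delta>]) (auto simp: mlin_norm_le_iff len1)
  qed
  \<comment> \<open>For arguments \<open>[v, w]\<close> the inner composition is
    \<open>T' x [v, A x [w]]\<close>; the outer one applies \<open>A x\<close> to it.\<close>
  have deriv: "multi_deriv (Suc 0) U A
      (slot_comp [] [0, 1] [] A (slot_comp [0] [1] [] T' A))"
    if T': "multi_deriv (Suc 0) U T T'" "\<And>x. x \<in> U \<Longrightarrow> bdd_mlin (Suc (Suc 0)) (T' x)" for T'
  proof (rule multi_derivI)
    fix x and \<epsilon> :: real assume x: "x \<in> U" and e: "\<epsilon> > 0"
    obtain k where k: "k \<ge> 0" "mlin_norm_le (Suc (Suc 0)) (T' x) k" using T'(2)[OF x] bdd_mlin_bound by blast
    \<comment> \<open>The remainder of \<open>T\<close> between two factors \<open>A\<close> costs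
      \<open>c * c\<close>; replacing \<open>A y\<close> by \<open>A x\<close> in front of
      \<open>T' A\<close> costs \<open>k * c\<close>.\<close>
    define \<epsilon>' where "\<epsilon>' = \<epsilon> / (c * (c + k))"
    have e': "\<epsilon>' > 0" using e A(3) k by (simp add: \<epsilon>'_def)
    obtain \<delta>1 where 1: "\<delta>1 > 0"
      "\<And>y. y \<in> U \<Longrightarrow> dist y x < \<delta>1 \<Longrightarrow>
         mlin_norm_le (Suc 0) (\<lambda>vs. T y vs - T x vs - T' x ((y - x) # vs)) (\<epsilon>' * norm (y - x))"
      using multi_derivD[OF T'(1) x T'(2)[OF x] e'] by blast
    obtain \<delta>2 where 2: "\<delta>2 > 0"
      "\<And>y. y \<in> U \<Longrightarrow> dist y x < \<delta>2 \<Longrightarrow> mlin_norm_le (Suc 0) (\<lambda>vs. A y vs - A x vs) \<epsilon>'"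
      using multi_contD[OF cont x e'] by blast
    have "norm (A y [v] - A x [v] - A x [T' x [y - x, A x [v]]]) \<le> \<epsilon> * norm (y - x) * norm v"
      if y: "y \<in> U" "dist y x < \<delta>1" "dist y x < \<delta>2" for y v
    proof -
      let ?w = "A x [v]"
      have eq: "A y [v] - A x [v] - A x [T' x [y - x, ?w]] =
        A y [T y [?w] - T x [?w] - T' x [y - x, ?w]]
        + (A y [T' x [y - x, ?w]] - A x [T' x [y - x, ?w]])"
        unfolding id[OF x y(1), of v] by (simp add: bdd_mlin_1_linear[OF A(1)[OF y(1)]])
      have b1: "norm (A y [T y [?w] - T x [?w] - T' x [y - x, ?w]])
          \<le> c * (\<epsilon>' * norm (y - x) * (c * norm v))"
      proof -
        have "norm (A y [T y [?w] - T x [?w] - T' x [y - x, ?w]])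
          \<le> c * norm (T y [?w] - T x [?w] - T' x [y - x, ?w])" using nA y by blast
        also have "\<dots> \<le> c * (\<epsilon>' * norm (y - x) * norm ?w)"
          using mlin_norm_le_D[OF 1(2)[OF y(1,2)], of "[?w]"] A(3) by (intro mult_left_mono) auto
        also have "\<dots> \<le> c * (\<epsilon>' * norm (y - x) * (c * norm v))"
          using A(3) e' nA[OF x] by (intro mult_left_mono) auto
        finally show ?thesis .
      qed
      have b2: "norm (A y [T' x [y - x, ?w]] - A x [T' x [y - x, ?w]])
          \<le> \<epsilon>' * (k * norm (y - x) * (c * norm v))"
      proof -
        have "norm (A y [T' x [y - x, ?w]] - A x [T' x [y - x, ?w]]) \<le> \<epsilon>' * norm (T' x [y - x, ?w])"
          using mlin_norm_le_D[OF 2(2)[OF y(1,3)], of "[T' x [y - x, ?w]]"] by simp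
        also have "\<dots> \<le> \<epsilon>' * (k * norm (y - x) * norm ?w)"
          using mlin_norm_le_D[OF k(2), of "[y - x, ?w]"] e' by (intro mult_left_mono) (auto simp: mult_ac)
        also have "\<dots> \<le> \<epsilon>' * (k * norm (y - x) * (c * norm v))"
          using k e' nA[OF x] by (intro mult_left_mono) auto
        finally show ?thesis .
      qed
      have "norm (A y [v] - A x [v] - A x [T' x [y - x, ?w]]) \<le>
          c * (\<epsilon>' * norm (y - x) * (c * norm v)) + \<epsilon>' * (k * norm (y - x) * (c * norm v))"
        unfolding eq by (rule norm_triangle_mono[OF b1 b2])
      also have "\<dots> = \<epsilon>' * (c * (c + k)) * (norm (y - x) * norm v)" by (simp add: algebra_simps)
      also have "\<epsilon>' * (c * (c + k)) = \<epsilon>" using A(3) k by (simp add: \<epsilon>'_def)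
      finally show ?thesis by simp
    qed
    then show "\<exists>\<delta>>0. \<forall>y\<in>U. dist y x < \<delta> \<longrightarrow> mlin_norm_le (Suc 0) (\<lambda>vs. A y vs - A x vs -
        slot_comp [] [0, 1] [] A (slot_comp [0] [1] [] T' A) x ((y - x) # vs)) (\<epsilon> * norm (y - x))"
      using 1(1) 2(1)
      by (intro exI[of _ "min \<delta>1 \<delta>2"]) (auto simp: mlin_norm_le_iff len1 slot_comp_def)
  qed
  show ?thesis using T
  proof (induction m)
    case 0
    then show ?case using cont A by auto
  next
    case (Suc m)
    obtain T' where T': "C_multi m (Suc (Suc 0)) U T'" "multi_deriv (Suc 0) U T T'"
      using Suc.prems by auto
    have IH: "C_multi m (Suc 0) U A" using Suc.IH C_multi_Suc_lower[OF Suc.prems] .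
    have Q: "C_multi m (Suc (Suc 0)) U (slot_comp [0] [1] [] T' A)"
      by (rule C_multi_slot) (use T' IH in auto)
    have "C_multi m (Suc (Suc 0)) U (slot_comp [] [0, 1] [] A (slot_comp [0] [1] [] T' A))"
      by (rule C_multi_slot) (use Q IH in auto)
    then show ?case using deriv[OF T'(2) C_multi_bml[OF T'(1)]] A by auto
  qed
qed

section \<open>Smooth dependence of fixed points\<close>

lemma bdd_mlin_1I:
  assumes "\<And>a b. L [a + b] = L [a] + L [b]" "\<And>c a. L [c *\<^sub>R a] = c *\<^sub>R L [a]"
    and "\<And>v. norm (L [v]) \<le> K * norm v" "K \<ge> 0"
  shows "bdd_mlin (Suc 0) L" "mlin_norm_le (Suc 0) L K"
proof -
  show n: "mlin_norm_le (Suc 0) L K" using assms(3) by (auto simp: mlin_norm_le_iff length_Suc_conv)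
  show "bdd_mlin (Suc 0) L" unfolding bdd_mlin_iff
    using assms n by auto
qed

text \<open>\<psi> inverts \<open>x - K x\<close>, so its derivative is \<open>A\<close> composed
  with \<psi>, where \<open>A\<close> inverts \<open>1 - T\<close>. \<open>A\<close> has order
  \<open>k\<close>; whenever \<psi> has order \<open>m \<le> k\<close>, so does this derivative, and
  thus \<psi> has order \<open>Suc m\<close>.\<close>

lemma C_multi_fixed_point:
  fixes K :: "'a::{real_normed_vector, complete_space} \<Rightarrow> 'a"
  assumes "open V" "open U" and K: "C_multi (Suc k) 0 V (\<lambda>x vs. K x)"
    and lip: "\<And>x y. x \<in> V \<Longrightarrow> y \<in> V \<Longrightarrow> norm (K x - K y) \<le> norm (x - y) / 2"
    and \<psi>: "\<And>w. w \<in> U \<Longrightarrow> \<psi> w \<in> V" "\<And>w. w \<in> U \<Longrightarrow> \<psi> w = w + K (\<psi> w)"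
  shows "C_multi (Suc k) 0 U (\<lambda>w vs. \<psi> w)"
proof -
  obtain T where T: "C_multi k (Suc 0) V T" "multi_deriv 0 V (\<lambda>x vs. K x) T" using K by auto
  note bT = C_multi_bml[OF T(1)]
  have der: "(K has_derivative (\<lambda>v. T x [v])) (at x)" if "x \<in> V" for x
    using multi_deriv_has_derivative[OF T(2) assms(1) that bT[OF that], of "[]"] by simp
  \<comment> \<open>\<open>1/2\<close> comes from the Lipschitz bound and \<open>1/4\<close> from
    the remainder of \<open>K\<close> at one small step; any sum below \<open>1\<close> would
    serve.\<close>
  have nT: "norm (T x [v]) \<le> 3/4 * norm v" if x: "x \<in> V" for x v
  proof (cases "v = 0")
    case True
    then show ?thesis using bdd_mlin_1_linear(3)[OF bT[OF x], of 0 0] by simp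
  next
    case False
    obtain d where d: "d > 0"
      "\<And>y. norm (y - x) < d \<Longrightarrow> norm (K y - K x - T x [y - x]) \<le> 1/4 * norm (y - x)"
      using der[OF x, unfolded has_derivative_at_alt, THEN conjunct2, rule_format, of "1/4"] by auto
    obtain r where r: "r > 0" "ball x r \<subseteq> V" using assms(1) x openE by blast
    \<comment> \<open>Scales \<open>v\<close> to half the admissible radius.\<close>
    define s where "s = min d r / (2 * norm v)"
    have s: "s > 0" using d r False by (simp add: s_def)
    have sv: "norm (s *\<^sub>R v) < min d r" using d(1) r(1) False s by (auto simp: s_def min_def)
    then have "x + s *\<^sub>R v \<in> V" using r(2) by (auto simp: dist_norm)
    from lip[OF this x] have "norm (K (x + s *\<^sub>R v) - K x) \<le> norm (s *\<^sub>R v) / 2" by simp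
    moreover have "norm (K (x + s *\<^sub>R v) - K x - T x [s *\<^sub>R v]) \<le> 1/4 * norm (s *\<^sub>R v)"
      using d(2)[of "x + s *\<^sub>R v"] sv by simp
    ultimately have "norm (T x [s *\<^sub>R v]) \<le> 3/4 * norm (s *\<^sub>R v)"
      using norm_triangle_sub[of "T x [s *\<^sub>R v]" "K (x + s *\<^sub>R v) - K x"]
      by (simp add: norm_minus_commute)
    then have "s * norm (T x [v]) \<le> s * (3/4 * norm v)"
      using s by (simp add: bdd_mlin_1_linear(3)[OF bT[OF x]])
    then show ?thesis using s by (simp only: mult_le_cancel_left_pos)
  qed
  \<comment> \<open>Completeness inverts \<open>1 - T x\<close>: the solution \<open>z\<close> of
    \<open>z = v + T x [z]\<close> is the value of the inverse at \<open>v\<close>, in place of a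
    Neumann series.\<close>
  have ex1: "\<exists>!z. v + T x [z] = z" if x: "x \<in> V" for x v
  proof (rule banach_fix_type[where c = "3/4"])
    show "\<forall>z w. dist (v + T x [z]) (v + T x [w]) \<le> 3/4 * dist z w"
      using nT[OF x, of "_ - _"] by (auto simp: dist_norm bdd_mlin_1_linear[OF bT[OF x]])
  qed auto
  define A where "A x vs = (THE z. hd vs + T x [z] = z)" for x vs
  have Aeq: "v + T x [A x [v]] = A x [v]" if "x \<in> V" for x v
    using theI'[OF ex1[OF that, of v]] by (simp add: A_def)
  have Auniq: "A x [v] = z" if "x \<in> V" "v + T x [z] = z" for x v z
    using the1_equality[OF ex1[OF that(1), of v] that(2)] by (simp add: A_def)
  \<comment> \<open>\<open>4 = 1 / (1 - 3/4)\<close>, obtained by absorbing the term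
    \<open>T x [A x [v]]\<close> into the left side.\<close>
  have bA: "bdd_mlin (Suc 0) (A x) \<and> mlin_norm_le (Suc 0) (A x) 4" if x: "x \<in> V" for x
  proof -
    note lin = bdd_mlin_1_linear[OF bT[OF x]]
    have "A x [a + b] = A x [a] + A x [b]" for a b
    proof (rule Auniq[OF x])
      have "a + b + T x [A x [a] + A x [b]] = (a + T x [A x [a]]) + (b + T x [A x [b]])"
        by (simp add: lin algebra_simps)
      then show "a + b + T x [A x [a] + A x [b]] = A x [a] + A x [b]"
        by (simp only: Aeq[OF x])
    qed
    moreover have "A x [c *\<^sub>R a] = c *\<^sub>R A x [a]" for c a
      using Aeq[OF x, of a] by (intro Auniq[OF x]) (metis lin(3) scaleR_add_right)
    moreover have "norm (A x [v]) \<le> 4 * norm v" for v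
    proof -
      have "norm (A x [v]) \<le> norm v + norm (T x [A x [v]])"
        by (subst Aeq[OF x, symmetric]) (rule norm_triangle_ineq)
      then show ?thesis using nT[OF x, of "A x [v]"] by linarith
    qed
    ultimately show ?thesis using bdd_mlin_1I[of "A x" 4] by auto
  qed
  have inv1: "A x [v - T x [v]] = v" if "x \<in> V" for x v
    by (rule Auniq[OF that]) simp
  have inv2: "A x [v] - T x [A x [v]] = v" if "x \<in> V" for x v
    using Aeq[OF that, of v] by (simp add: algebra_simps)
  have A: "C_multi k (Suc 0) V A"
    by (rule C_multi_resolvent[OF T(1), of A 4]) (use bA inv1 inv2 in auto)
  \<comment> \<open>\<open>2 = 1 / (1 - 1/2)\<close>. The resulting continuity of \<psi> is a
    premise of the derivative rule for inverse functions.\<close>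
  have psi_lip: "dist (\<psi> w) (\<psi> w') \<le> 2 * dist w w'" if "w \<in> U" "w' \<in> U" for w w'
  proof -
    have "norm (\<psi> w - \<psi> w') = norm ((w - w') + (K (\<psi> w) - K (\<psi> w')))"
      using \<psi>(2)[OF that(1)] \<psi>(2)[OF that(2)] by (simp add: algebra_simps)
    also have "\<dots> \<le> norm (w - w') + norm (\<psi> w - \<psi> w') / 2"
      using lip[OF \<psi>(1)[OF that(1)] \<psi>(1)[OF that(2)]] by (intro norm_triangle_mono) auto
    finally show ?thesis by (simp add: dist_norm)
  qed
  have cont: "continuous_on U \<psi>"
    by (rule lipschitz_on_continuous_on[of 2])
      (use psi_lip in \<open>auto intro: lipschitz_onI\<close>)
  have "(\<psi> has_derivative (\<lambda>v. A (\<psi> w) [v])) (at w)" if w: "w \<in> U" for w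
  proof (rule has_derivative_inverse_basic[where f = "\<lambda>x. x - K x" and T = U])
    note pV = \<psi>(1)[OF w]
    show "((\<lambda>x. x - K x) has_derivative (\<lambda>v. v - T (\<psi> w) [v])) (at (\<psi> w))"
      by (intro has_derivative_diff has_derivative_ident der pV)
    show "bounded_linear (\<lambda>v. A (\<psi> w) [v])"
      using bdd_mlin_Cons_bounded_linear[of 0 "A (\<psi> w)" "[]"] bA[OF pV] by simp
    show "(\<lambda>v. A (\<psi> w) [v]) \<circ> (\<lambda>v. v - T (\<psi> w) [v]) = id"
      using inv1[OF pV] by auto
    show "continuous (at w) \<psi>"
      using cont w assms(2) continuous_on_eq_continuous_at by blast
    show "\<psi> z - K (\<psi> z) = z" if "z \<in> U" for z
      using \<psi>(2)[OF that] by (simp add: algebra_simps)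
  qed (use assms w in auto)
  then have der\<psi>: "multi_deriv 0 U (\<lambda>w vs. \<psi> w) (\<lambda>w. A (\<psi> w))"
    by (rule multi_derivI_has_derivative)
  have bdd_mlin0: "bdd_mlin 0 (\<lambda>vs::'a list. \<psi> w)" for w
    unfolding bdd_mlin_iff mlin_norm_le_iff by (auto intro: exI[of _ "norm (\<psi> w)"])
  have "C_multi m 0 U (\<lambda>w vs. \<psi> w)" if "m \<le> Suc k" for m
    using that
  proof (induction m)
    case 0
    then show ?case using cont bdd_mlin0 by (simp add: multi_cont_0_continuous_on)
  next
    case (Suc m)
    have "C_multi m (Suc 0) U (\<lambda>w. A (\<psi> w))"
      by (rule C_multi_compose[OF C_multi_lower[OF A]]) (use Suc \<psi>(1) in auto)
    then show ?case using der\<psi> bdd_mlin0 by auto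
  qed
  then show ?thesis by blast
qed

section \<open>Bounded linear images, and the sequence of derivatives\<close>

lemma C_multi_linear:
  fixes M :: "'a::real_normed_vector \<Rightarrow> 'a list \<Rightarrow> 'b::real_normed_vector"
  assumes Q: "bounded_linear Q" and "C_multi m j U M"
  shows "C_multi m j U (\<lambda>x vs. Q (M x vs))"
proof -
  interpret Q: bounded_linear Q by (rule Q)
  obtain q where q: "q > 0" "\<And>z. norm (Q z) \<le> q * norm z"
    using Q.pos_bounded by (metis mult.commute)
  have nQ: "mlin_norm_le j (\<lambda>vs. Q (L vs)) (q * c)" if "mlin_norm_le j L c" for j c and L :: "'a list \<Rightarrow> 'b"
    unfolding mlin_norm_le_iff
  proof (intro allI impI)
    fix vs :: "'a list" assume "length vs = j"
    from mlin_norm_le_D[OF that this] have "q * norm (L vs) \<le> q * (c * prod_list (map norm vs))"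
      using q(1) by simp
    with q(2)[of "L vs"] show "norm (Q (L vs)) \<le> q * c * prod_list (map norm vs)" by simp
  qed
  have bQ: "bdd_mlin j (\<lambda>vs. Q (L vs))" if "bdd_mlin j L" for j and L :: "'a list \<Rightarrow> 'b"
  proof -
    obtain c where "c \<ge> 0" "mlin_norm_le j L c" using \<open>bdd_mlin j L\<close> bdd_mlin_bound by blast
    then have "\<exists>K\<ge>0. mlin_norm_le j (\<lambda>vs. Q (L vs)) K" using nQ q(1) by (intro exI[of _ "q * c"]) auto
    then show ?thesis using that unfolding bdd_mlin_iff by (simp add: Q.add Q.scaleR)
  qed
  show ?thesis
    using assms(2)
  proof (induction m arbitrary: j M)
    case 0
    have "multi_cont j U (\<lambda>x vs. Q (M x vs))"
    proof (rule multi_contI)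
      fix x and \<epsilon> :: real assume x: "x \<in> U" and e: "\<epsilon> > 0"
      have e': "\<epsilon> / q > 0" using e q by simp
      have "multi_cont j U M" using 0 by simp
      from multi_contD[OF this x e'] obtain \<delta> where \<delta>: "\<delta> > 0"
        "\<And>y. y \<in> U \<Longrightarrow> dist y x < \<delta> \<Longrightarrow> mlin_norm_le j (\<lambda>vs. M y vs - M x vs) (\<epsilon> / q)" by blast
      have "mlin_norm_le j (\<lambda>vs. Q (M y vs) - Q (M x vs)) \<epsilon>" if "y \<in> U" "dist y x < \<delta>" for y
        using nQ[OF \<delta>(2)[OF that]] q(1) by (simp add: Q.diff)
      with \<delta>(1) show "\<exists>\<delta>>0. \<forall>y\<in>U. dist y x < \<delta> \<longrightarrow> mlin_norm_le j (\<lambda>vs. Q (M y vs) - Q (M x vs)) \<epsilon>"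
        by blast
    qed
    then show ?case using 0 bQ by auto
  next
    case (Suc m)
    obtain M' where M': "C_multi m (Suc j) U M'" "multi_deriv j U M M'" using Suc.prems by auto
    have "multi_deriv j U (\<lambda>x vs. Q (M x vs)) (\<lambda>x vs. Q (M' x vs))"
    proof (rule multi_derivI)
      fix x and \<epsilon> :: real assume x: "x \<in> U" and e: "\<epsilon> > 0"
      have e': "\<epsilon> / q > 0" using e q by simp
      from multi_derivD[OF M'(2) x C_multi_bml[OF M'(1) x] e'] obtain \<delta> where \<delta>: "\<delta> > 0"
        "\<And>y. y \<in> U \<Longrightarrow> dist y x < \<delta> \<Longrightarrow>
          mlin_norm_le j (\<lambda>vs. M y vs - M x vs - M' x ((y - x) # vs)) (\<epsilon> / q * norm (y - x))" by blast
      have "mlin_norm_le j (\<lambda>vs. Q (M y vs) - Q (M x vs) - Q (M' x ((y - x) # vs))) (\<epsilon> * norm (y - x))"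
        if "y \<in> U" "dist y x < \<delta>" for y
        using nQ[OF \<delta>(2)[OF that]] q(1) by (simp add: Q.diff)
      with \<delta>(1) show "\<exists>\<delta>>0. \<forall>y\<in>U. dist y x < \<delta> \<longrightarrow>
          mlin_norm_le j (\<lambda>vs. Q (M y vs) - Q (M x vs) - Q (M' x ((y - x) # vs))) (\<epsilon> * norm (y - x))"
        by blast
    qed
    with Suc.IH[OF M'(1)] bQ C_multi_bml[OF Suc.prems] show ?case by auto
  qed
qed

text \<open>Unfolds the nested existential quantifiers of \<open>C_multi\<close> into the single
  sequence that \<open>has_frechet_derivatives_on\<close> demands. The offset \<open>j\<close> is
  there because the induction hypothesis speaks of \<open>M'\<close>, which has one slot
  more.\<close>

lemma C_multi_derivatives:
  assumes "C_multi m j U M"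
  shows "\<exists>D. D 0 = M \<and> (\<forall>i\<le>m. \<forall>x\<in>U. bdd_mlin (i + j) (D i x)) \<and>
    (\<forall>i<m. multi_deriv (i + j) U (D i) (D (Suc i))) \<and> (\<forall>i\<le>m. multi_cont (i + j) U (D i))"
  using assms
proof (induction m arbitrary: j M)
  case 0
  then show ?case by (intro exI[of _ "\<lambda>_. M"]) auto
next
  case (Suc m)
  obtain M' where M': "C_multi m (Suc j) U M'" "multi_deriv j U M M'" using Suc.prems by auto
  obtain D where D: "D 0 = M' \<and> (\<forall>i\<le>m. \<forall>x\<in>U. bdd_mlin (i + Suc j) (D i x)) \<and>
    (\<forall>i<m. multi_deriv (i + Suc j) U (D i) (D (Suc i))) \<and> (\<forall>i\<le>m. multi_cont (i + Suc j) U (D i))"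
    using Suc.IH[OF M'(1)] by (rule exE)
  have D0: "D 0 = M'" and D1: "\<And>i x. i \<le> m \<Longrightarrow> x \<in> U \<Longrightarrow> bdd_mlin (i + Suc j) (D i x)"
    and D2: "\<And>i. i < m \<Longrightarrow> multi_deriv (i + Suc j) U (D i) (D (Suc i))"
    and D3: "\<And>i. i \<le> m \<Longrightarrow> multi_cont (i + Suc j) U (D i)"
    using D by (simp_all only: simp_thms)
  define E where "E i = (case i of 0 \<Rightarrow> M | Suc i \<Rightarrow> D i)" for i
  have E: "E 0 = M" "E (Suc i) = D i" for i by (simp_all add: E_def)
  have "bdd_mlin (i + j) (E i x)" if "i \<le> Suc m" "x \<in> U" for i x
  proof (cases i)
    case 0
    then show ?thesis using C_multi_bml[OF Suc.prems that(2)] E by simp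
  next
    case (Suc l)
    then show ?thesis using D1[of l x] that E by simp
  qed
  moreover have "multi_deriv (i + j) U (E i) (E (Suc i))" if "i < Suc m" for i
  proof (cases i)
    case 0
    then show ?thesis using M'(2) D0 E by simp
  next
    case (Suc l)
    then show ?thesis using D2[of l] that E by simp
  qed
  moreover have "multi_cont (i + j) U (E i)" if "i \<le> Suc m" for i
  proof (cases i)
    case 0
    then show ?thesis using C_multi_cont[OF Suc.prems] E by simp
  next
    case (Suc l)
    then show ?thesis using D3[of l] that E by simp
  qed
  ultimately show ?case using E(1) by blast
qed

section \<open>Superposition operators\<close>

text \<open>\<delta> is a Lebesgue number for the cover of \<open>C\<close> by balls on which
  \<open>M\<close> stays within \<open>\<epsilon>/2\<close> of its value at the centre, so
  \<open>p\<close> and \<open>q\<close> lie in a common ball. The point \<open>q\<close> may lie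
  outside \<open>C\<close>, as points of a perturbed curve do.\<close>

lemma multi_cont_compact:
  assumes "open U" "multi_cont j U M" "compact C" "C \<subseteq> U" "\<epsilon> > 0"
  obtains \<delta> where "\<delta> > 0" "\<And>p. p \<in> C \<Longrightarrow> ball p \<delta> \<subseteq> U"
    "\<And>p q. p \<in> C \<Longrightarrow> dist q p < \<delta> \<Longrightarrow> mlin_norm_le j (\<lambda>vs. M q vs - M p vs) \<epsilon>"
proof -
  have e2: "\<epsilon> / 2 > 0" using assms(5) by simp
  have "\<exists>d>0. ball p d \<subseteq> U \<and> (\<forall>q\<in>ball p d. mlin_norm_le j (\<lambda>vs. M q vs - M p vs) (\<epsilon>/2))"
    if p: "p \<in> C" for p
  proof -
    have pU: "p \<in> U" using p assms(4) by blast
    from multi_contD[OF assms(2) pU e2] obtain d where d: "d > 0"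
      "\<And>y. y \<in> U \<Longrightarrow> dist y p < d \<Longrightarrow> mlin_norm_le j (\<lambda>vs. M y vs - M p vs) (\<epsilon> / 2)" by blast
    obtain r where r: "r > 0" "ball p r \<subseteq> U" using assms(1) pU openE by blast
    have "mlin_norm_le j (\<lambda>vs. M q vs - M p vs) (\<epsilon>/2)" if "q \<in> ball p (min d r)" for q
      using d(2)[of q] r(2) that by (auto simp: dist_commute)
    with d(1) r show ?thesis by (intro exI[of _ "min d r"]) auto
  qed
  then obtain d where d: "\<And>p. p \<in> C \<Longrightarrow> d p > 0" "\<And>p. p \<in> C \<Longrightarrow> ball p (d p) \<subseteq> U"
    "\<And>p q. p \<in> C \<Longrightarrow> q \<in> ball p (d p) \<Longrightarrow> mlin_norm_le j (\<lambda>vs. M q vs - M p vs) (\<epsilon>/2)"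
    by metis
  have "C \<subseteq> \<Union> ((\<lambda>p. ball p (d p)) ` C)" using d(1) by auto
  then obtain \<delta> where \<delta>: "\<delta> > 0" "\<And>p. p \<in> C \<Longrightarrow> \<exists>G\<in>(\<lambda>p. ball p (d p)) ` C. ball p \<delta> \<subseteq> G"
    using Heine_Borel_lemma[OF assms(3)] by (metis (no_types, lifting) imageE open_ball)
  show ?thesis
  proof (rule that[OF \<delta>(1)])
    show "ball p \<delta> \<subseteq> U" if "p \<in> C" for p
      using \<delta>(2)[OF that] d(2) by blast
    fix p q assume p: "p \<in> C" and q: "dist q p < \<delta>"
    obtain c where c: "c \<in> C" "ball p \<delta> \<subseteq> ball c (d c)" using \<delta>(2)[OF p] by blast
    have "p \<in> ball p \<delta>" "q \<in> ball p \<delta>" using q \<delta>(1) by (auto simp: dist_commute)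
    then have "p \<in> ball c (d c)" "q \<in> ball c (d c)" using c(2) by blast+
    from mlin_norm_le_diff[OF d(3)[OF c(1) this(2)] d(3)[OF c(1) this(1)]]
    show "mlin_norm_le j (\<lambda>vs. M q vs - M p vs) \<epsilon>" by simp
  qed
qed

lemma multi_bounded_compact:
  assumes "open U" "multi_cont j U M" "compact C" "C \<subseteq> U" "\<And>p. p \<in> C \<Longrightarrow> bdd_mlin j (M p)"
  obtains K where "K \<ge> 0" "\<And>p. p \<in> C \<Longrightarrow> mlin_norm_le j (M p) K"
proof -
  have "\<exists>K\<ge>0. mlin_norm_le j (M p) K" if "p \<in> C" for p
    using assms(5)[OF that] bdd_mlin_bound by blast
  then obtain k where k: "\<And>p. p \<in> C \<Longrightarrow> k p \<ge> 0" "\<And>p. p \<in> C \<Longrightarrow> mlin_norm_le j (M p) (k p)"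
    by metis
  obtain \<delta> where \<delta>: "\<delta> > 0"
    "\<And>p q. p \<in> C \<Longrightarrow> dist q p < \<delta> \<Longrightarrow> mlin_norm_le j (\<lambda>vs. M q vs - M p vs) 1"
    by (rule multi_cont_compact[OF assms(1-4) zero_less_one]) (rule that)
  obtain F where F: "finite F" "F \<subseteq> C" "C \<subseteq> (\<Union>x\<in>F. ball x \<delta>)"
    using seq_compact_imp_totally_bounded[of C] assms(3) \<delta>(1) compact_imp_seq_compact by blast
  show ?thesis
  \<comment> \<open>The sum dominates \<open>k p\<close> for every \<open>p\<close> in the finite
    net \<open>F\<close>, and an empty net is no exception.\<close>
  proof (rule that[of "1 + sum k F"])
    show "0 \<le> 1 + sum k F" using k(1) F(2) by (intro add_nonneg_nonneg sum_nonneg) auto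
    fix q assume q: "q \<in> C"
    then obtain p where p: "p \<in> F" "dist q p < \<delta>" using F(3) by (auto simp: dist_commute)
    have "k p \<le> sum k F" using F k(1) p(1) by (intro member_le_sum) auto
    have "p \<in> C" using p F by blast
    from mlin_norm_le_add[OF \<delta>(2)[OF this p(2)] k(2)[OF this]] have "mlin_norm_le j (M q) (1 + k p)" by simp
    then show "mlin_norm_le j (M q) (1 + sum k F)"
      by (rule mlin_norm_le_mono) (use \<open>k p \<le> sum k F\<close> in simp)
  qed
qed

text \<open>The mean value theorem turns uniform continuity of \<open>M'\<close> into uniform differentiability of \<open>M\<close>.\<close>

lemma multi_deriv_compact:
  assumes "open U" "multi_deriv j U M M'" "\<And>x. x \<in> U \<Longrightarrow> bdd_mlin (Suc j) (M' x)"
    and "multi_cont (Suc j) U M'" "compact C" "C \<subseteq> U" "\<epsilon> > 0"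
  obtains \<delta> where "\<delta> > 0"
    "\<And>p q. p \<in> C \<Longrightarrow> dist q p < \<delta> \<Longrightarrow>
      mlin_norm_le j (\<lambda>vs. M q vs - M p vs - M' p ((q - p) # vs)) (\<epsilon> * norm (q - p))"
proof -
  obtain \<delta> where \<delta>: "\<delta> > 0" "\<And>p. p \<in> C \<Longrightarrow> ball p \<delta> \<subseteq> U"
    "\<And>p q. p \<in> C \<Longrightarrow> dist q p < \<delta> \<Longrightarrow> mlin_norm_le (Suc j) (\<lambda>vs. M' q vs - M' p vs) \<epsilon>"
    by (rule multi_cont_compact[OF assms(1,4-7)]) (rule that)
  show ?thesis
  proof (rule that[OF \<delta>(1)])
    fix p q assume p: "p \<in> C" and q: "dist q p < \<delta>"
    show "mlin_norm_le j (\<lambda>vs. M q vs - M p vs - M' p ((q - p) # vs)) (\<epsilon> * norm (q - p))"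
      unfolding mlin_norm_le_iff
    proof (intro allI impI)
      fix vs :: "'a list" assume len: "length vs = j"
      let ?p = "prod_list (map norm vs)"
      have "norm (M q vs - M p vs - M' p ((q - p) # vs)) \<le> norm (q - p) * (\<epsilon> * ?p)"
      proof (rule differentiable_bound_linearization[where S = "ball p \<delta>"
            and f = "\<lambda>x. M x vs" and f' = "\<lambda>x v. M' x (v # vs)"])
        show "p + t *\<^sub>R (q - p) \<in> ball p \<delta>" if "t \<in> {0..1}" for t
        proof -
          have "dist p (p + t *\<^sub>R (q - p)) = t * dist q p" using that by (simp add: dist_norm)
          also have "\<dots> \<le> 1 * dist q p" using that by (intro mult_right_mono) auto
          finally show ?thesis using q by simp
        qed
        show "((\<lambda>x. M x vs) has_derivative (\<lambda>v. M' x (v # vs))) (at x within ball p \<delta>)"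
          if "x \<in> ball p \<delta>" for x
        proof -
          have x: "x \<in> U" using that \<delta>(2)[OF p] by blast
          show ?thesis
            by (rule has_derivative_at_withinI,
                rule multi_deriv_has_derivative[OF assms(2,1) x assms(3)[OF x] len])
        qed
        show "onorm ((\<lambda>v. M' x (v # vs)) - (\<lambda>v. M' p (v # vs))) \<le> \<epsilon> * ?p"
          if "x \<in> ball p \<delta>" for x
        proof (rule onorm_bound)
          fix v
          from that have "dist x p < \<delta>" by (simp add: dist_commute)
          from mlin_norm_le_D[OF \<delta>(3)[OF p this], of "v # vs"] len
          show "norm (((\<lambda>v. M' x (v # vs)) - (\<lambda>v. M' p (v # vs))) v) \<le> \<epsilon> * ?p * norm v"
            by (simp add: mult_ac)
        qed (use assms(7) in simp)
      qed (use \<delta> in auto)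
      then show "norm (M q vs - M p vs - M' p ((q - p) # vs)) \<le> \<epsilon> * norm (q - p) * ?p"
        by (simp add: mult_ac)
    qed
  qed
qed

section \<open>Superposition along a curve of contractions\<close>

text \<open>Both the map and its arguments move with \<open>r\<close>. Absorbing the moving first
  argument into the map leaves a family with one slot fewer that is still continuous in operator
  norm; hence the induction on the argument list with \<open>N\<close> arbitrary.\<close>

lemma continuous_on_multi_curve:
  fixes N :: "real \<Rightarrow> 'a::real_normed_vector list \<Rightarrow> 'b::real_normed_vector"
  assumes "\<And>r. bdd_mlin j (N r)"
    and "\<And>r \<epsilon>. \<epsilon> > 0 \<Longrightarrow> \<exists>\<delta>>0. \<forall>r'. dist r' r < \<delta> \<longrightarrow> mlin_norm_le j (\<lambda>vs. N r' vs - N r vs) \<epsilon>"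
    and "length vs = j" "\<And>v. v \<in> set vs \<Longrightarrow> continuous_on UNIV (\<lambda>r. S r v)"
  shows "continuous_on UNIV (\<lambda>r. N r (map (S r) vs))"
  using assms
proof (induction vs arbitrary: j N)
  case Nil
  show ?case unfolding continuous_on_iff
  proof (intro ballI allI impI)
    fix r e :: real assume "e > 0"
    then have "e / 2 > 0" by simp
    from Nil(2)[OF this, of r] Nil(3) obtain \<delta> where "\<delta> > 0"
      "\<And>r'. dist r' r < \<delta> \<Longrightarrow> norm (N r' [] - N r []) \<le> e / 2" by (auto simp: mlin_norm_le_iff)
    then show "\<exists>d>0. \<forall>x'\<in>UNIV. dist x' r < d \<longrightarrow> dist (N x' (map (S x') [])) (N r (map (S r) [])) < e"
      using \<open>e > 0\<close> by (intro exI[of _ \<delta>]) (fastforce simp: dist_norm)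
  qed
next
  case (Cons v vs)
  obtain i where j: "j = Suc i" and i: "length vs = i" using Cons.prems(3) by auto
  have cv: "continuous_on UNIV (\<lambda>r. S r v)" using Cons.prems(4) by simp
  let ?N = "\<lambda>r ws. N r (S r v # ws)"
  have bN: "bdd_mlin (Suc i) (N r)" for r using Cons.prems(1) j by simp
  have "continuous_on UNIV (\<lambda>r. ?N r (map (S r) vs))"
  proof (rule Cons.IH[OF _ _ i])
    show "bdd_mlin i (?N r)" for r
    proof -
      obtain K where K: "K \<ge> 0" "mlin_norm_le (Suc i) (N r) K" using bN bdd_mlin_bound by blast
      have "mlin_norm_le i (?N r) (K * norm (S r v))"
        unfolding mlin_norm_le_iff using mlin_norm_le_D[OF K(2), of "S r v # _"] by (simp add: mult_ac)
      then have "\<exists>K\<ge>0. mlin_norm_le i (?N r) K" using K(1) by (intro exI[of _ "K * norm (S r v)"]) auto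
      then show ?thesis
        unfolding bdd_mlin_iff
        using bdd_mlin_add[OF bN, of "S r v # _"] bdd_mlin_scaleR[OF bN, of "S r v # _"] by auto
    qed
  next
    fix r \<epsilon> :: real assume e: "\<epsilon> > 0"
    obtain K where K: "K \<ge> 0" "mlin_norm_le (Suc i) (N r) K" using bN bdd_mlin_bound by blast
    \<comment> \<open>Since \<open>\<epsilon>'\<close> is at most \<open>1\<close>, this bounds
      \<open>S r' v\<close> for all \<open>r'\<close> near \<open>r\<close>.\<close>
    define c where "c = norm (S r v) + 1"
    have c: "c > 0" by (simp add: c_def add_nonneg_pos)
    define \<epsilon>' where "\<epsilon>' = min 1 (\<epsilon> / (c + K))"
    have e': "\<epsilon>' > 0" "\<epsilon>' \<le> 1" using e c K by (auto simp: \<epsilon>'_def)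
    obtain \<delta>1 where 1: "\<delta>1 > 0"
      "\<And>r'. dist r' r < \<delta>1 \<Longrightarrow> mlin_norm_le (Suc i) (\<lambda>vs. N r' vs - N r vs) \<epsilon>'"
      using Cons.prems(2)[OF e'(1), of r] j by auto
    obtain \<delta>2 where 2: "\<delta>2 > 0" "\<And>r'. dist r' r < \<delta>2 \<Longrightarrow> dist (S r' v) (S r v) < \<epsilon>'"
      using cv[unfolded continuous_on_iff, rule_format, OF UNIV_I e'(1), of r] by auto
    have "mlin_norm_le i (\<lambda>ws. ?N r' ws - ?N r ws) \<epsilon>" if r': "dist r' r < min \<delta>1 \<delta>2" for r'
      unfolding mlin_norm_le_iff
    proof (intro allI impI)
      fix ws :: "'a list" assume len: "length ws = i"
      define p where "p = prod_list (map norm ws)"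
      have p: "p \<ge> 0" by (simp add: p_def)
      have d: "norm (S r' v - S r v) \<le> \<epsilon>'" using 2(2)[of r'] r' by (simp add: dist_norm)
      then have d': "norm (S r' v) \<le> c"
        using e'(2) norm_triangle_sub[of "S r' v" "S r v"] by (simp add: c_def)
      have eq: "?N r' ws - ?N r ws =
          (N r' (S r' v # ws) - N r (S r' v # ws)) + N r ((S r' v - S r v) # ws)"
        using bdd_mlin_diff[OF bN, of "[]" ws] len by simp
      have b1: "norm (N r' (S r' v # ws) - N r (S r' v # ws)) \<le> \<epsilon>' * (c * p)"
      proof -
        have "norm (N r' (S r' v # ws) - N r (S r' v # ws)) \<le> \<epsilon>' * (norm (S r' v) * p)"
          using mlin_norm_le_D[OF 1(2)[of r'], of "S r' v # ws"] len r' by (simp add: p_def)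
        also have "\<dots> \<le> \<epsilon>' * (c * p)" using e' d' p by (intro mult_left_mono mult_right_mono) auto
        finally show ?thesis .
      qed
      have b2: "norm (N r ((S r' v - S r v) # ws)) \<le> K * (\<epsilon>' * p)"
      proof -
        have "norm (N r ((S r' v - S r v) # ws)) \<le> K * (norm (S r' v - S r v) * p)"
          using mlin_norm_le_D[OF K(2), of "(S r' v - S r v) # ws"] len by (simp add: p_def)
        also have "\<dots> \<le> K * (\<epsilon>' * p)" using K d p by (intro mult_left_mono mult_right_mono) auto
        finally show ?thesis .
      qed
      have "norm (?N r' ws - ?N r ws) \<le> \<epsilon>' * (c * p) + K * (\<epsilon>' * p)"
        unfolding eq by (rule norm_triangle_mono[OF b1 b2])
      also have "\<dots> = \<epsilon>' * (c + K) * p" by (simp add: algebra_simps)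
      also have "\<dots> \<le> \<epsilon> / (c + K) * (c + K) * p"
        using c K p by (intro mult_right_mono) (auto simp: \<epsilon>'_def)
      also have "\<dots> = \<epsilon> * p" using c K by simp
      finally show "norm (?N r' ws - ?N r ws) \<le> \<epsilon> * prod_list (map norm ws)" by (simp add: p_def)
    qed
    then show "\<exists>\<delta>>0. \<forall>r'. dist r' r < \<delta> \<longrightarrow> mlin_norm_le i (\<lambda>ws. ?N r' ws - ?N r ws) \<epsilon>"
      using 1(1) 2(1) by (intro exI[of _ "min \<delta>1 \<delta>2"]) auto
  qed (use Cons.prems(4) in auto)
  then show ?case by simp
qed

text \<open>The model is the segment of \<open>x\<close> at time \<open>r\<close>, with
  \<open>r\<close> clamped to a compact interval. Contractivity transfers estimates from
  \<open>S r x\<close> to \<open>x\<close> with the same constants; compactness of each orbit makes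
  them uniform in \<open>r\<close>.\<close>

locale contraction_curve =
  fixes S :: "real \<Rightarrow> 'a::real_normed_vector \<Rightarrow> 'a"
  assumes linear: "\<And>r. linear (S r)"
    and norm_le: "\<And>r x. norm (S r x) \<le> norm x"
    and cont: "\<And>x. continuous_on UNIV (\<lambda>r. S r x)"
    and comp: "\<And>x. compact (range (\<lambda>r. S r x))"
begin

text \<open>The Nemytskii operator of \<open>M\<close> along the curve. The arguments are moved as
  well, so that differentiating \<open>superpose M\<close> simply gives
  \<open>superpose M'\<close>.\<close>

definition superpose ::
  "('a \<Rightarrow> 'a list \<Rightarrow> 'b::real_normed_vector) \<Rightarrow> 'a \<Rightarrow> 'a list \<Rightarrow> real \<Rightarrow>\<^sub>C 'b" where
  "superpose M x vs = Bcontfun (\<lambda>r. M (S r x) (map (S r) vs))"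

lemma prod_norm_le: "prod_list (map norm (map (S r) vs)) \<le> prod_list (map norm vs)"
  by (induction vs) (auto intro!: mult_mono norm_le simp del: map_map)

lemma mlin_norm_le_S: "mlin_norm_le j L c \<Longrightarrow> c \<ge> 0 \<Longrightarrow> length vs = j \<Longrightarrow>
    norm (L (map (S r) vs)) \<le> c * prod_list (map norm vs)"
  by (rule order_trans[OF mlin_norm_le_D mult_left_mono[OF prod_norm_le]]) auto

text \<open>\<open>Bcontfun\<close> is meaningful only for bounded continuous functions; boundedness
  comes from the compact orbit, continuity from \<open>continuous_on_multi_curve\<close>.\<close>

lemma superpose_apply:
  assumes U: "open U" "multi_cont j U M" "\<And>x. x \<in> U \<Longrightarrow> bdd_mlin j (M x)"
    and x: "range (\<lambda>r. S r x) \<subseteq> U" and len: "length vs = j"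
  shows "apply_bcontfun (superpose M x vs) r = M (S r x) (map (S r) vs)"
proof -
  have xr: "S r x \<in> U" for r using x by blast
  have "continuous_on UNIV (\<lambda>r. M (S r x) (map (S r) vs))"
  proof (rule continuous_on_multi_curve[OF _ _ len])
    show "bdd_mlin j (M (S r x))" for r using U(3) xr by blast
    fix r \<epsilon> :: real assume "\<epsilon> > 0"
    from multi_contD[OF U(2) xr this] obtain \<delta> where \<delta>: "\<delta> > 0"
      "\<And>y. y \<in> U \<Longrightarrow> dist y (S r x) < \<delta> \<Longrightarrow> mlin_norm_le j (\<lambda>vs. M y vs - M (S r x) vs) \<epsilon>" by blast
    from cont[unfolded continuous_on_iff, rule_format, OF UNIV_I \<delta>(1), of r x]
    show "\<exists>\<delta>>0. \<forall>r'. dist r' r < \<delta> \<longrightarrow> mlin_norm_le j (\<lambda>vs. M (S r' x) vs - M (S r x) vs) \<epsilon>"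
      using \<delta>(2) xr by blast
  qed (rule cont)
  moreover obtain K where K: "K \<ge> 0" "\<And>r. mlin_norm_le j (M (S r x)) K"
    by (rule multi_bounded_compact[OF U(1,2) comp x]) (use U(3) x that in blast)+
  have "norm (M (S r x) (map (S r) vs)) \<le> K * prod_list (map norm vs)" for r
    by (rule mlin_norm_le_S[OF K(2,1) len])
  ultimately have "(\<lambda>r. M (S r x) (map (S r) vs)) \<in> bcontfun"
    by (rule bcontfun_normI)
  then show ?thesis by (simp add: superpose_def Bcontfun_inverse)
qed

lemma bdd_mlin_superpose:
  assumes U: "open U" "multi_cont j U M" "\<And>x. x \<in> U \<Longrightarrow> bdd_mlin j (M x)"
    and x: "range (\<lambda>r. S r x) \<subseteq> U"
  shows "bdd_mlin j (superpose M x)"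
proof -
  have ap: "apply_bcontfun (superpose M x vs) r = M (S r x) (map (S r) vs)"
    if "length vs = j" for vs r
    by (rule superpose_apply[OF U(1,2) _ x that]) (rule U(3))
  have xr: "S r x \<in> U" for r using x by blast
  obtain K where K: "K \<ge> 0" "\<And>r. mlin_norm_le j (M (S r x)) K"
    by (rule multi_bounded_compact[OF U(1,2) comp x]) (use U(3) x that in blast)+
  have "mlin_norm_le j (superpose M x) K"
    unfolding mlin_norm_le_iff by (intro allI impI norm_bound) (simp add: ap mlin_norm_le_S[OF K(2,1)])
  moreover have "superpose M x (xs @ (a + b) # ys) = superpose M x (xs @ a # ys) + superpose M x (xs @ b # ys)"
    if "length xs + Suc (length ys) = j" for xs ys a b
    using that bdd_mlin_add[OF U(3)[OF xr], of "map (S _) xs" "map (S _) ys"]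
    by (intro bcontfun_eqI) (simp add: ap linear_add[OF linear])
  moreover have "superpose M x (xs @ (c *\<^sub>R a) # ys) = c *\<^sub>R superpose M x (xs @ a # ys)"
    if "length xs + Suc (length ys) = j" for xs ys a c
    using that bdd_mlin_scaleR[OF U(3)[OF xr], of "map (S _) xs" "map (S _) ys"]
    by (intro bcontfun_eqI) (simp add: ap linear_scale[OF linear])
  ultimately show ?thesis using K(1) unfolding bdd_mlin_iff by blast
qed

text \<open>One radius must serve all \<open>r\<close>. The orbit of \<open>x\<close> is compact,
  and \<open>S r y\<close> stays within \<open>dist y x\<close> of \<open>S r x\<close>, so
  \<open>multi_cont_compact\<close> supplies it.\<close>

lemma multi_cont_superpose:
  assumes U: "open U" "multi_cont j U M" "\<And>x. x \<in> U \<Longrightarrow> bdd_mlin j (M x)"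
    and V: "\<And>x. x \<in> V \<Longrightarrow> range (\<lambda>r. S r x) \<subseteq> U"
  shows "multi_cont j V (superpose M)"
proof (rule multi_contI)
  fix x and \<epsilon> :: real assume x: "x \<in> V" and e: "\<epsilon> > 0"
  have ap: "apply_bcontfun (superpose M x vs) r = M (S r x) (map (S r) vs)"
    if "x \<in> V" "length vs = j" for x vs r
    by (rule superpose_apply[OF U(1,2)]) (use U(3) V that in blast)+
  obtain \<delta> where \<delta>: "\<delta> > 0"
    "\<And>p q. p \<in> range (\<lambda>r. S r x) \<Longrightarrow> dist q p < \<delta> \<Longrightarrow> mlin_norm_le j (\<lambda>vs. M q vs - M p vs) \<epsilon>"
    by (rule multi_cont_compact[OF U(1,2) comp V[OF x] e]) (rule that)
  have "mlin_norm_le j (\<lambda>vs. superpose M y vs - superpose M x vs) \<epsilon>" if y: "y \<in> V" "dist y x < \<delta>" for y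
    unfolding mlin_norm_le_iff
  proof (intro allI impI norm_bound)
    fix vs :: "'a list" and r assume len: "length vs = j"
    have "dist (S r y) (S r x) \<le> dist y x"
      using norm_le[of r "y - x"] by (simp add: dist_norm linear_diff[OF linear])
    then have "mlin_norm_le j (\<lambda>vs. M (S r y) vs - M (S r x) vs) \<epsilon>" using \<delta>(2) y(2) by auto
    then show "norm (apply_bcontfun (superpose M y vs - superpose M x vs) r)
        \<le> \<epsilon> * prod_list (map norm vs)"
      using mlin_norm_le_S[of j "\<lambda>vs. M (S r y) vs - M (S r x) vs" \<epsilon> vs r] len e
      by (simp add: ap[OF y(1) len] ap[OF x len])
  qed
  then show "\<exists>\<delta>>0. \<forall>y\<in>V. dist y x < \<delta> \<longrightarrow> mlin_norm_le j (\<lambda>vs. superpose M y vs - superpose M x vs) \<epsilon>"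
    using \<delta>(1) by blast
qed

text \<open>At \<open>r\<close> the remainder is that of \<open>M\<close> at \<open>S r x\<close>
  with increment \<open>S r (y - x)\<close>, which is no longer than \<open>y - x\<close>;
  \<open>multi_deriv_compact\<close> supplies a radius common to all \<open>r\<close>.\<close>

lemma multi_deriv_superpose:
  assumes U: "open U" "multi_cont j U M" "\<And>x. x \<in> U \<Longrightarrow> bdd_mlin j (M x)"
    and M': "multi_deriv j U M M'" "multi_cont (Suc j) U M'" "\<And>x. x \<in> U \<Longrightarrow> bdd_mlin (Suc j) (M' x)"
    and V: "\<And>x. x \<in> V \<Longrightarrow> range (\<lambda>r. S r x) \<subseteq> U"
  shows "multi_deriv j V (superpose M) (superpose M')"
proof (rule multi_derivI)
  fix x and \<epsilon> :: real assume x: "x \<in> V" and e: "\<epsilon> > 0"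
  have ap: "apply_bcontfun (superpose M x vs) r = M (S r x) (map (S r) vs)"
    if "x \<in> V" "length vs = j" for x vs r
    by (rule superpose_apply[OF U(1,2)]) (use U(3) V that in blast)+
  have ap': "apply_bcontfun (superpose M' x vs) r = M' (S r x) (map (S r) vs)"
    if "x \<in> V" "length vs = Suc j" for x vs r
    by (rule superpose_apply[OF U(1) M'(2)]) (use M'(3) V that in blast)+
  obtain \<delta> where \<delta>: "\<delta> > 0"
    "\<And>p q. p \<in> range (\<lambda>r. S r x) \<Longrightarrow> dist q p < \<delta> \<Longrightarrow>
      mlin_norm_le j (\<lambda>vs. M q vs - M p vs - M' p ((q - p) # vs)) (\<epsilon> * norm (q - p))"
    by (rule multi_deriv_compact[OF U(1) M'(1) _ M'(2) comp V[OF x] e]) (use M'(3) in blast, rule that)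
  have "mlin_norm_le j (\<lambda>vs. superpose M y vs - superpose M x vs - superpose M' x ((y - x) # vs)) (\<epsilon> * norm (y - x))"
    if y: "y \<in> V" "dist y x < \<delta>" for y
    unfolding mlin_norm_le_iff
  proof (intro allI impI norm_bound)
    fix vs :: "'a list" and r assume len: "length vs = j"
    then have len': "length ((y - x) # vs) = Suc j" by simp
    let ?L = "\<lambda>vs. M (S r y) vs - M (S r x) vs - M' (S r x) ((S r y - S r x) # vs)"
    have n: "norm (S r y - S r x) \<le> norm (y - x)"
      using norm_le[of r "y - x"] by (simp add: linear_diff[OF linear])
    then have "mlin_norm_le j ?L (\<epsilon> * norm (S r y - S r x))" using \<delta>(2) y(2) by (auto simp: dist_norm)
    then have "mlin_norm_le j ?L (\<epsilon> * norm (y - x))"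
      by (rule mlin_norm_le_mono) (use n e in simp)
    then show "norm (apply_bcontfun (superpose M y vs - superpose M x vs - superpose M' x ((y - x) # vs)) r)
        \<le> \<epsilon> * norm (y - x) * prod_list (map norm vs)"
      using mlin_norm_le_S[of j ?L "\<epsilon> * norm (y - x)" vs r] len e
      by (simp add: ap[OF y(1) len] ap[OF x len] ap'[OF x len'] linear_diff[OF linear])
  qed
  then show "\<exists>\<delta>>0. \<forall>y\<in>V. dist y x < \<delta> \<longrightarrow>
      mlin_norm_le j (\<lambda>vs. superpose M y vs - superpose M x vs - superpose M' x ((y - x) # vs)) (\<epsilon> * norm (y - x))"
    using \<delta>(1) by blast
qed

lemma C_multi_superpose:
  assumes "open U" "C_multi m j U M" and V: "\<And>x. x \<in> V \<Longrightarrow> range (\<lambda>r. S r x) \<subseteq> U"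
  shows "C_multi m j V (superpose M)"
  using assms(2)
proof (induction m arbitrary: j M)
  case 0
  have "multi_cont j V (superpose M)"
    by (rule multi_cont_superpose[OF assms(1) C_multi_cont[OF 0] C_multi_bml[OF 0] V])
  moreover have "bdd_mlin j (superpose M x)" if "x \<in> V" for x
    by (rule bdd_mlin_superpose[OF assms(1) C_multi_cont[OF 0] C_multi_bml[OF 0] V[OF that]])
  ultimately show ?case by simp
next
  case (Suc m)
  obtain M' where M': "C_multi m (Suc j) U M'" "multi_deriv j U M M'" using Suc.prems by auto
  have "multi_deriv j V (superpose M) (superpose M')"
    by (rule multi_deriv_superpose[OF assms(1) C_multi_cont[OF Suc.prems] C_multi_bml[OF Suc.prems]
          M'(2) C_multi_cont[OF M'(1)] C_multi_bml[OF M'(1)] V])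
  moreover have "bdd_mlin j (superpose M x)" if "x \<in> V" for x
    by (rule bdd_mlin_superpose[OF assms(1) C_multi_cont[OF Suc.prems] C_multi_bml[OF Suc.prems] V[OF that]])
  ultimately show ?case using Suc.IH[OF M'(1)] by auto
qed

end

section \<open>Histories\<close>

lemma clamp_real: "a \<le> b \<Longrightarrow> clamp a b x = max a (min b (x::real))"
  by (cases "x < a"; cases "x \<le> b") (simp_all add: clamp_def)

lemma clamp_real_mem: "a \<le> b \<Longrightarrow> clamp a b (x::real) \<in> {a..b}"
  by (simp add: clamp_real)

lemma ext_cont_real_bcontfun:
  fixes g :: "real \<Rightarrow> 'a::euclidean_space"
  assumes "a \<le> b" "continuous_on {a..b} g"
  shows "ext_cont g a b \<in> bcontfun"
  using assms by (auto simp: bcontfun_def ext_cont_def cbox_interval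
      intro!: clamp_continuous_on clamp_bounded compact_imp_bounded[OF compact_continuous_image])

lemma apply_Bcontfun_ext_cont:
  fixes g :: "real \<Rightarrow> 'a::euclidean_space"
  assumes "a \<le> b" "continuous_on {a..b} g"
  shows "apply_bcontfun (Bcontfun (ext_cont g a b)) s = g (clamp a b s)"
  using ext_cont_real_bcontfun[OF assms] by (simp add: Bcontfun_inverse ext_cont_def)

lemma segment_apply:
  fixes x :: "real \<Rightarrow> real^'n"
  assumes "h > 0" "continuous_on {t - h..t} x"
  shows "apply_bcontfun (segment h x t) \<theta> = x (t + clamp (-h) 0 \<theta>)"
proof -
  have "continuous_on {-h..0} (\<lambda>\<theta>. x (t + \<theta>))"
    by (rule continuous_on_compose2[OF assms(2)]) (auto intro!: continuous_intros)
  then show ?thesis unfolding segment_def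
    using assms(1) by (simp add: apply_Bcontfun_ext_cont)
qed

lemma segment_mem:
  fixes x :: "real \<Rightarrow> real^'n"
  assumes "h > 0" "continuous_on {t - h..t} x"
  shows "segment h x t \<in> history_space h"
  using assms(1) by (auto simp: history_space_def ext_cont_def segment_apply[OF assms] fun_eq_iff clamp_real)

lemma segment_cong:
  fixes x y :: "real \<Rightarrow> real^'n"
  assumes "h > 0" "\<And>s. t - h \<le> s \<Longrightarrow> s \<le> t \<Longrightarrow> x s = y s"
  shows "segment h x t = segment h y t"
proof -
  have "ext_cont (\<lambda>\<theta>. x (t + \<theta>)) (-h) 0 = ext_cont (\<lambda>\<theta>. y (t + \<theta>)) (-h) 0"
    using assms clamp_real_mem[of "-h" 0] by (force simp: ext_cont_def fun_eq_iff)
  then show ?thesis by (simp add: segment_def)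
qed

lemma segment_apply_bcontfun:
  fixes x :: "real \<Rightarrow>\<^sub>C (real^'n)"
  assumes "h > 0"
  shows "apply_bcontfun (segment h (apply_bcontfun x) t) \<theta> = apply_bcontfun x (t + clamp (-h) 0 \<theta>)"
  using assms by (intro segment_apply) auto

text \<open>Hence the segment at time \<open>0\<close> is a projection: it maps every bounded
  continuous function into \<open>history_space h\<close> and fixes that space.\<close>

lemma segment_history:
  fixes u :: "real \<Rightarrow>\<^sub>C (real^'n)"
  assumes "h > 0" "u \<in> history_space h"
  shows "segment h (apply_bcontfun u) 0 = u"
proof (rule bcontfun_eqI)
  fix \<theta>
  have "apply_bcontfun u \<theta> = ext_cont (apply_bcontfun u) (-h) 0 \<theta>"
    using assms(2) unfolding history_space_def by (metis (mono_tags) mem_Collect_eq)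
  then show "apply_bcontfun (segment h (apply_bcontfun u) 0) \<theta> = apply_bcontfun u \<theta>"
    by (simp add: segment_apply_bcontfun[OF assms(1)] ext_cont_def)
qed

lemma segment_mem_bcontfun:
  fixes x :: "real \<Rightarrow>\<^sub>C (real^'n)"
  assumes "h > 0"
  shows "segment h (apply_bcontfun x) t \<in> history_space h"
  using assms by (intro segment_mem) auto

lemma norm_segment_le:
  fixes x :: "real \<Rightarrow>\<^sub>C (real^'n)"
  assumes "h > 0"
  shows "norm (segment h (apply_bcontfun x) t) \<le> norm x"
  by (rule norm_bound) (simp add: segment_apply_bcontfun[OF assms] norm_bounded)

lemma linear_segment:
  assumes "h > 0"
  shows "linear (\<lambda>x::real \<Rightarrow>\<^sub>C (real^'n). segment h (apply_bcontfun x) t)"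
  by (rule linearI; rule bcontfun_eqI; subst segment_apply_bcontfun[OF assms])
    (simp_all add: segment_apply_bcontfun[OF assms])

lemma bounded_linear_segment:
  assumes "h > 0"
  shows "bounded_linear (\<lambda>x::real \<Rightarrow>\<^sub>C (real^'n). segment h (apply_bcontfun x) t)"
  using linear_segment[OF assms, of t] norm_segment_le[OF assms, of _ t]
  by (intro bounded_linear.intro bounded_linear_axioms.intro exI[of _ 1]) auto

lemma continuous_segment:
  fixes x :: "real \<Rightarrow>\<^sub>C (real^'n)"
  assumes "h > 0"
  shows "continuous_on UNIV (\<lambda>t. segment h (apply_bcontfun x) t)"
  unfolding continuous_on_iff
proof (intro ballI allI impI)
  fix t e :: real assume e: "e > 0"
  \<comment> \<open>This interval contains \<open>s + \<theta>\<close> for all \<open>s\<close>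
    within \<open>1\<close> of \<open>t\<close> and all \<theta> in \<open>[-h, 0]\<close>.\<close>
  have "uniformly_continuous_on {t - h - 1..t + 1} (apply_bcontfun x)"
    by (intro compact_uniformly_continuous) auto
  moreover have "e / 2 > 0" using e by simp
  ultimately obtain d where d: "d > 0"
    "\<And>a b. a \<in> {t - h - 1..t + 1} \<Longrightarrow> b \<in> {t - h - 1..t + 1} \<Longrightarrow> dist b a < d \<Longrightarrow>
      dist (apply_bcontfun x b) (apply_bcontfun x a) < e / 2"
    unfolding uniformly_continuous_on_def by metis
  show "\<exists>d>0. \<forall>t'\<in>UNIV. dist t' t < d \<longrightarrow>
      dist (segment h (apply_bcontfun x) t') (segment h (apply_bcontfun x) t) < e"
  proof (intro exI[of _ "min d 1"] conjI ballI impI)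
    fix t' assume t': "dist t' t < min d 1"
    have "dist (segment h (apply_bcontfun x) t') (segment h (apply_bcontfun x) t) \<le> e / 2"
    proof (rule dist_bound)
      fix \<theta>
      have "clamp (-h) 0 \<theta> \<in> {-h..0}" using assms by (intro clamp_real_mem) simp
      then have "dist (apply_bcontfun x (t' + clamp (-h) 0 \<theta>)) (apply_bcontfun x (t + clamp (-h) 0 \<theta>)) < e / 2"
        using t' by (intro d(2)) (auto simp: dist_real_def abs_if split: if_splits)
      then show "dist (apply_bcontfun (segment h (apply_bcontfun x) t') \<theta>)
          (apply_bcontfun (segment h (apply_bcontfun x) t) \<theta>) \<le> e / 2"
        by (simp add: segment_apply_bcontfun[OF assms])
    qed
    then show "dist (segment h (apply_bcontfun x) t') (segment h (apply_bcontfun x) t) < e"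
      using e by simp
  qed (use d in simp)
qed

text \<open>Over all real times the segments of a bounded continuous function need not form a
  compact set; clamping leaves those with times in the compact interval
  \<open>{0..t}\<close>.\<close>

lemma contraction_curve_segment:
  assumes "h > 0" "t \<ge> 0"
  shows "contraction_curve (\<lambda>r (x::real \<Rightarrow>\<^sub>C (real^'n)). segment h (apply_bcontfun x) (clamp 0 t r))"
proof (rule contraction_curve.intro)
  fix x :: "real \<Rightarrow>\<^sub>C (real^'n)"
  have c: "continuous_on UNIV (\<lambda>r. clamp 0 t (r::real))"
    using assms(2) by (simp add: clamp_real continuous_intros)
  show "continuous_on UNIV (\<lambda>r. segment h (apply_bcontfun x) (clamp 0 t r))"
    by (rule continuous_on_compose2[OF continuous_segment[OF assms(1)] c]) simp
  have "range (clamp 0 t) = {0..t}"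
  proof (intro antisym subsetI)
    fix r assume "r \<in> {0..t}"
    then have "r = clamp 0 t r" by (simp add: clamp_real)
    then show "r \<in> range (clamp 0 t)" by (rule range_eqI)
  qed (use assms(2) clamp_real_mem in auto)
  then have "range (\<lambda>r. segment h (apply_bcontfun x) (clamp 0 t r)) = segment h (apply_bcontfun x) ` {0..t}"
    by (metis image_image)
  also have "compact \<dots>"
    by (intro compact_continuous_image continuous_on_subset[OF continuous_segment[OF assms(1)]]) auto
  finally show "compact (range (\<lambda>r. segment h (apply_bcontfun x) (clamp 0 t r)))" .
qed (rule linear_segment[OF assms(1)], rule norm_segment_le[OF assms(1)])

section \<open>The integral operator\<close>

text \<open>For \<open>s \<le> 0\<close> the clamped upper limit is \<open>0\<close> and the
  integral vanishes, so \<open>w + integral_op t g\<close> retains the history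
  \<open>w\<close>.\<close>

definition integral_op :: "real \<Rightarrow> (real \<Rightarrow>\<^sub>C (real^'n)) \<Rightarrow> (real \<Rightarrow>\<^sub>C (real^'n))" where
  "integral_op t g = Bcontfun (ext_cont (\<lambda>s. integral {0..s} (apply_bcontfun g)) 0 t)"

lemma integrable_apply_bcontfun:
  fixes g :: "real \<Rightarrow>\<^sub>C (real^'n)"
  shows "apply_bcontfun g integrable_on {a..b}"
  by (intro integrable_continuous_interval) auto

lemma integral_op_apply:
  fixes g :: "real \<Rightarrow>\<^sub>C (real^'n)"
  assumes "t \<ge> 0"
  shows "apply_bcontfun (integral_op t g) s = integral {0..clamp 0 t s} (apply_bcontfun g)"
  unfolding integral_op_def
  by (rule apply_Bcontfun_ext_cont[OF assms])
    (intro indefinite_integral_continuous_1 integrable_apply_bcontfun)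

text \<open>The factor \<open>t\<close> is what makes the fixed point equation contractive for short
  times.\<close>

lemma norm_integral_op_le:
  fixes g :: "real \<Rightarrow>\<^sub>C (real^'n)"
  assumes "t \<ge> 0"
  shows "norm (integral_op t g) \<le> t * norm g"
proof (rule norm_bound)
  fix s
  have c: "clamp 0 t s \<in> {0..t}" using assms by (rule clamp_real_mem)
  have "norm (integral {0..clamp 0 t s} (apply_bcontfun g)) \<le> norm g * (clamp 0 t s - 0)"
    using c by (intro integral_bound) (auto simp: norm_bounded)
  also have "\<dots> \<le> t * norm g" using c by (simp add: mult.commute[of t] mult_left_mono)
  finally show "norm (apply_bcontfun (integral_op t g) s) \<le> t * norm g"
    by (simp add: integral_op_apply[OF assms])
qed

lemma bounded_linear_integral_op:
  assumes "t \<ge> 0"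
  shows "bounded_linear (integral_op t :: _ \<Rightarrow> (real \<Rightarrow>\<^sub>C (real^'n)))"
proof (rule bounded_linear_intro[where K = t])
  show "integral_op t (a + b) = integral_op t a + integral_op t b" for a b :: "real \<Rightarrow>\<^sub>C (real^'n)"
    by (rule bcontfun_eqI)
      (simp add: integral_op_apply[OF assms] integral_add integrable_apply_bcontfun)
  show "integral_op t (c *\<^sub>R a) = c *\<^sub>R integral_op t a" for c and a :: "real \<Rightarrow>\<^sub>C (real^'n)"
    by (rule bcontfun_eqI) (simp add: integral_op_apply[OF assms])
  show "norm (integral_op t a) \<le> norm a * t" for a :: "real \<Rightarrow>\<^sub>C (real^'n)"
    using norm_integral_op_le[OF assms, of a] by (simp add: mult.commute)
qed

section \<open>From the history space to the whole space\<close>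

text \<open>\<open>P\<close> will be the segment at time \<open>0\<close>. Applying it to the point
  and to every argument extends each derivative of \<open>f\<close> to the whole space; its norm is
  at most one, so all estimates survive.\<close>

lemma C_k_on_imp_C_multi:
  fixes P :: "'a::real_normed_vector \<Rightarrow> 'a" and f :: "'a \<Rightarrow> 'b::real_normed_vector"
  assumes f: "C_k_on X k \<Omega> f" and P: "linear P" "\<And>x. P x \<in> X" "\<And>x. norm (P x) \<le> norm x"
  shows "C_multi k 0 (P -` \<Omega>) (\<lambda>x vs. f (P x))"
proof -
  obtain D where D: "has_frechet_derivatives_on X k \<Omega> f D"
    and cont: "\<And>x \<epsilon>. x \<in> \<Omega> \<Longrightarrow> \<epsilon> > 0 \<Longrightarrow>
      \<forall>\<^sub>F y in at x within \<Omega>. multilinear_norm_le X k (\<lambda>vs. D k y vs - D k x vs) \<epsilon>"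
    using f unfolding C_k_on_def by (elim exE conjE) simp
  have D0: "\<And>x. x \<in> \<Omega> \<Longrightarrow> D 0 x [] = f x"
    and Dml: "\<And>j x. j \<le> k \<Longrightarrow> x \<in> \<Omega> \<Longrightarrow> bounded_multilinear_on X j (D j x)"
    and Dd: "\<And>j x \<epsilon>. j < k \<Longrightarrow> x \<in> \<Omega> \<Longrightarrow> \<epsilon> > 0 \<Longrightarrow> \<forall>\<^sub>F y in at x within \<Omega>.
        multilinear_norm_le X j (\<lambda>vs. D j y vs - D j x vs - D (Suc j) x ((y - x) # vs))
          (\<epsilon> * norm (y - x))"
    using D unfolding has_frechet_derivatives_on_def by simp_all
  have pn: "prod_list (map norm (map P vs)) \<le> prod_list (map norm vs)" for vs
    by (induction vs) (auto intro!: mult_mono P(3) simp del: map_map)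
  have mn: "mlin_norm_le j (\<lambda>vs. L (map P vs)) c"
    if "multilinear_norm_le X j L c" "c \<ge> 0" for j c and L :: "'a list \<Rightarrow> 'b"
    unfolding mlin_norm_le_iff
  proof (intro allI impI)
    fix vs :: "'a list" assume "length vs = j"
    moreover have "set (map P vs) \<subseteq> X" using P(2) by auto
    ultimately have "norm (L (map P vs)) \<le> c * prod_list (map norm (map P vs))"
      using that(1)[unfolded multilinear_norm_le_def, rule_format, of "map P vs"] by simp
    also have "\<dots> \<le> c * prod_list (map norm vs)" by (intro mult_left_mono pn that(2))
    finally show "norm (L (map P vs)) \<le> c * prod_list (map norm vs)" .
  qed
  define N where "N j x vs = D j (P x) (map P vs)" for j x vs
  have bN: "bdd_mlin j (N j x)" if j: "j \<le> k" and x: "x \<in> P -` \<Omega>" for j x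
  proof -
    have B: "bounded_multilinear_on X j (D j (P x))" using Dml[OF j] x by simp
    then obtain K where K: "multilinear_norm_le X j (D j (P x)) K"
      unfolding bounded_multilinear_on_def by blast
    have "multilinear_norm_le X j (D j (P x)) (max K 0)"
      unfolding multilinear_norm_le_def
    proof (intro allI impI)
      fix vs assume vs: "length vs = j \<and> set vs \<subseteq> X"
      with K have "norm (D j (P x) vs) \<le> K * prod_list (map norm vs)"
        unfolding multilinear_norm_le_def by blast
      also have "\<dots> \<le> max K 0 * prod_list (map norm vs)" by (intro mult_right_mono) auto
      finally show "norm (D j (P x) vs) \<le> max K 0 * prod_list (map norm vs)" .
    qed
    from mn[OF this] have "\<exists>K\<ge>0. mlin_norm_le j (N j x) K"
      unfolding N_def by (intro exI[of _ "max K 0"]) simp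
    moreover have "N j x (xs @ (a + b) # ys) = N j x (xs @ a # ys) + N j x (xs @ b # ys) \<and>
      N j x (xs @ (c *\<^sub>R a) # ys) = c *\<^sub>R N j x (xs @ a # ys)"
      if len: "length xs + Suc (length ys) = j" for xs ys a b c
    proof -
      have "(map P xs @ 0 # map P ys)[length xs := z] = map P xs @ z # map P ys" for z
        by (simp add: list_update_append)
      moreover have "set (map P xs @ 0 # map P ys) \<subseteq> X"
        using P(2) linear_0[OF P(1)] by (auto, metis)
      ultimately show ?thesis
        using B[unfolded bounded_multilinear_on_def, THEN conjunct1, rule_format,
            of "map P xs @ 0 # map P ys" "length xs"] len P(2)
        by (simp add: N_def linear_add[OF P(1)] linear_scale[OF P(1)])
    qed
    ultimately show ?thesis unfolding bdd_mlin_iff by blast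
  qed
  have dN: "multi_deriv j (P -` \<Omega>) (N j) (N (Suc j))" if j: "j < k" for j
  proof (rule multi_derivI)
    fix x and \<epsilon> :: real assume x: "x \<in> P -` \<Omega>" and e: "\<epsilon> > 0"
    from x have "P x \<in> \<Omega>" by simp
    from Dd[OF j this e] obtain d where d: "d > 0"
      "\<And>y. y \<in> \<Omega> \<Longrightarrow> y \<noteq> P x \<Longrightarrow> dist y (P x) < d \<Longrightarrow>
        multilinear_norm_le X j (\<lambda>vs. D j y vs - D j (P x) vs - D (Suc j) (P x) ((y - P x) # vs))
          (\<epsilon> * norm (y - P x))"
      unfolding eventually_at by blast
    have "mlin_norm_le j (\<lambda>vs. N j y vs - N j x vs - N (Suc j) x ((y - x) # vs)) (\<epsilon> * norm (y - x))"
      if y: "y \<in> P -` \<Omega>" "dist y x < d" for y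
    \<comment> \<open>\<open>P\<close> may identify \<open>y\<close> with \<open>x\<close>. The
      filter at \<open>P x\<close> says nothing then, but \<open>P (y - x) = 0\<close> makes the
      remainder zero.\<close>
    proof (cases "P y = P x")
      case True
      have "N (Suc j) x ((y - x) # vs) = 0" if "length vs = j" for vs
      proof -
        have "N (Suc j) x ((y - x) # vs) = N (Suc j) x (0 # vs)"
          using True by (simp add: N_def linear_diff[OF P(1)] linear_0[OF P(1)])
        also have "\<dots> = 0"
          using linear_simps(3)[OF bdd_mlin_Cons_bounded_linear[OF bN[of "Suc j" x] that]] j x by simp
        finally show ?thesis .
      qed
      then show ?thesis using True e by (simp add: mlin_norm_le_iff N_def)
    next
      case False
      have n: "norm (P y - P x) \<le> norm (y - x)"
        using P(3)[of "y - x"] by (simp add: linear_diff[OF P(1)])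
      then have "dist (P y) (P x) < d" using y(2) by (simp add: dist_norm)
      from mn[OF d(2)[OF _ False this]] y(1) e
      have "mlin_norm_le j (\<lambda>vs. D j (P y) (map P vs) - D j (P x) (map P vs)
          - D (Suc j) (P x) ((P y - P x) # map P vs)) (\<epsilon> * norm (P y - P x))" by simp
      then have "mlin_norm_le j (\<lambda>vs. N j y vs - N j x vs - N (Suc j) x ((y - x) # vs)) (\<epsilon> * norm (P y - P x))"
        by (simp add: N_def linear_diff[OF P(1)])
      then show ?thesis by (rule mlin_norm_le_mono) (use n e in simp)
    qed
    with d(1) show "\<exists>\<delta>>0. \<forall>y\<in>P -` \<Omega>. dist y x < \<delta> \<longrightarrow>
        mlin_norm_le j (\<lambda>vs. N j y vs - N j x vs - N (Suc j) x ((y - x) # vs)) (\<epsilon> * norm (y - x))"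
      by blast
  qed
  have cN: "multi_cont k (P -` \<Omega>) (N k)"
  proof (rule multi_contI)
    fix x and \<epsilon> :: real assume x: "x \<in> P -` \<Omega>" and e: "\<epsilon> > 0"
    from x have "P x \<in> \<Omega>" by simp
    from cont[OF this e] obtain d where d: "d > 0"
      "\<And>y. y \<in> \<Omega> \<Longrightarrow> y \<noteq> P x \<Longrightarrow> dist y (P x) < d \<Longrightarrow>
        multilinear_norm_le X k (\<lambda>vs. D k y vs - D k (P x) vs) \<epsilon>"
      unfolding eventually_at by blast
    have "mlin_norm_le k (\<lambda>vs. N k y vs - N k x vs) \<epsilon>"
      if y: "y \<in> P -` \<Omega>" "dist y x < d" for y
    proof (cases "P y = P x")
      case True
      then show ?thesis using e by (simp add: mlin_norm_le_iff N_def)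
    next
      case False
      have "dist (P y) (P x) < d" using y(2) P(3)[of "y - x"] by (simp add: dist_norm linear_diff[OF P(1)])
      from mn[OF d(2)[OF _ False this]] y(1) e show ?thesis by (simp add: N_def)
    qed
    with d(1) show "\<exists>\<delta>>0. \<forall>y\<in>P -` \<Omega>. dist y x < \<delta> \<longrightarrow> mlin_norm_le k (\<lambda>vs. N k y vs - N k x vs) \<epsilon>"
      by blast
  qed
  \<comment> \<open>Counted downwards from the top derivative, since each level of
    \<open>C_multi\<close> rests on the next derivative.\<close>
  have "C_multi i (k - i) (P -` \<Omega>) (N (k - i))" if "i \<le> k" for i
    using that
  proof (induction i)
    case 0
    then show ?case using cN bN by simp
  next
    case (Suc i)
    then have eq: "Suc (k - Suc i) = k - i" by simp
    have "multi_deriv (k - Suc i) (P -` \<Omega>) (N (k - Suc i)) (N (k - i))"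
      using dN[of "k - Suc i"] Suc.prems unfolding eq by simp
    moreover have "\<forall>x\<in>P -` \<Omega>. bdd_mlin (k - Suc i) (N (k - Suc i) x)" by (simp add: bN)
    ultimately show ?case using Suc.IH Suc.prems unfolding C_multi.simps eq by auto
  qed
  from this[of k] have "C_multi k 0 (P -` \<Omega>) (N 0)" by simp
  then show ?thesis
    by (rule C_multi_cong[rotated]) (use D0 in \<open>auto simp: N_def\<close>)
qed

text \<open>Near \<open>p\<close> the derivative is bounded by \<open>1 + K\<close>, and a ball is
  convex, so the mean value inequality applies.\<close>

lemma C_multi_locally_lipschitz:
  assumes "open U" "C_multi (Suc m) 0 U (\<lambda>x vs. g x)" "p \<in> U"
  obtains \<delta> L where "\<delta> > 0" "L \<ge> 0" "ball p \<delta> \<subseteq> U"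
    "\<And>x y. x \<in> ball p \<delta> \<Longrightarrow> y \<in> ball p \<delta> \<Longrightarrow> norm (g x - g y) \<le> L * norm (x - y)"
proof -
  obtain G where G: "C_multi m (Suc 0) U G" "multi_deriv 0 U (\<lambda>x vs. g x) G" using assms(2) by auto
  note bG = C_multi_bml[OF G(1)]
  obtain K where K: "K \<ge> 0" "mlin_norm_le (Suc 0) (G p) K" using bG[OF assms(3)] bdd_mlin_bound by blast
  from multi_contD[OF C_multi_cont[OF G(1)] assms(3) zero_less_one] obtain d where d: "d > 0"
    "\<And>y. y \<in> U \<Longrightarrow> dist y p < d \<Longrightarrow> mlin_norm_le (Suc 0) (\<lambda>vs. G y vs - G p vs) 1" by blast
  obtain r where r: "r > 0" "ball p r \<subseteq> U" using assms(1,3) openE by blast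
  show ?thesis
  proof (rule that[of "min d r" "1 + K"])
    show "ball p (min d r) \<subseteq> U" using r by auto
    fix x y assume xy: "x \<in> ball p (min d r)" "y \<in> ball p (min d r)"
    show "norm (g x - g y) \<le> (1 + K) * norm (x - y)"
    proof (rule differentiable_bound[where S = "ball p (min d r)" and f' = "\<lambda>x v. G x [v]"])
      fix z assume z: "z \<in> ball p (min d r)"
      then have zU: "z \<in> U" using r by auto
      show "(g has_derivative (\<lambda>v. G z [v])) (at z within ball p (min d r))"
        using multi_deriv_has_derivative[OF G(2) assms(1) zU bG[OF zU], of "[]"]
        by (auto intro: has_derivative_at_withinI)
      have "mlin_norm_le (Suc 0) (G z) (1 + K)"
        using mlin_norm_le_add[OF d(2)[OF zU] K(2)] z by (simp add: dist_commute)
      from mlin_norm_le_D[OF this, of "[_]"] show "onorm (\<lambda>v. G z [v]) \<le> 1 + K"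
        using K(1) by (intro onorm_bound) auto
    qed (use xy in auto)
  qed (use d r K in auto)
qed

section \<open>Uniqueness and maximal solutions\<close>

text \<open>\<open>x\<close> is controlled only on \<open>[-h, \<tau>]\<close>. Its constant
  extension \<open>z\<close> is bounded and continuous and has the same segments at times in
  \<open>[0, \<tau>]\<close>, so \<open>continuous_segment\<close> applies.\<close>

lemma continuous_segment_solution:
  fixes x :: "real \<Rightarrow> real^'n"
  assumes "h > 0" "continuous_on {-h..\<tau>} x"
  shows "continuous_on {0..\<tau>} (segment h x)"
proof (cases "\<tau> \<ge> 0")
  case True
  define z where "z = Bcontfun (ext_cont x (-h) \<tau>)"
  have z: "apply_bcontfun z s = x (clamp (-h) \<tau> s)" for s
    unfolding z_def using assms True by (intro apply_Bcontfun_ext_cont) auto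
  have "segment h x r = segment h (apply_bcontfun z) r" if "r \<in> {0..\<tau>}" for r
    using that True assms(1) by (intro segment_cong) (auto simp: z clamp_real)
  moreover have "continuous_on {0..\<tau>} (segment h (apply_bcontfun z))"
    by (rule continuous_on_subset[OF continuous_segment[OF assms(1)]]) simp
  ultimately show ?thesis by (metis continuous_on_eq)
qed simp

text \<open>A time \<tau> strictly between \<open>t\<close> and \<open>T\<close> makes the claim
  local, alike for finite and infinite \<open>T\<close>.\<close>

lemma continuous_on_ereal_interval:
  fixes g :: "real \<Rightarrow> 'a::topological_space"
  assumes "\<And>\<tau>. ereal \<tau> < T \<Longrightarrow> continuous_on {c..\<tau>} g"
  shows "continuous_on {t. c \<le> t \<and> ereal t < T} g"
  unfolding continuous_on_eq_continuous_within
proof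
  fix t assume t: "t \<in> {t. c \<le> t \<and> ereal t < T}"
  then obtain \<tau> where \<tau>: "t < \<tau>" "ereal \<tau> < T"
    using ereal_dense2[of "ereal t" T] by auto
  have lt: "ereal s < T" if "s < \<tau>" for s
    using that \<tau>(2) by (meson ereal_less_eq(3) le_less_trans less_imp_le)
  have "at t within {t. c \<le> t \<and> ereal t < T} = at t within {c..\<tau>}"
    by (rule at_within_nhd[of _ "{..<\<tau>}"]) (use \<tau> lt in auto)
  moreover have "continuous (at t within {c..\<tau>}) g"
    using assms[OF \<tau>(2)] t \<tau>(1) by (auto simp: continuous_on_eq_continuous_within)
  ultimately show "continuous (at t within {t. c \<le> t \<and> ereal t < T}) g" by simp
qed

lemma dde_solution_continuous:
  assumes "dde_solution h \<Omega> f u T x" "ereal \<tau> < T"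
  shows "continuous_on {-h..\<tau>} x"
proof -
  have "continuous_on {t. -h \<le> t \<and> ereal t < T} x"
    using assms(1) by (simp add: dde_solution_def)
  then show ?thesis
  proof (rule continuous_on_subset)
    have "ereal s < T" if "s \<le> \<tau>" for s
      using that assms(2) by (meson ereal_less_eq(3) le_less_trans)
    then show "{-h..\<tau>} \<subseteq> {t. -h \<le> t \<and> ereal t < T}" by auto
  qed
qed

text \<open>The derivative is continuous because it equals \<open>f\<close> along the continuous
  curve of segments.\<close>

lemma dde_solutionI:
  fixes x :: "real \<Rightarrow> real^'n"
  assumes "h > 0" "0 < T" "continuous_on \<Omega> f"
    and cont: "\<And>\<tau>. 0 \<le> \<tau> \<Longrightarrow> ereal \<tau> < T \<Longrightarrow> continuous_on {-h..\<tau>} x"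
    and init: "\<And>\<theta>. \<theta> \<in> {-h..0} \<Longrightarrow> x \<theta> = apply_bcontfun u \<theta>"
    and seg: "\<And>t. 0 \<le> t \<Longrightarrow> ereal t < T \<Longrightarrow> segment h x t \<in> \<Omega>"
    and der: "\<And>t. 0 < t \<Longrightarrow> ereal t < T \<Longrightarrow> (x has_vector_derivative f (segment h x t)) (at t)"
    and right: "(x has_vector_derivative f u) (at_right 0)"
  shows "dde_solution h \<Omega> f u T x"
proof -
  have lt: "ereal s < T" if "s \<le> \<tau>" "ereal \<tau> < T" for s \<tau>
    using that by (meson ereal_less_eq(3) le_less_trans)
  have c: "continuous_on {-h..\<tau>} x" if "ereal \<tau> < T" for \<tau>
  proof (cases "0 \<le> \<tau>")
    case False
    have "continuous_on {-h..0} x" using cont[of 0] assms(2) by (simp add: zero_ereal_def)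
    then show ?thesis by (rule continuous_on_subset) (use False in auto)
  qed (use cont that in blast)
  have "continuous_on {0..\<tau>} (\<lambda>t. f (segment h x t))" if "ereal \<tau> < T" for \<tau>
    by (rule continuous_on_compose2[OF assms(3) continuous_segment_solution[OF assms(1) c[OF that]]])
      (use seg lt that in auto)
  then have "continuous_on {t. 0 \<le> t \<and> ereal t < T} (\<lambda>t. f (segment h x t))"
    by (rule continuous_on_ereal_interval)
  then have "continuous_on {t. 0 < t \<and> ereal t < T} (\<lambda>t. f (segment h x t))"
    by (rule continuous_on_subset) auto
  then have "continuous_on {t. 0 < t \<and> ereal t < T} (\<lambda>t. vector_derivative x (at t))"
    by (rule continuous_on_eq) (use der in \<open>auto intro: vector_derivative_at[symmetric]\<close>)
  moreover have "continuous_on {t. -h \<le> t \<and> ereal t < T} x"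
    using c by (rule continuous_on_ereal_interval)
  ultimately show ?thesis
    unfolding dde_solution_def using assms by auto
qed

section \<open>Uniqueness\<close>

definition locally_lipschitz :: "'a::real_normed_vector set \<Rightarrow> ('a \<Rightarrow> 'b::real_normed_vector) \<Rightarrow> bool" where
  "locally_lipschitz \<Omega> f \<longleftrightarrow>
     (\<forall>p\<in>\<Omega>. \<exists>\<delta>>0. \<exists>L\<ge>0. \<forall>x\<in>\<Omega> \<inter> ball p \<delta>. \<forall>y\<in>\<Omega> \<inter> ball p \<delta>. norm (f x - f y) \<le> L * norm (x - y))"

text \<open>Let \<open>a\<close> be the infimum of the times at which the solutions differ. They
  agree up to \<open>a\<close>, so both segments start from the same \<open>p\<close>, and on a
  short interval \<open>[a, a + c]\<close> the largest distance \<open>d m\<close> is at most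
  \<open>c * L * d m\<close>. As \<open>c * L \<le> 1/2\<close> it is zero, which contradicts the
  choice of \<open>a\<close>.\<close>

lemma dde_solution_unique:
  fixes x y :: "real \<Rightarrow> real^'n"
  assumes h: "h > 0" and lip: "locally_lipschitz \<Omega> f"
    and x: "dde_solution h \<Omega> f u T x" and y: "dde_solution h \<Omega> f u S y"
    and t: "-h \<le> t" "ereal t < T" "ereal t < S"
  shows "x t = y t"
proof (rule ccontr)
  assume neq: "x t \<noteq> y t"
  have init: "x \<theta> = y \<theta>" if "\<theta> \<in> {-h..0}" for \<theta>
    using x y that by (simp add: dde_solution_def)
  with neq t(1) have t0: "t > 0" by force
  have lt: "ereal s < T" "ereal s < S" if "s \<le> t" for s
    using that t by (meson ereal_less_eq(3) le_less_trans)+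
  have cx: "continuous_on {-h..t} x" and cy: "continuous_on {-h..t} y"
    using dde_solution_continuous[OF x t(2)] dde_solution_continuous[OF y t(3)] by auto
  have segx: "continuous_on {0..t} (segment h x)" and segy: "continuous_on {0..t} (segment h y)"
    using continuous_segment_solution[OF h cx] continuous_segment_solution[OF h cy] by auto
  have mx: "segment h x s \<in> \<Omega>" and my: "segment h y s \<in> \<Omega>" if "0 \<le> s" "s \<le> t" for s
    using x y that lt[of s] by (auto simp: dde_solution_def)
  define d where "d s = norm (x s - y s)" for s
  have cd: "continuous_on {-h..t} d"
    unfolding d_def by (intro continuous_intros cx cy)
  define B where "B = {s \<in> {0..t}. x s \<noteq> y s}"
  have tB: "t \<in> B" using neq t0 by (simp add: B_def)
  have bdd: "bdd_below B" by (rule bdd_belowI[of _ 0]) (auto simp: B_def)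
  define a where "a = Inf B"
  have a: "0 \<le> a" "a \<le> t"
    using tB bdd by (auto simp: a_def B_def intro: cInf_greatest cInf_lower)
  have before: "x s = y s" if "-h \<le> s" "s < a" for s
  proof (cases "s \<le> 0")
    case False
    have "s \<notin> B" using that(2) cInf_lower[OF _ bdd, of s] by (auto simp: a_def)
    then show ?thesis using False that a by (auto simp: B_def)
  qed (use init that in auto)
  have at: "x a = y a"
  proof (rule ccontr)
    assume ne: "x a \<noteq> y a"
    then have "a \<noteq> 0" using init[of 0] h by auto
    have "d a > 0" using ne by (simp add: d_def)
    then obtain \<delta> where \<delta>: "\<delta> > 0" "\<And>s. s \<in> {-h..t} \<Longrightarrow> dist s a < \<delta> \<Longrightarrow> dist (d s) (d a) < d a"
      using cd[unfolded continuous_on_iff, rule_format, of a "d a"] a h by force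
    \<comment> \<open>A time before \<open>a\<close> that is nonnegative and within \<delta> of
      \<open>a\<close>: there \<open>d\<close> vanishes, although continuity makes it
      positive.\<close>
    define s where "s = a - min (\<delta>/2) a"
    have s: "0 \<le> s" "s < a" "dist s a < \<delta>"
      using \<delta>(1) a(1) \<open>a \<noteq> 0\<close> by (auto simp: s_def dist_real_def min_def)
    have "dist (d s) (d a) < d a" using \<delta>(2)[of s] s a h by auto
    moreover have "d s = 0" using before[of s] s h by (simp add: d_def)
    ultimately show False using \<open>d a > 0\<close> by (simp add: dist_real_def)
  qed
  have upto: "x s = y s" if "-h \<le> s" "s \<le> a" for s
    using before[of s] at that by (cases "s = a") auto
  have "a \<noteq> t" using at neq by auto
  then have at': "a < t" using a by simp
  define p where "p = segment h x a"
  have py: "segment h y a = p"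
    unfolding p_def using upto a h by (intro segment_cong) auto
  have p\<Omega>: "p \<in> \<Omega>" using mx a by (simp add: p_def)
  obtain \<delta> L where L: "\<delta> > 0" "L \<ge> 0"
    "\<And>v w. v \<in> \<Omega> \<inter> ball p \<delta> \<Longrightarrow> w \<in> \<Omega> \<inter> ball p \<delta> \<Longrightarrow> norm (f v - f w) \<le> L * norm (v - w)"
    using lip[unfolded locally_lipschitz_def, rule_format, OF p\<Omega>] by blast
  have aI: "a \<in> {0..t}" using a by simp
  obtain \<delta>1 where 1: "\<delta>1 > 0" "\<And>s. s \<in> {0..t} \<Longrightarrow> dist s a < \<delta>1 \<Longrightarrow> dist (segment h x s) p < \<delta>"
    using segx[unfolded continuous_on_iff, rule_format, OF aI L(1)] unfolding p_def by blast
  obtain \<delta>2 where 2: "\<delta>2 > 0" "\<And>s. s \<in> {0..t} \<Longrightarrow> dist s a < \<delta>2 \<Longrightarrow> dist (segment h y s) p < \<delta>"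
    using segy[unfolded continuous_on_iff, rule_format, OF aI L(1)] unfolding py by blast
  \<comment> \<open>\<open>c\<close> keeps both segments in the Lipschitz ball, does not pass
    \<open>t\<close>, and makes \<open>c * L \<le> 1/2\<close>; \<open>L + 1\<close> avoids division
    by zero.\<close>
  define c where "c = min (min (\<delta>1/2) (\<delta>2/2)) (min (t - a) (1 / (2 * (L + 1))))"
  have c: "c > 0" "c < \<delta>1" "c < \<delta>2" "a + c \<le> t" "c \<le> 1 / (2 * (L + 1))"
    using 1(1) 2(1) at' L(2) by (auto simp: c_def min_def)
  then have "c * (2 * (L + 1)) \<le> 1" using L(2) by (simp add: pos_le_divide_eq)
  then have cL: "c * L \<le> 1/2" using c(1) by (simp add: algebra_simps)
  have "continuous_on {a..a + c} d"
    by (rule continuous_on_subset[OF cd]) (use a c h in auto)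
  then obtain m where m: "m \<in> {a..a + c}" "\<And>s. s \<in> {a..a + c} \<Longrightarrow> d s \<le> d m"
    using continuous_attains_sup[of "{a..a + c}" d] c(1) by auto
  have dm0: "d m \<ge> 0" by (simp add: d_def)
  \<comment> \<open>Both segments coincide before \<open>a\<close>, so only times in
    \<open>[a, a + c]\<close> contribute to their distance.\<close>
  have segd: "norm (segment h x s - segment h y s) \<le> d m" if s: "a \<le> s" "s \<le> a + c" for s
  proof (rule norm_bound)
    fix \<theta>
    have cl: "clamp (-h) 0 \<theta> \<in> {-h..0}" using h by (intro clamp_real_mem) simp
    let ?r = "s + clamp (-h) 0 \<theta>"
    have "continuous_on {s - h..s} x" "continuous_on {s - h..s} y"
      by (rule continuous_on_subset[OF cx] continuous_on_subset[OF cy], use s a c in auto)+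
    then have "apply_bcontfun (segment h x s - segment h y s) \<theta> = x ?r - y ?r"
      using h by (simp add: segment_apply)
    moreover have "norm (x ?r - y ?r) \<le> d m"
    proof (cases "?r \<le> a")
      case True
      then have "x ?r = y ?r" using upto[of ?r] cl s a by auto
      then show ?thesis using dm0 by simp
    next
      case False
      then show ?thesis using m(2)[of ?r] cl s by (auto simp: d_def)
    qed
    ultimately show "norm (apply_bcontfun (segment h x s - segment h y s) \<theta>) \<le> d m" by simp
  qed
  have dm: "d m = 0"
  proof (cases "m = a")
    case False
    then have am: "a < m" using m by simp
    let ?D = "\<lambda>s. f (segment h x s) - f (segment h y s)"
    have "\<exists>s\<in>{a<..<m}. norm ((x m - y m) - (x a - y a)) \<le> norm ((m - a) *\<^sub>R ?D s)"
    proof (rule mvt_general[OF am, where f = "\<lambda>s. x s - y s" and f' = "\<lambda>s r. r *\<^sub>R ?D s"])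
      show "continuous_on {a..m} (\<lambda>s. x s - y s)"
        by (intro continuous_on_diff; rule continuous_on_subset[OF cx] continuous_on_subset[OF cy])
          (use a m c h in auto)
      fix s assume s: "a < s" "s < m"
      then have st: "0 < s" "s \<le> t" using a m c by auto
      have "(x has_vector_derivative f (segment h x s)) (at s)"
        "(y has_vector_derivative f (segment h y s)) (at s)"
        using x y st lt[of s] by (auto simp: dde_solution_def)
      then have "((\<lambda>s. x s - y s) has_vector_derivative ?D s) (at s)"
        by (rule has_vector_derivative_diff)
      then show "((\<lambda>s. x s - y s) has_derivative (\<lambda>r. r *\<^sub>R ?D s)) (at s)"
        by (simp add: has_vector_derivative_def)
    qed
    then obtain s where s: "a < s" "s < m" "d m \<le> (m - a) * norm (?D s)"
      using at by (auto simp: d_def)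
    have st: "s \<in> {0..t}" "dist s a < \<delta>1" "dist s a < \<delta>2" "s \<le> a + c"
      using s a m c by (auto simp: dist_real_def)
    have "segment h x s \<in> \<Omega> \<inter> ball p \<delta>" "segment h y s \<in> \<Omega> \<inter> ball p \<delta>"
      using 1(2)[OF st(1,2)] 2(2)[OF st(1,3)] mx my st(1) by (auto simp: dist_commute)
    then have "norm (?D s) \<le> L * norm (segment h x s - segment h y s)" by (rule L(3))
    also have "\<dots> \<le> L * d m" using segd[of s] s st L(2) by (intro mult_left_mono) auto
    finally have "(m - a) * norm (?D s) \<le> c * (L * d m)"
      using m am L(2) dm0 by (intro mult_mono) auto
    also have "\<dots> \<le> 1/2 * d m" using mult_right_mono[OF cL dm0] by simp
    finally show ?thesis using s(3) dm0 by simp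
  qed (use at in \<open>simp add: d_def\<close>)
  have "a + c \<le> s" if "s \<in> B" for s
  proof (rule ccontr)
    assume "\<not> a + c \<le> s"
    moreover have "a \<le> s" using that bdd by (auto simp: a_def intro: cInf_lower)
    ultimately have "d s \<le> 0" using m(2)[of s] dm by auto
    then show False using that by (simp add: B_def d_def)
  qed
  then have "a + c \<le> Inf B" using tB by (intro cInf_greatest) auto
  then show False using c(1) by (simp add: a_def)
qed

section \<open>Maximal solutions\<close>

lemma at_right_eq_Ici: "at_right (0::real) = at 0 within {0..}"
  by (rule at_within_nhd[of _ UNIV]) auto

text \<open>All solutions are glued: by uniqueness any two agree where both are defined, so the
  choice in \<open>y\<close> is harmless and the supremum of the lifetimes is attained. Dominating
  every solution is more than maximality, and it is what later makes the lifetime unique.\<close>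

lemma maximal_dde_solution_exists:
  fixes x :: "real \<Rightarrow> real^'n"
  assumes h: "h > 0" and lip: "locally_lipschitz \<Omega> f" and cf: "continuous_on \<Omega> f"
    and x: "dde_solution h \<Omega> f u T x"
  obtains S y where "maximal_dde_solution h \<Omega> f u S y"
    "\<And>S' y'. dde_solution h \<Omega> f u S' y' \<Longrightarrow> S' \<le> S"
proof -
  define Sols where "Sols = {(T, x). dde_solution h \<Omega> f u T x}"
  define S where "S = Sup (fst ` Sols)"
  have le: "T' \<le> S" if "dde_solution h \<Omega> f u T' x'" for T' x'
    unfolding S_def using that by (intro Sup_upper) (force simp: Sols_def)
  have ex: "\<exists>T' x'. dde_solution h \<Omega> f u T' x' \<and> ereal t < T'" if "ereal t < S" for t
    using that unfolding S_def less_Sup_iff by (force simp: Sols_def)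
  define y where "y t = (SOME v. \<exists>T' x'. dde_solution h \<Omega> f u T' x' \<and> ereal t < T' \<and> v = x' t)" for t
  have y: "y t = x' t" if x': "dde_solution h \<Omega> f u T' x'" and t: "-h \<le> t" "ereal t < T'" for T' x' t
  proof -
    have "\<exists>T'' x''. dde_solution h \<Omega> f u T'' x'' \<and> ereal t < T'' \<and> y t = x'' t"
      unfolding y_def by (rule someI_ex) (use x' t in blast)
    then show ?thesis using dde_solution_unique[OF h lip _ x' t(1) _ t(2)] by metis
  qed
  have T0: "0 < T" using x by (simp add: dde_solution_def)
  have seg: "segment h y t = segment h x' t"
    if x': "dde_solution h \<Omega> f u T' x'" and t: "0 \<le> t" "ereal t < T'" for T' x' t
  proof (rule segment_cong[OF h])
    fix s assume s: "t - h \<le> s" "s \<le> t"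
    then have "ereal s < T'" using t by (meson ereal_less_eq(3) le_less_trans)
    then show "y s = x' s" using y[OF x'] s t by simp
  qed
  have sol: "dde_solution h \<Omega> f u S y"
  proof (rule dde_solutionI[OF h _ cf])
    show "0 < S" using T0 le[OF x] by simp
  next
    fix \<tau> assume "0 \<le> \<tau>" "ereal \<tau> < S"
    then obtain T' x' where x': "dde_solution h \<Omega> f u T' x'" "ereal \<tau> < T'" using ex by blast
    have eq: "y s = x' s" if "s \<in> {-h..\<tau>}" for s
    proof (rule y[OF x'(1)])
      show "ereal s < T'" using that x'(2) by (meson atLeastAtMost_iff ereal_less_eq(3) le_less_trans)
    qed (use that in simp)
    show "continuous_on {-h..\<tau>} y"
      by (rule continuous_on_eq[OF dde_solution_continuous[OF x']]) (use eq in simp)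
  next
    fix \<theta> assume "\<theta> \<in> {-h..0}"
    moreover from this have "ereal \<theta> < T"
      by (intro le_less_trans[OF _ T0]) simp
    ultimately have "y \<theta> = x \<theta>" by (intro y[OF x]) auto
    with x \<open>\<theta> \<in> {-h..0}\<close> show "y \<theta> = apply_bcontfun u \<theta>" by (simp add: dde_solution_def)
  next
    fix t assume t: "0 \<le> t" "ereal t < S"
    then obtain T' x' where x': "dde_solution h \<Omega> f u T' x'" "ereal t < T'" using ex by blast
    then show "segment h y t \<in> \<Omega>"
      using seg[OF x'(1) t(1) x'(2)] t by (simp add: dde_solution_def)
  next
    fix t assume t: "0 < t" "ereal t < S"
    then obtain T' x' where x': "dde_solution h \<Omega> f u T' x'" "ereal t < T'" using ex by blast
    \<comment> \<open>The derivative depends on a neighbourhood of \<open>t\<close>, so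
      \<open>y\<close> must agree with \<open>x'\<close> beyond \<open>t\<close>.\<close>
    obtain \<tau> where \<tau>: "t < \<tau>" "ereal \<tau> < T'"
      using ereal_dense2[of "ereal t" T'] x'(2) by auto
    show "(y has_vector_derivative f (segment h y t)) (at t)"
    proof (rule has_vector_derivative_transform_within_open[where S = "{0<..<\<tau>}" and f = x'])
      show "(x' has_vector_derivative f (segment h y t)) (at t)"
        using x' t seg[OF x'(1) _ x'(2)] by (simp add: dde_solution_def)
      fix s assume s: "s \<in> {0<..<\<tau>}"
      then have "ereal s < T'" using \<tau>(2) by (meson ereal_less_eq(3) greaterThanLessThan_iff le_less_trans less_imp_le)
      then show "x' s = y s" using y[OF x'(1), of s] s h by simp
    qed (use t \<tau> in auto)
  next
    obtain \<tau> where \<tau>: "0 < \<tau>" "ereal \<tau> < T"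
      using ereal_dense2[of "ereal 0" T] T0 by (auto simp: zero_ereal_def)
    show "(y has_vector_derivative f u) (at_right 0)"
      unfolding at_right_eq_Ici
    proof (rule has_vector_derivative_transform_within[where d = \<tau> and f = x])
      show "(x has_vector_derivative f u) (at 0 within {0..})"
        using x by (simp add: dde_solution_def at_right_eq_Ici)
      fix s :: real assume s: "s \<in> {0..}" "dist s 0 < \<tau>"
      then have "s \<le> \<tau>" by simp
      then have "ereal s < T" using \<tau>(2) by (meson ereal_less_eq(3) le_less_trans)
      then show "x s = y s" using y[OF x, of s] s h by simp
    qed (use \<tau> in auto)
  qed
  moreover have "S' = S" if "dde_solution h \<Omega> f u S' y'" "S \<le> S'" for S' y'
    using le[OF that(1)] that(2) by simp
  ultimately have "maximal_dde_solution h \<Omega> f u S y" by (auto simp: maximal_dde_solution_def)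
  then show ?thesis using that le by blast
qed

text \<open>\<open>lifetime\<close> is a definite description and \<open>the_dde_solution\<close> a
  choice. Both become usable once the lifetime of a maximal solution is known to be unique; then any
  solution at hand computes the chosen one.\<close>

lemma the_dde_solution_eq:
  fixes x :: "real \<Rightarrow> real^'n"
  assumes h: "h > 0" and lip: "locally_lipschitz \<Omega> f" and cf: "continuous_on \<Omega> f"
    and x: "dde_solution h \<Omega> f u T x"
  shows "T \<le> lifetime h \<Omega> f u"
    "\<And>t. -h \<le> t \<Longrightarrow> ereal t < T \<Longrightarrow> the_dde_solution h \<Omega> f u t = x t"
proof -
  obtain S y where Sy: "maximal_dde_solution h \<Omega> f u S y"
    "\<And>S' y'. dde_solution h \<Omega> f u S' y' \<Longrightarrow> S' \<le> S"
    using maximal_dde_solution_exists[OF assms] by metis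
  have sol: "dde_solution h \<Omega> f u S y" using Sy(1) by (simp add: maximal_dde_solution_def)
  \<comment> \<open>The glued solution extends every maximal one, so maximality forces equal
    lifetimes.\<close>
  have "S' = S" if "maximal_dde_solution h \<Omega> f u S' y'" for S' y'
  proof -
    have sol': "dde_solution h \<Omega> f u S' y'" using that by (simp add: maximal_dde_solution_def)
    have le: "S' \<le> S" by (rule Sy(2)[OF sol'])
    have "y t = y' t" if "-h \<le> t" "ereal t < S'" for t
      using dde_solution_unique[OF h lip sol sol'] that le by (meson less_le_trans)
    then have "S = S'" using that[unfolded maximal_dde_solution_def] sol le by blast
    then show ?thesis by simp
  qed
  then have life: "lifetime h \<Omega> f u = S"
    unfolding lifetime_def using Sy(1) by (intro the_equality) blast+
  have "maximal_dde_solution h \<Omega> f u S (the_dde_solution h \<Omega> f u)"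
    unfolding the_dde_solution_def life by (rule someI[of "maximal_dde_solution h \<Omega> f u S", OF Sy(1)])
  then have sol': "dde_solution h \<Omega> f u S (the_dde_solution h \<Omega> f u)"
    by (simp add: maximal_dde_solution_def)
  show le: "T \<le> lifetime h \<Omega> f u" using Sy(2)[OF x] life by simp
  show "the_dde_solution h \<Omega> f u t = x t" if "-h \<le> t" "ereal t < T" for t
    using dde_solution_unique[OF h lip sol' x that(1) _ that(2)] that(2) le
    unfolding life by (meson less_le_trans)
qed

section \<open>The local solution map\<close>

lemma multi_cont_apply:
  assumes "multi_cont j U M" "length vs = j"
  shows "continuous_on U (\<lambda>x. M x vs)"
  unfolding continuous_on_iff
proof (intro ballI allI impI)
  fix x and e :: real assume x: "x \<in> U" and e: "e > 0"
  define p where "p = prod_list (map norm vs)"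
  have p: "p \<ge> 0" by (simp add: p_def)
  have e': "e / (p + 1) > 0" using p e by simp
  obtain \<delta> where \<delta>: "\<delta> > 0"
    "\<And>y. y \<in> U \<Longrightarrow> dist y x < \<delta> \<Longrightarrow> mlin_norm_le j (\<lambda>vs. M y vs - M x vs) (e / (p + 1))"
    by (rule multi_contD[OF assms(1) x e']) (rule that)
  have "dist (M y vs) (M x vs) < e" if "y \<in> U" "dist y x < \<delta>" for y
  proof -
    have "norm (M y vs - M x vs) \<le> e / (p + 1) * p"
      using mlin_norm_le_D[OF \<delta>(2)[OF that] assms(2)] by (simp add: p_def)
    also have "\<dots> < e" using p e by (simp add: field_simps)
    finally show ?thesis by (simp add: dist_norm)
  qed
  then show "\<exists>d>0. \<forall>y\<in>U. dist y x < d \<longrightarrow> dist (M y vs) (M x vs) < e" using \<delta>(1) by blast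
qed

text \<open>The segment map is nonexpansive in \<open>x\<close> uniformly in the time, so continuity
  in the time alone suffices; the triangle inequality goes through the point
  \<open>(s', x)\<close>.\<close>

lemma continuous_segment_pair:
  assumes "h > 0"
  shows "continuous_on UNIV (\<lambda>(s, x::real \<Rightarrow>\<^sub>C (real^'n)). segment h (apply_bcontfun x) s)"
  unfolding continuous_on_iff
proof (intro ballI allI impI)
  fix z :: "real \<times> (real \<Rightarrow>\<^sub>C (real^'n))" and e :: real assume e: "e > 0"
  obtain s x where z: "z = (s, x)" by (cases z)
  let ?g = "\<lambda>s x. segment h (apply_bcontfun x) s :: real \<Rightarrow>\<^sub>C (real^'n)"
  have "e / 2 > 0" using e by simp
  then obtain d where d: "d > 0" "\<And>s'. dist s' s < d \<Longrightarrow> dist (?g s' x) (?g s x) < e / 2"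
    using continuous_segment[OF assms, of x, unfolded continuous_on_iff] by (metis UNIV_I)
  have "dist (?g s' x') (?g s x) < e" if "dist (s', x') (s, x) < min d (e / 2)" for s' x'
  proof -
    have "dist s' s < d" "dist x' x < e / 2"
      using that dist_fst_le[of "(s', x')" "(s, x)"] dist_snd_le[of "(s', x')" "(s, x)"] by auto
    moreover have "dist (?g s' x') (?g s' x) \<le> dist x' x"
      using norm_segment_le[OF assms, of "x' - x" s'] linear_diff[OF linear_segment[OF assms, of s'], of x' x]
      by (simp add: dist_norm del: minus_bcontfun.rep_eq)
    ultimately show ?thesis
      using d(2)[of s'] dist_triangle[of "?g s' x'" "?g s x" "?g s' x"] by linarith
  qed
  with d(1) e show "\<exists>d>0. \<forall>z'\<in>UNIV. dist z' z < d \<longrightarrow>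
      dist (case z' of (s, x) \<Rightarrow> ?g s x) (case z of (s, x) \<Rightarrow> ?g s x) < e"
    unfolding z by (intro exI[of _ "min d (e / 2)"]) auto
qed

section \<open>Back to the history space\<close>

lemma multilinear_norm_le_subset: "mlin_norm_le j L c \<Longrightarrow> multilinear_norm_le X j L c"
  by (simp add: multilinear_norm_le_def)

lemma bounded_multilinear_on_subset:
  assumes "bdd_mlin j L"
  shows "bounded_multilinear_on X j L"
  unfolding bounded_multilinear_on_def
proof (intro conjI allI impI ballI)
  note * = assms[unfolded bounded_multilinear_on_def]
  fix vs i assume vs: "length vs = j \<and> set vs \<subseteq> X \<and> i < j"
  show "L (vs[i := a + b]) = L (vs[i := a]) + L (vs[i := b])" for a b
    using *[THEN conjunct1, rule_format, of vs i] vs by simp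
  show "L (vs[i := c *\<^sub>R a]) = c *\<^sub>R L (vs[i := a])" for a c
    using *[THEN conjunct1, rule_format, of vs i] vs by simp
next
  show "\<exists>K. multilinear_norm_le X j L K"
    using assms multilinear_norm_le_subset unfolding bounded_multilinear_on_def by blast
qed

text \<open>Restricting points to \<open>U\<close> and arguments to \<open>X\<close> weakens every
  condition, and a linear contraction \<open>Q\<close> preserves every bound. \<open>Q\<close> will
  be the segment map at a fixed time.\<close>

lemma frechet_derivatives_contraction:
  fixes Q :: "'b::real_normed_vector \<Rightarrow> 'c::real_normed_vector"
  assumes Q: "linear Q" "\<And>z. norm (Q z) \<le> norm z" and "U \<subseteq> V"
    and bE: "\<And>i x. i \<le> k \<Longrightarrow> x \<in> V \<Longrightarrow> bdd_mlin i (E i x)"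
    and dE: "\<And>i. i < k \<Longrightarrow> multi_deriv i V (E i) (E (Suc i))"
    and g: "\<And>x. x \<in> U \<Longrightarrow> Q (E 0 x []) = g x"
  shows "has_frechet_derivatives_on X k U g (\<lambda>j x vs. Q (E j x vs))"
proof -
  have mn: "mlin_norm_le j (\<lambda>vs. Q (L vs)) c" if "mlin_norm_le j L c" for j c and L :: "'a list \<Rightarrow> 'b"
    unfolding mlin_norm_le_iff using order_trans[OF Q(2) mlin_norm_le_D[OF that]] by blast
  have "bdd_mlin j (\<lambda>vs. Q (L vs))" if "bdd_mlin j L" for j and L :: "'a list \<Rightarrow> 'b"
    using that mn unfolding bdd_mlin_iff by (metis linear_add[OF Q(1)] linear_scale[OF Q(1)])
  then have "bounded_multilinear_on X j (\<lambda>vs. Q (E j x vs))" if "j \<le> k" "x \<in> U" for j x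
    using bE[OF that(1), of x] that assms(3) bounded_multilinear_on_subset by blast
  moreover have "\<forall>\<^sub>F y in at x within U. multilinear_norm_le X j
      (\<lambda>vs. Q (E j y vs) - Q (E j x vs) - Q (E (Suc j) x ((y - x) # vs))) (\<epsilon> * norm (y - x))"
    if "j < k" "x \<in> U" "\<epsilon> > 0" for j x \<epsilon>
  proof -
    have "\<forall>\<^sub>F y in at x within V. mlin_norm_le j
      (\<lambda>vs. E j y vs - E j x vs - E (Suc j) x ((y - x) # vs)) (\<epsilon> * norm (y - x))"
      using dE[OF that(1)] that assms(3) unfolding multi_deriv_def by blast
    then have "\<forall>\<^sub>F y in at x within U. mlin_norm_le j
      (\<lambda>vs. E j y vs - E j x vs - E (Suc j) x ((y - x) # vs)) (\<epsilon> * norm (y - x))"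
      using at_le[OF assms(3)] by (rule filter_leD[rotated])
    then show ?thesis
    proof (rule eventually_mono)
      fix y assume "mlin_norm_le j (\<lambda>vs. E j y vs - E j x vs - E (Suc j) x ((y - x) # vs)) (\<epsilon> * norm (y - x))"
      from mn[OF this] have "mlin_norm_le j
        (\<lambda>vs. Q (E j y vs) - Q (E j x vs) - Q (E (Suc j) x ((y - x) # vs))) (\<epsilon> * norm (y - x))"
        by (simp add: linear_diff[OF Q(1)])
      then show "multilinear_norm_le X j
        (\<lambda>vs. Q (E j y vs) - Q (E j x vs) - Q (E (Suc j) x ((y - x) # vs))) (\<epsilon> * norm (y - x))"
        by (rule multilinear_norm_le_subset)
    qed
  qed
  ultimately show ?thesis
    unfolding has_frechet_derivatives_on_def using g by blast
qed

lemma frechet_cont_contraction: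
  fixes Q :: "'b::real_normed_vector \<Rightarrow> 'c::real_normed_vector"
  assumes Q: "linear Q" "\<And>z. norm (Q z) \<le> norm z" and "U \<subseteq> V"
    and "multi_cont k V E" "x \<in> U" "\<epsilon> > 0"
  shows "\<forall>\<^sub>F y in at x within U. multilinear_norm_le X k (\<lambda>vs. Q (E y vs) - Q (E x vs)) \<epsilon>"
proof -
  have "\<forall>\<^sub>F y in at x within V. mlin_norm_le k (\<lambda>vs. E y vs - E x vs) \<epsilon>"
    using assms(3-6) unfolding multi_cont_def by blast
  then have "\<forall>\<^sub>F y in at x within U. mlin_norm_le k (\<lambda>vs. E y vs - E x vs) \<epsilon>"
    using at_le[OF assms(3)] by (rule filter_leD[rotated])
  then show ?thesis
  proof (rule eventually_mono)
    fix y assume *: "mlin_norm_le k (\<lambda>vs. E y vs - E x vs) \<epsilon>"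
    have "norm (Q (E y vs) - Q (E x vs)) \<le> \<epsilon> * prod_list (map norm vs)" if "length vs = k" for vs
      using mlin_norm_le_D[OF * that] Q(2)[of "E y vs - E x vs"] by (simp add: linear_diff[OF Q(1)])
    then show "multilinear_norm_le X k (\<lambda>vs. Q (E y vs) - Q (E x vs)) \<epsilon>"
      by (simp add: multilinear_norm_le_def)
  qed
qed

section \<open>Solving the fixed point equation\<close>

text \<open>The radii are nested: initial values lie within \<open>\<delta> / 8\<close> of
  \<open>u\<close>, iterates in the complete closed ball of radius \<open>\<delta> / 4\<close>, the
  calculus takes place in the open \<open>V\<close> of radius \<open>\<delta> / 2\<close>, and the
  segments of functions in \<open>V\<close> stay in the ball of radius \<delta> where
  \<open>F\<close> is Lipschitz. One \<open>T\<close> serves all initial values.\<close>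

lemma local_solution_map:
  fixes F :: "(real \<Rightarrow>\<^sub>C (real^'n)) \<Rightarrow> real^'n"
  assumes h: "h > 0" and op: "open \<Omega>" and F: "C_multi (Suc k) 0 \<Omega> (\<lambda>x vs. F x)"
    and u: "u \<in> \<Omega>" "u \<in> history_space h"
  obtains T \<delta> \<psi> where "T > 0" "\<delta> > 0"
    "C_multi (Suc k) 0 (ball u \<delta>) (\<lambda>w vs. \<psi> w)"
    "\<And>w r. w \<in> ball u \<delta> \<Longrightarrow> r \<in> {0..T} \<Longrightarrow> segment h (apply_bcontfun (\<psi> w)) r \<in> \<Omega>"
    "\<And>w s. w \<in> ball u \<delta> \<Longrightarrow> apply_bcontfun (\<psi> w) s =
      apply_bcontfun w s + integral {0..clamp 0 T s} (\<lambda>r. F (segment h (apply_bcontfun (\<psi> w)) r))"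
proof -
  obtain \<delta> L where \<delta>: "\<delta> > 0" and L: "L \<ge> 0" and sub: "ball u \<delta> \<subseteq> \<Omega>"
    and lip: "\<And>x y. x \<in> ball u \<delta> \<Longrightarrow> y \<in> ball u \<delta> \<Longrightarrow> norm (F x - F y) \<le> L * norm (x - y)"
    by (rule C_multi_locally_lipschitz[OF op F u(1)]) (rule that)
  \<comment> \<open>Bounds \<open>F\<close> on the ball, by its value at the centre and the
    Lipschitz constant.\<close>
  define B where "B = norm (F u) + L * \<delta>"
  have B: "B \<ge> 0" using L \<delta> by (simp add: B_def)
  have bound: "norm (F x) \<le> B" if x: "x \<in> ball u \<delta>" for x
  proof -
    have "norm (F x - F u) \<le> L * norm (x - u)" using lip[OF x, of u] \<delta> by simp
    also have "\<dots> \<le> L * \<delta>" using x L by (intro mult_left_mono) (auto simp: dist_norm norm_minus_commute)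
    finally show ?thesis using norm_triangle_sub[of "F x" "F u"] by (simp add: B_def)
  qed
  have "\<delta> / 2 > 0" using \<delta> by simp
  from continuous_segment[OF h, of u, unfolded continuous_on_iff, rule_format, OF UNIV_I this, of 0]
  obtain d where d: "d > 0" "\<And>r. dist r 0 < d \<Longrightarrow> dist (segment h (apply_bcontfun u) r) u < \<delta> / 2"
    unfolding segment_history[OF h u(2)] by blast
  \<comment> \<open>The three entries keep the segments of \<open>u\<close> within
    \<open>\<delta> / 2\<close> of \<open>u\<close>, make \<open>K\<close> a contraction with
    constant \<open>1/2\<close>, and bound \<open>K\<close> by \<open>\<delta> / 8\<close>; each
    \<open>+ 1\<close> avoids division by zero.\<close>
  define T where "T = min (d / 2) (min (1 / (2 * (L + 1))) (\<delta> / (8 * (B + 1))))"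
  have T: "T > 0" "T < d" "T \<le> 1 / (2 * (L + 1))" "T \<le> \<delta> / (8 * (B + 1))"
    using d(1) L B \<delta> by (auto simp: T_def min_le_iff_disj min_less_iff_disj)
  have "T * (2 * (L + 1)) \<le> 1" using T(3) L by (simp add: pos_le_divide_eq)
  then have TL: "T * L \<le> 1/2" using T(1) by (simp add: algebra_simps)
  have "T * (8 * (B + 1)) \<le> \<delta>" using T(4) B by (simp add: pos_le_divide_eq)
  then have TB: "T * B \<le> \<delta> / 8" using T(1) by (simp add: algebra_simps)
  define S where "S r x = segment h (apply_bcontfun x) (clamp 0 T r)" for r and x :: "real \<Rightarrow>\<^sub>C (real^'n)"
  interpret S: contraction_curve S
    using contraction_curve_segment[OF h, of T] T(1) by (simp add: S_def[abs_def])
  define V where "V = ball u (\<delta> / 2)"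
  have SV: "S r x \<in> ball u \<delta>" if x: "x \<in> V" for r x
  proof -
    have c: "clamp 0 T r \<in> {0..T}" using T(1) by (intro clamp_real_mem) simp
    have "dist (S r u) u < \<delta> / 2" unfolding S_def using c T(2) by (intro d(2)) simp
    moreover have "dist (S r x) (S r u) \<le> dist x u"
      using S.norm_le[of r "x - u"] linear_diff[OF S.linear, of r x u] by (simp add: dist_norm)
    moreover have "dist x u < \<delta> / 2" using x by (simp add: V_def dist_commute)
    ultimately show ?thesis
      using dist_triangle[of "S r x" u "S r u"] by (simp add: dist_commute)
  qed
  then have ran: "range (\<lambda>r. S r x) \<subseteq> \<Omega>" if "x \<in> V" for x
    using sub that by blast
  define N where "N x = S.superpose (\<lambda>x vs. F x) x []" for x
  have N: "apply_bcontfun (N x) r = F (S r x)" if "x \<in> V" for x r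
    unfolding N_def
    by (rule S.superpose_apply[OF op C_multi_cont[OF F] C_multi_bml[OF F] ran[OF that]]) auto
  have CN: "C_multi (Suc k) 0 V (\<lambda>x vs. N x)"
    by (rule C_multi_cong[OF _ S.C_multi_superpose[OF op F ran]]) (auto simp: N_def)
  define K where "K x = integral_op T (N x)" for x
  have T0: "T \<ge> 0" using T(1) by simp
  note blK = bounded_linear_integral_op[OF T0]
  have CK: "C_multi (Suc k) 0 V (\<lambda>x vs. K x)"
    unfolding K_def by (rule C_multi_linear[OF blK CN])
  have lipK: "norm (K x - K y) \<le> norm (x - y) / 2" if xy: "x \<in> V" "y \<in> V" for x y
  proof -
    have "norm (N x - N y) \<le> L * norm (x - y)"
    proof (rule norm_bound)
      fix r
      have "norm (F (S r x) - F (S r y)) \<le> L * norm (S r x - S r y)"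
        using xy by (intro lip SV)
      also have "\<dots> \<le> L * norm (x - y)"
        using S.norm_le[of r "x - y"] linear_diff[OF S.linear, of r x y] L by (intro mult_left_mono) auto
      finally show "norm (apply_bcontfun (N x - N y) r) \<le> L * norm (x - y)"
        using xy by (simp add: N)
    qed
    then have "T * norm (N x - N y) \<le> T * (L * norm (x - y))" using T0 by (rule mult_left_mono)
    moreover have "norm (K x - K y) \<le> T * norm (N x - N y)"
      using norm_integral_op_le[OF T0, of "N x - N y"]
      by (simp add: K_def linear_simps(2)[OF blK])
    moreover have "T * (L * norm (x - y)) \<le> 1/2 * norm (x - y)"
      using mult_right_mono[OF TL norm_ge_zero[of "x - y"]] by simp
    ultimately show ?thesis by linarith
  qed
  have boundK: "norm (K x) \<le> \<delta> / 8" if "x \<in> V" for x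
  proof -
    have "norm (N x) \<le> B" by (rule norm_bound) (simp only: N[OF that] bound[OF SV[OF that]])
    then have "T * norm (N x) \<le> T * B" using T0 by (rule mult_left_mono)
    then show ?thesis using norm_integral_op_le[OF T0, of "N x"] TB by (simp add: K_def)
  qed
  have cV: "cball u (\<delta> / 4) \<subseteq> V" using \<delta> by (auto simp: V_def)
  \<comment> \<open>\<open>w\<close> and \<open>K x\<close> each contribute at most
    \<open>\<delta> / 8\<close> to the distance from \<open>u\<close>, so the closed ball of radius
    \<open>\<delta> / 4\<close> is mapped into itself.\<close>
  have "\<exists>x. x \<in> V \<and> x = w + K x" if w: "w \<in> ball u (\<delta> / 8)" for w
  proof -
    have "\<exists>!x. x \<in> cball u (\<delta> / 4) \<and> w + K x = x"
    proof (rule Banach_fix[where c = "1/2"])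
      show "complete (cball u (\<delta> / 4))" by (simp add: complete_eq_closed)
      show "cball u (\<delta> / 4) \<noteq> {}" using \<delta> by simp
      show "(\<lambda>x. w + K x) ` cball u (\<delta> / 4) \<subseteq> cball u (\<delta> / 4)"
      proof (rule image_subsetI)
        fix x assume "x \<in> cball u (\<delta> / 4)"
        then have "norm (K x) \<le> \<delta> / 8" using cV boundK by blast
        moreover have "norm (w - u) \<le> \<delta> / 8" using w by (simp add: dist_norm norm_minus_commute)
        ultimately have "norm ((w - u) + K x) \<le> \<delta> / 8 + \<delta> / 8" by (intro norm_triangle_mono)
        moreover have "norm ((w - u) + K x) = dist u (w + K x)"
          by (simp add: dist_norm norm_minus_commute algebra_simps)
        ultimately show "w + K x \<in> cball u (\<delta> / 4)" by simp
      qed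
      show "dist (w + K x) (w + K y) \<le> 1/2 * dist x y"
        if "x \<in> cball u (\<delta> / 4)" "y \<in> cball u (\<delta> / 4)" for x y
      proof -
        have "x \<in> V" "y \<in> V" using that cV by blast+
        from lipK[OF this] show ?thesis by (simp add: dist_norm)
      qed
    qed auto
    then show ?thesis using cV by (metis subsetD)
  qed
  then obtain \<psi> where \<psi>: "\<And>w. w \<in> ball u (\<delta> / 8) \<Longrightarrow> \<psi> w \<in> V"
    "\<And>w. w \<in> ball u (\<delta> / 8) \<Longrightarrow> \<psi> w = w + K (\<psi> w)" by metis
  have C\<psi>: "C_multi (Suc k) 0 (ball u (\<delta> / 8)) (\<lambda>w vs. \<psi> w)"
  proof (rule C_multi_fixed_point[OF _ open_ball CK])
    show "open V" by (simp add: V_def)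
  qed (fact lipK \<psi>)+
  have Sr: "S r x = segment h (apply_bcontfun x) r" if "r \<in> {0..T}" for r x
    using that by (simp add: S_def clamp_real)
  have Nr: "apply_bcontfun (N (\<psi> w)) r = F (segment h (apply_bcontfun (\<psi> w)) r)"
    if "w \<in> ball u (\<delta> / 8)" "r \<in> {0..T}" for w r
    using N[OF \<psi>(1)[OF that(1)]] Sr[OF that(2)] by simp
  show ?thesis
  proof (rule that[OF T(1) _ C\<psi>])
    show "\<delta> / 8 > 0" using \<delta> by simp
    fix w assume w: "w \<in> ball u (\<delta> / 8)"
    show "segment h (apply_bcontfun (\<psi> w)) r \<in> \<Omega>" if "r \<in> {0..T}" for r
      using SV[OF \<psi>(1)[OF w], of r] sub Sr[OF that] by auto
    fix s
    have c: "clamp 0 T s \<in> {0..T}" using T0 by (rule clamp_real_mem)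
    have "apply_bcontfun (\<psi> w) s = apply_bcontfun (w + K (\<psi> w)) s"
      using \<psi>(2)[OF w] by simp
    also have "\<dots> = apply_bcontfun w s + integral {0..clamp 0 T s} (apply_bcontfun (N (\<psi> w)))"
      by (simp add: K_def integral_op_apply[OF T0])
    also have "integral {0..clamp 0 T s} (apply_bcontfun (N (\<psi> w))) =
        integral {0..clamp 0 T s} (\<lambda>r. F (segment h (apply_bcontfun (\<psi> w)) r))"
      using c by (intro integral_cong Nr[OF w]) auto
    finally show "apply_bcontfun (\<psi> w) s = apply_bcontfun w s +
        integral {0..clamp 0 T s} (\<lambda>r. F (segment h (apply_bcontfun (\<psi> w)) r))" .
  qed
qed

text \<open>The fundamental theorem gives the derivative within \<open>{0..T}\<close>. In the
  interior this is the two-sided derivative, and at \<open>0\<close> it is the right derivative that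
  \<open>dde_solution\<close> asks for.\<close>

lemma integral_equation_imp_dde_solution:
  fixes f :: "(real \<Rightarrow>\<^sub>C (real^'n)) \<Rightarrow> real^'n" and x w :: "real \<Rightarrow>\<^sub>C (real^'n)"
  assumes h: "h > 0" and T: "T > 0" and cf: "continuous_on \<Omega> f" and w: "w \<in> history_space h"
    and seg: "\<And>r. r \<in> {0..T} \<Longrightarrow> segment h (apply_bcontfun x) r \<in> \<Omega>"
    and eq: "\<And>s. apply_bcontfun x s = apply_bcontfun w s +
      integral {0..clamp 0 T s} (\<lambda>r. f (segment h (apply_bcontfun x) r))"
  shows "dde_solution h \<Omega> f w (ereal T) (apply_bcontfun x)"
proof -
  let ?g = "\<lambda>r. f (segment h (apply_bcontfun x) r)"
  have cg: "continuous_on {0..T} ?g"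
    by (rule continuous_on_compose2[OF cf continuous_on_subset[OF continuous_segment[OF h]]])
      (use seg in auto)
  \<comment> \<open>Elements of the history space are constant to the right of \<open>0\<close>, so
    for positive times \<open>w\<close> contributes just the initial value
    \<open>w 0\<close>.\<close>
  have w0: "apply_bcontfun w s = apply_bcontfun w 0" if "s \<ge> 0" for s
  proof -
    have "apply_bcontfun w s = ext_cont (apply_bcontfun w) (-h) 0 s"
      using w unfolding history_space_def by (metis (mono_tags) mem_Collect_eq)
    then show ?thesis using that h by (simp add: ext_cont_def clamp_real)
  qed
  have neg: "apply_bcontfun x s = apply_bcontfun w s" if "s \<le> 0" for s
    using eq[of s] that T by (simp add: clamp_real)
  have pos: "apply_bcontfun x s = apply_bcontfun w 0 + integral {0..s} ?g" if "s \<in> {0..T}" for s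
    using eq[of s] w0[of s] that by (simp add: clamp_real)
  have der: "(apply_bcontfun x has_vector_derivative ?g s) (at s within {0..T})" if s: "s \<in> {0..T}" for s
  proof (rule has_vector_derivative_transform_within[where d = 1])
    show "((\<lambda>s. apply_bcontfun w 0 + integral {0..s} ?g) has_vector_derivative ?g s) (at s within {0..T})"
      using has_vector_derivative_add[OF has_vector_derivative_const integral_has_vector_derivative[OF cg s]]
      by simp
  qed (use pos s in auto)
  have seg0: "segment h (apply_bcontfun x) 0 = w"
    using segment_cong[OF h, of 0 "apply_bcontfun x" "apply_bcontfun w"] neg segment_history[OF h w] by simp
  show ?thesis
  proof (rule dde_solutionI[OF h _ cf])
    show "(apply_bcontfun x has_vector_derivative f w) (at_right 0)"
      using der[of 0] T seg0 by (simp add: at_within_Icc_at_right)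
    fix t assume t: "0 < t" "ereal t < ereal T"
    then show "(apply_bcontfun x has_vector_derivative f (segment h (apply_bcontfun x) t)) (at t)"
      using der[of t] at_within_Icc_at[of 0 t T] by simp
  qed (use T neg seg in auto)
qed

section \<open>Smoothness of the semiflow\<close>

theorem proposition34:
  fixes h :: real and k :: nat
    and \<Omega> :: "(real \<Rightarrow>\<^sub>C (real^'n)) set"
    and f :: "(real \<Rightarrow>\<^sub>C (real^'n)) \<Rightarrow> real^'n"
    and u :: "real \<Rightarrow>\<^sub>C (real^'n)"
  assumes "h > 0" and "k \<ge> 1"
    and "openin (top_of_set (history_space h)) \<Omega>"
    and "C_k_on (history_space h) k \<Omega> f"
    and "u \<in> \<Omega>"
  shows "\<exists>t>0. \<exists>U.
           openin (top_of_set (history_space h)) U \<and> u \<in> U \<and>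
           U \<subseteq> {w. (t, w) \<in> semiflow_domain h \<Omega> f} \<and>
           C_k_on (history_space h) k U (semiflow h \<Omega> f t) \<and>
           (\<exists>D. (\<forall>s\<in>{0..t}. has_frechet_derivatives_on (history_space h) k U
                              (semiflow h \<Omega> f s) (D s)) \<and>
                (\<forall>j\<le>k. \<forall>vs. length vs = j \<and> set vs \<subseteq> history_space h \<longrightarrow>
                   continuous_on ({0..t} \<times> U) (\<lambda>(s, w). D s j w vs)))"
proof -
  note h = assms(1)
  let ?X = "history_space h :: (real \<Rightarrow>\<^sub>C (real^'n)) set"
  let ?seg = "\<lambda>s x. segment h (apply_bcontfun x) s :: real \<Rightarrow>\<^sub>C (real^'n)"
  \<comment> \<open>\<Omega> is open only relative to the history space; its preimage under the
    projection is open in the whole space.\<close>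
  define \<Omega>' where "\<Omega>' = ?seg 0 -` \<Omega>"
  define F where "F x = f (?seg 0 x)" for x
  \<comment> \<open>At least one derivative is required: it yields the Lipschitz bounds behind both
    the contraction and uniqueness.\<close>
  obtain k' where k: "k = Suc k'" using assms(2) by (cases k) auto
  obtain G where G: "open G" "\<Omega> = ?X \<inter> G" using assms(3) unfolding openin_open by blast
  have "\<Omega>' = ?seg 0 -` G"
    using segment_mem_bcontfun[OF h] G(2) by (auto simp: \<Omega>'_def)
  then have op: "open \<Omega>'"
    using open_vimage[OF G(1) linear_continuous_on[OF bounded_linear_segment[OF h]]] by simp
  have CF: "C_multi k 0 \<Omega>' (\<lambda>x vs. F x)"
    unfolding \<Omega>'_def F_def
    by (rule C_k_on_imp_C_multi[OF assms(4) linear_segment[OF h] segment_mem_bcontfun[OF h] norm_segment_le[OF h]])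
  have \<Omega>X: "x \<in> ?X" and seg0: "?seg 0 x = x" and \<Omega>\<Omega>': "x \<in> \<Omega>'" and Ff: "F x = f x"
    if "x \<in> \<Omega>" for x
    using that G(2) segment_history[OF h, of x] by (auto simp: \<Omega>'_def F_def)
  have "continuous_on \<Omega>' F"
    using C_multi_cont[OF CF] by (simp add: multi_cont_0_continuous_on)
  then have "continuous_on \<Omega> F" by (rule continuous_on_subset) (use \<Omega>\<Omega>' in blast)
  then have cf: "continuous_on \<Omega> f" by (rule continuous_on_eq) (rule Ff)
  have lip: "locally_lipschitz \<Omega> f"
    unfolding locally_lipschitz_def
  proof
    fix p assume "p \<in> \<Omega>"
    from C_multi_locally_lipschitz[OF op CF[unfolded k] \<Omega>\<Omega>'[OF this]] obtain \<delta> L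
      where "\<delta> > 0" "L \<ge> 0"
        "\<And>x y. x \<in> ball p \<delta> \<Longrightarrow> y \<in> ball p \<delta> \<Longrightarrow> norm (F x - F y) \<le> L * norm (x - y)" by metis
    moreover from this have "\<forall>x\<in>\<Omega> \<inter> ball p \<delta>. \<forall>y\<in>\<Omega> \<inter> ball p \<delta>.
        norm (f x - f y) \<le> L * norm (x - y)"
      by (metis Ff IntE)
    ultimately show "\<exists>\<delta>>0. \<exists>L\<ge>0. \<forall>x\<in>\<Omega> \<inter> ball p \<delta>. \<forall>y\<in>\<Omega> \<inter> ball p \<delta>.
        norm (f x - f y) \<le> L * norm (x - y)"
      by blast
  qed
  obtain T \<delta> \<psi> where T: "T > 0" and \<delta>: "\<delta> > 0"
    and C\<psi>: "C_multi (Suc k') 0 (ball u \<delta>) (\<lambda>w vs. \<psi> w)"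
    and mem': "\<And>w r. w \<in> ball u \<delta> \<Longrightarrow> r \<in> {0..T} \<Longrightarrow> ?seg r (\<psi> w) \<in> \<Omega>'"
    and eq': "\<And>w s. w \<in> ball u \<delta> \<Longrightarrow> apply_bcontfun (\<psi> w) s =
      apply_bcontfun w s + integral {0..clamp 0 T s} (\<lambda>r. F (?seg r (\<psi> w)))"
    by (rule local_solution_map[OF h op CF[unfolded k] \<Omega>\<Omega>'[OF assms(5)] \<Omega>X[OF assms(5)]]) (rule that)
  \<comment> \<open>A segment already lies in the history space, where the projection is the
    identity, so membership in \<open>\<Omega>'\<close> is membership in \<Omega>.\<close>
  have mem: "?seg r (\<psi> w) \<in> \<Omega>" if "w \<in> ball u \<delta>" "r \<in> {0..T}" for w r
    using mem'[OF that] segment_history[OF h segment_mem_bcontfun[OF h, of "\<psi> w" r]] by (simp add: \<Omega>'_def)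
  have eq: "apply_bcontfun (\<psi> w) s =
      apply_bcontfun w s + integral {0..clamp 0 T s} (\<lambda>r. f (?seg r (\<psi> w)))"
    if w: "w \<in> ball u \<delta>" for w s
  proof -
    have "clamp 0 T s \<in> {0..T}" using T by (intro clamp_real_mem) simp
    then have "integral {0..clamp 0 T s} (\<lambda>r. F (?seg r (\<psi> w))) =
        integral {0..clamp 0 T s} (\<lambda>r. f (?seg r (\<psi> w)))"
      using mem[OF w] by (intro integral_cong Ff) auto
    with eq'[OF w, of s] show ?thesis by simp
  qed
  \<comment> \<open>\<psi> is defined on a ball of the whole space, but only histories in \<Omega>
    are admissible initial values.\<close>
  define U where "U = ball u \<delta> \<inter> \<Omega>"
  \<comment> \<open>The constructed solution is known to solve the equation on
    \<open>[-h, T)\<close>, so the closed interval \<open>[0, t]\<close> has to end before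
    \<open>T\<close>.\<close>
  define t where "t = T / 2"
  have t: "0 < t" "t < T" using T by (auto simp: t_def)
  have sol: "dde_solution h \<Omega> f w (ereal T) (apply_bcontfun (\<psi> w))" if "w \<in> U" for w
    by (rule integral_equation_imp_dde_solution[OF h T cf])
      (use that mem eq \<Omega>X in \<open>auto simp: U_def\<close>)
  have flow: "semiflow h \<Omega> f s w = ?seg s (\<psi> w)" if "w \<in> U" "s \<in> {0..t}" for w s
    unfolding semiflow_def
    by (rule segment_cong[OF h], rule the_dde_solution_eq(2)[OF h lip cf sol[OF that(1)]])
      (use that t in auto)
  obtain E where E: "E 0 = (\<lambda>w vs. \<psi> w)"
    and bE: "\<And>i x. i \<le> k \<Longrightarrow> x \<in> ball u \<delta> \<Longrightarrow> bdd_mlin i (E i x)"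
    and dE: "\<And>i. i < k \<Longrightarrow> multi_deriv i (ball u \<delta>) (E i) (E (Suc i))"
    and cE: "\<And>i. i \<le> k \<Longrightarrow> multi_cont i (ball u \<delta>) (E i)"
    using C_multi_derivatives[OF C\<psi>] unfolding k by (elim exE conjE) simp
  define D where "D s j w vs = ?seg s (E j w vs)" for s j w vs
  have UV: "U \<subseteq> ball u \<delta>" by (simp add: U_def)
  have der: "has_frechet_derivatives_on ?X k U (semiflow h \<Omega> f s) (D s)" if "s \<in> {0..t}" for s
    unfolding D_def[abs_def]
    by (rule frechet_derivatives_contraction[OF linear_segment[OF h] norm_segment_le[OF h] UV])
      (use bE dE E flow that in auto)
  show ?thesis
  proof (intro exI[of _ t] conjI exI[of _ U] exI[of _ D] ballI allI impI)
    show "openin (top_of_set ?X) U"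
      unfolding U_def using assms(3) by (simp add: Int_commute openin_Int_open)
    show "u \<in> U" using \<delta> assms(5) by (simp add: U_def)
    show "U \<subseteq> {w. (t, w) \<in> semiflow_domain h \<Omega> f}"
    proof
      fix w assume w: "w \<in> U"
      have "ereal t < ereal T" using t by simp
      also have "\<dots> \<le> lifetime h \<Omega> f w" by (rule the_dde_solution_eq(1)[OF h lip cf sol[OF w]])
      finally show "w \<in> {w. (t, w) \<in> semiflow_domain h \<Omega> f}"
        using w t by (simp add: semiflow_domain_def U_def)
    qed
    show "C_k_on ?X k U (semiflow h \<Omega> f t)"
      unfolding C_k_on_def
    proof (intro exI[of _ "D t"] conjI ballI allI impI)
      show "has_frechet_derivatives_on ?X k U (semiflow h \<Omega> f t) (D t)" using der t by simp
      show "\<forall>\<^sub>F y in at x within U. multilinear_norm_le ?X k (\<lambda>vs. D t k y vs - D t k x vs) \<epsilon>"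
        if "x \<in> U" "\<epsilon> > 0" for x \<epsilon>
        unfolding D_def
        by (rule frechet_cont_contraction[OF linear_segment[OF h] norm_segment_le[OF h] UV cE[OF order_refl] that])
    qed
  next
    fix j and vs :: "(real \<Rightarrow>\<^sub>C (real^'n)) list"
    assume j: "j \<le> k" and vs: "length vs = j \<and> set vs \<subseteq> ?X"
    have "continuous_on U (\<lambda>w. E j w vs)"
      by (rule continuous_on_subset[OF multi_cont_apply[OF cE[OF j]] UV]) (use vs in simp)
    then have "continuous_on ({0..t} \<times> U) (\<lambda>z. E j (snd z) vs)"
      by (rule continuous_on_compose2) (auto intro: continuous_on_snd continuous_on_id)
    then have "continuous_on ({0..t} \<times> U) (\<lambda>z. (fst z, E j (snd z) vs))"
      by (intro continuous_on_Pair continuous_on_fst continuous_on_id)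
    from continuous_on_compose2[OF continuous_segment_pair[OF h] this]
    show "continuous_on ({0..t} \<times> U) (\<lambda>(s, w). D s j w vs)"
      by (simp add: D_def split_beta)
  qed (use der t in auto)
qed

end
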